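(* Let $H$ be a reflexive digraph, $G$ a reflexive digraph, and $\alpha,\beta:G\to H$ homomorphisms. One can find in polynomial time an $H$-recoloring sequence from $\alpha$ to $\beta$ that satisfies the push-or-pull property, or conclude correctly that there is none.
   Context: Digraphs may have loops; reflexive means every vertex has a loop; $G,H$ are weakly connected with at least two vertices. Homomorphisms map arcs to arcs. Two homomorphisms $\phi,\psi:G\to H$ are adjacent in $\mathrm{Hom}_1(G,H)$ if they differ on exactly one vertex of $G$ and for every arc $uv$ of $G$, $\phi(u)\psi(v)$ is an arc of $H$. Here an $H$-recoloring sequence from $\alpha$ to $\beta$ is a sequence $\sigma_0=\alpha,\dots,\sigma_\ell=\beta$ of homomorphisms $G\to H$ with consecutive ones adjacent in $\mathrm{Hom}_1(G,H)$. It satisfies the push-or-pull property if whenever a vertex $u$ changes color from $a$ to $b$, every neighbor of $u$ (in the underlying undirected graph of $G$) has color $a$ or $b$. *)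

theory Defs
  imports
    "HOL-Computational_Algebra.Polynomial"
    "HOL-Library.FuncSet"
    "Graph_Theory.Graph_Theory"
begin

section \<open>Reconfiguration of digraph homomorphisms\<close>

text \<open>
  A digraph of type \<^typ>\<open>'a pair_pre_digraph\<close> has at most one arc from one vertex to another,
  but loops and pairs of opposite arcs are allowed.
\<close>

definition reflexive_digraph :: "'a pair_pre_digraph \<Rightarrow> bool" where
  "reflexive_digraph G \<longleftrightarrow> (\<forall>v \<in> pverts G. (v, v) \<in> parcs G)"

text \<open>
  The library notion \<^term>\<open>Digraph_Component.connected\<close> is weak connectivity: strong
  connectivity of the symmetric closure.  It is qualified because the topological
  notion has the same name.
\<close>

definition admissible_digraph :: "'a pair_pre_digraph \<Rightarrow> bool" where
  "admissible_digraph G \<longleftrightarrow>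
     pair_fin_digraph G \<and> Digraph_Component.connected (with_proj G) \<and> 2 \<le> card (pverts G)"

text \<open>
  Homomorphisms are extensional functions, so that two of them are equal as soon as
  they agree on the vertices.
\<close>

definition digraph_hom ::
    "'a pair_pre_digraph \<Rightarrow> 'b pair_pre_digraph \<Rightarrow> ('a \<Rightarrow> 'b) set" where
  "digraph_hom G H =
     {\<phi> \<in> pverts G \<rightarrow>\<^sub>E pverts H. \<forall>(u, v) \<in> parcs G. (\<phi> u, \<phi> v) \<in> parcs H}"

text \<open>
  The second condition is not symmetric in the two maps: if \<open>u\<close> has a loop and changes
  colour from \<open>a\<close> to \<open>b\<close>, it requires the arc \<open>ab\<close>, but not the arc \<open>ba\<close>.
\<close>

definition hom1_adj ::
    "'a pair_pre_digraph \<Rightarrow> 'b pair_pre_digraph \<Rightarrow> ('a \<Rightarrow> 'b) \<Rightarrow> ('a \<Rightarrow> 'b) \<Rightarrow> bool" where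
  "hom1_adj G H \<phi> \<psi> \<longleftrightarrow>
     \<phi> \<in> digraph_hom G H \<and> \<psi> \<in> digraph_hom G H \<and>
     (\<exists>!u. u \<in> pverts G \<and> \<phi> u \<noteq> \<psi> u) \<and>
     (\<forall>(u, v) \<in> parcs G. (\<phi> u, \<psi> v) \<in> parcs H)"

definition recoloring_seq ::
    "'a pair_pre_digraph \<Rightarrow> 'b pair_pre_digraph \<Rightarrow> ('a \<Rightarrow> 'b) \<Rightarrow> ('a \<Rightarrow> 'b)
       \<Rightarrow> ('a \<Rightarrow> 'b) list \<Rightarrow> bool" where
  "recoloring_seq G H \<alpha> \<beta> \<sigma> \<longleftrightarrow>
     \<sigma> \<noteq> [] \<and> set \<sigma> \<subseteq> digraph_hom G H \<and> hd \<sigma> = \<alpha> \<and> last \<sigma> = \<beta> \<and>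
     (\<forall>i. Suc i < length \<sigma> \<longrightarrow> hom1_adj G H (\<sigma> ! i) (\<sigma> ! Suc i))"

definition neighbors :: "'a pair_pre_digraph \<Rightarrow> 'a \<Rightarrow> 'a set" where
  "neighbors G u = {v. (u, v) \<in> parcs G \<or> (v, u) \<in> parcs G}"

definition push_or_pull :: "'a pair_pre_digraph \<Rightarrow> ('a \<Rightarrow> 'b) list \<Rightarrow> bool" where
  "push_or_pull G \<sigma> \<longleftrightarrow>
     (\<forall>i u. Suc i < length \<sigma> \<longrightarrow> u \<in> pverts G \<longrightarrow> (\<sigma> ! i) u \<noteq> (\<sigma> ! Suc i) u \<longrightarrow>
        (\<forall>v \<in> neighbors G u. (\<sigma> ! i) v \<in> {(\<sigma> ! i) u, (\<sigma> ! Suc i) u}))"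


section \<open>Polynomial time\<close>

text \<open>
  The machine model is the language WHILE over binary trees (Jones, Computability and
  Complexity from a Programming Perspective).  A variable assignment is charged the size
  of the whole assigned tree, so a program cannot build large trees cheaply by sharing
  subtrees.  With this measure WHILE programs and Turing machines simulate each other
  with polynomial overhead in input size plus running time.
\<close>

datatype bt = Leaf | Node bt bt

fun left :: "bt \<Rightarrow> bt" where
  "left Leaf = Leaf"
| "left (Node l r) = l"

fun right :: "bt \<Rightarrow> bt" where
  "right Leaf = Leaf"
| "right (Node l r) = r"

datatype exp = Var nat | ELeaf | ENode exp exp | ELeft exp | ERight exp

type_synonym store = "nat \<Rightarrow> bt"

primrec eval_exp :: "exp \<Rightarrow> store \<Rightarrow> bt" where
  "eval_exp (Var x) s = s x"
| "eval_exp ELeaf s = Leaf"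
| "eval_exp (ENode e1 e2) s = Node (eval_exp e1 s) (eval_exp e2 s)"
| "eval_exp (ELeft e) s = left (eval_exp e s)"
| "eval_exp (ERight e) s = right (eval_exp e s)"

datatype com =
    Skip
  | Assign nat exp
  | Seq com com
  | If exp com com
  | While exp com

text \<open>
  A judgement \<open>exec c s t s'\<close> says that \<open>c\<close>, started in \<open>s\<close>, halts in \<open>s'\<close> after time
  \<open>t\<close>.  A tree counts as true iff it is not \<^const>\<open>Leaf\<close>; the size of a tree is its
  number of inner nodes.
\<close>

inductive exec :: "com \<Rightarrow> store \<Rightarrow> nat \<Rightarrow> store \<Rightarrow> bool" where
  Skip: "exec Skip s 1 s"
| Assign: "exec (Assign x e) s (1 + size (eval_exp e s)) (s(x := eval_exp e s))"
| Seq: "exec c1 s t1 s' \<Longrightarrow> exec c2 s' t2 s'' \<Longrightarrow> exec (Seq c1 c2) s (t1 + t2) s''"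
| IfTrue: "eval_exp e s \<noteq> Leaf \<Longrightarrow> exec c1 s t s' \<Longrightarrow> exec (If e c1 c2) s (1 + t) s'"
| IfFalse: "eval_exp e s = Leaf \<Longrightarrow> exec c2 s t s' \<Longrightarrow> exec (If e c1 c2) s (1 + t) s'"
| WhileFalse: "eval_exp e s = Leaf \<Longrightarrow> exec (While e c) s 1 s"
| WhileTrue: "eval_exp e s \<noteq> Leaf \<Longrightarrow> exec c s t1 s' \<Longrightarrow> exec (While e c) s' t2 s''
    \<Longrightarrow> exec (While e c) s (1 + t1 + t2) s''"

lemma exec_deterministic:
  "exec c s t s' \<Longrightarrow> exec c s t' s'' \<Longrightarrow> t' = t \<and> s'' = s'"
proof (induction arbitrary: t' s'' rule: exec.induct)
  case (Seq c1 s t1 s1 c2 t2 s2)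
  from Seq.prems show ?case
    by cases (use Seq.IH in blast)
next
  case (WhileTrue e s c t1 s1 t2 s2)
  from WhileTrue.prems show ?case
    by cases (use WhileTrue.hyps WhileTrue.IH in blast)+
qed (erule exec.cases; force)+

text \<open>Input and output are passed in variable 0; all other variables are initially
  \<^const>\<open>Leaf\<close>.\<close>

definition runs :: "com \<Rightarrow> bt \<Rightarrow> nat \<Rightarrow> bt \<Rightarrow> bool" where
  "runs c x t y \<longleftrightarrow> (\<exists>s. exec c ((\<lambda>_. Leaf)(0 := x)) t s \<and> s 0 = y)"


section \<open>Encodings\<close>

text \<open>
  Digraphs on the vertices \<open>0, \<dots>, n - 1\<close> are encoded by adjacency matrices and maps by
  tables of values.  Vertices are written in unary; as the adjacency matrix has \<open>n\<^sup>2\<close>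
  entries, this changes the input size only polynomially.
\<close>

primrec enc_nat :: "nat \<Rightarrow> bt" where
  "enc_nat 0 = Leaf"
| "enc_nat (Suc n) = Node Leaf (enc_nat n)"

primrec enc_bool :: "bool \<Rightarrow> bt" where
  "enc_bool False = Leaf"
| "enc_bool True = Node Leaf Leaf"

primrec enc_list :: "('a \<Rightarrow> bt) \<Rightarrow> 'a list \<Rightarrow> bt" where
  "enc_list f [] = Leaf"
| "enc_list f (x # xs) = Node (f x) (enc_list f xs)"

primrec enc_option :: "('a \<Rightarrow> bt) \<Rightarrow> 'a option \<Rightarrow> bt" where
  "enc_option f None = Leaf"
| "enc_option f (Some x) = Node Leaf (f x)"

definition std_verts :: "nat pair_pre_digraph \<Rightarrow> bool" where
  "std_verts G \<longleftrightarrow> pverts G = {..<card (pverts G)}"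

definition enc_digraph :: "nat pair_pre_digraph \<Rightarrow> bt" where
  "enc_digraph G =
     (let vs = [0..<card (pverts G)]
      in enc_list (\<lambda>u. enc_list (\<lambda>v. enc_bool ((u, v) \<in> parcs G)) vs) vs)"

definition enc_map :: "nat pair_pre_digraph \<Rightarrow> (nat \<Rightarrow> nat) \<Rightarrow> bt" where
  "enc_map G \<phi> = enc_list (\<lambda>v. enc_nat (\<phi> v)) [0..<card (pverts G)]"

definition enc_instance ::
    "nat pair_pre_digraph \<Rightarrow> nat pair_pre_digraph \<Rightarrow> (nat \<Rightarrow> nat) \<Rightarrow> (nat \<Rightarrow> nat) \<Rightarrow> bt" where
  "enc_instance G H \<alpha> \<beta> =
     Node (enc_digraph G) (Node (enc_digraph H) (Node (enc_map G \<alpha>) (enc_map G \<beta>)))"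

definition recoloring_instance ::
    "nat pair_pre_digraph \<Rightarrow> nat pair_pre_digraph \<Rightarrow> (nat \<Rightarrow> nat) \<Rightarrow> (nat \<Rightarrow> nat) \<Rightarrow> bool" where
  "recoloring_instance G H \<alpha> \<beta> \<longleftrightarrow>
     std_verts G \<and> admissible_digraph G \<and> reflexive_digraph G \<and>
     std_verts H \<and> admissible_digraph H \<and> reflexive_digraph H \<and>
     \<alpha> \<in> digraph_hom G H \<and> \<beta> \<in> digraph_hom G H"

definition correct_answer ::
    "nat pair_pre_digraph \<Rightarrow> nat pair_pre_digraph \<Rightarrow> (nat \<Rightarrow> nat) \<Rightarrow> (nat \<Rightarrow> nat)
       \<Rightarrow> (nat \<Rightarrow> nat) list option \<Rightarrow> bool" where
  "correct_answer G H \<alpha> \<beta> ans \<longleftrightarrow>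
     (case ans of
        Some \<sigma> \<Rightarrow> recoloring_seq G H \<alpha> \<beta> \<sigma> \<and> push_or_pull G \<sigma>
      | None \<Rightarrow> \<nexists>\<sigma>. recoloring_seq G H \<alpha> \<beta> \<sigma> \<and> push_or_pull G \<sigma>)"

end

theory Submission
  imports Defs "HOL-Library.Sublist"
begin

text \<open>
  In a push-or-pull recolouring every vertex \<open>v\<close> of \<open>G\<close> traces a walk in \<open>H\<close>. Reduce walks by the rules
  \<open>xx \<rightarrow> x\<close> and \<open>xyx \<rightarrow> x\<close>, so that reduced walks are the vertices of a tree, the universal cover of \<open>H\<close>.
  The lifted colours of adjacent vertices always have distance at most one in this tree. Hence the
  reduced trace \<open>S\<close> of one root vertex determines those of all others, and once all of them are known,
  detours are unnecessary: moving any vertex along its reduced trace whenever the step is valid never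
  gets stuck. It remains to find polynomially many candidates for \<open>S\<close>.

  If every closed walk of \<open>G\<close> has a trivial image under \<open>\<alpha>\<close>, then \<open>\<alpha>\<close> and \<open>\<beta>\<close> lift to maps from \<open>G\<close> into
  the tree. Either their images meet, and \<open>S\<close> is the image under \<open>\<alpha>\<close> of a walk followed by the reverse of
  the image under \<open>\<beta>\<close> of another one, or all vertices cross the segment between the two images, and the
  recolouring can be made to pass through constant maps. The part between the constant maps can be
  replaced by any path in \<open>H\<close>, or in the symmetric part of \<open>H\<close> if only symmetric arcs can be crossed.

  If some closed walk \<open>C\<close> has a nontrivial image \<open>A\<close> under \<open>\<alpha>\<close> and image \<open>B\<close> under \<open>\<beta>\<close>, then \<open>A S = S B\<close>
  and therefore \<open>S\<close> is, up to walks along parts of \<open>C\<close>, a power of \<open>A\<close>. In a shortest recolouring the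
  exponent is small: a long \<open>S\<close> would be periodic, so that some colouring would occur twice.
\<close>

text \<open>Lifted colours of neighbours stay close because a vertex that crosses an edge from a to
  b finds each neighbour at a or b, that is, at an end of this edge. The tree forgets the directions
  of arcs. They come back through \<open>valid\<close>: crossing an arc without reverse arc requires
  that the out-neighbours have crossed already. So reducing the traces does not by itself give a
  recolouring; the validity of the straight moves is proved by comparison with the given
  recolouring, in \<open>feasible_progress\<close>. All cases share one shape of candidate: the
  image under \<alpha> of C^k X, then a path g of H, then the reverse of the image of Y under
  \<beta>, with C a closed walk of G and X, Y prefixes of closed walks. Without nontrivial closed
  walks, k = 0; where the images meet, or with a nontrivial closed walk, g is a single colour. All
  walks of G are built from one table of paths from the root, which keeps the list polynomial. A
  wrong candidate does no harm: every greedy move is checked, so a run that ends in \<beta> is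
  correct whatever candidate produced it.\<close>

section \<open>Functions computable in polynomial time\<close>

class encodable =
  fixes enc :: "'a \<Rightarrow> bt"

instantiation nat :: encodable
begin
definition "enc = enc_nat"
instance ..
end

instantiation bool :: encodable
begin
definition "enc = enc_bool"
instance ..
end

instantiation unit :: encodable
begin
definition enc_unit :: "unit \<Rightarrow> bt" where "enc_unit x = Leaf"
instance ..
end

instantiation list :: (encodable) encodable
begin
definition "enc = enc_list enc"
instance ..
end

instantiation option :: (encodable) encodable
begin
definition "enc = enc_option enc"
instance ..
end

instantiation prod :: (encodable, encodable) encodable
begin
definition enc_prod :: "'a \<times> 'b \<Rightarrow> bt" where "enc_prod x = Node (enc (fst x)) (enc (snd x))"
instance ..
end

lemma enc_simps [simp]:
  "enc (0::nat) = Leaf" "enc (Suc n) = Node Leaf (enc n)"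
  "enc False = Leaf" "enc True = Node Leaf Leaf" "enc () = Leaf"
  "enc [] = Leaf" "enc (a # as) = Node (enc a) (enc as)"
  "enc None = Leaf" "enc (Some a) = Node Leaf (enc a)"
  "enc (a, b) = Node (enc a) (enc b)"
  by (auto simp: enc_nat_def enc_bool_def enc_unit_def enc_list_def enc_option_def enc_prod_def)

lemma enc_eq_Leaf [simp]:
  "enc (b::bool) = Leaf \<longleftrightarrow> \<not> b" "enc (n::nat) = Leaf \<longleftrightarrow> n = 0"
  "enc (xs::'a::encodable list) = Leaf \<longleftrightarrow> xs = []" "enc (a::'a option) = Leaf \<longleftrightarrow> a = None"
  by (cases b, auto) (cases n, auto, cases xs, auto, cases a, auto)

lemma size_enc_nat [simp]: "size (enc (n::nat)) = n"
  by (induction n) auto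

lemma length_le_size_enc: "length xs \<le> size (enc xs)"
  by (induction xs) auto

lemma size_enc_append [simp]: "size (enc (xs @ ys)) = size (enc xs) + size (enc ys)"
  by (induction xs) auto

lemma size_enc_rev [simp]: "size (enc (rev xs)) = size (enc xs)"
  by (induction xs) auto

lemma size_enc_member: "x \<in> set xs \<Longrightarrow> size (enc x) \<le> size (enc xs)"
  by (induction xs) auto

lemma size_enc_list_le:
  "(\<And>x. x \<in> set xs \<Longrightarrow> size (enc x) \<le> b) \<Longrightarrow> length xs \<le> n \<Longrightarrow> size (enc xs) \<le> n * Suc b"
proof (induction xs arbitrary: n)
  case (Cons x xs)
  then obtain m where m: "n = Suc m" "length xs \<le> m" by (cases n) auto
  have "size (enc xs) \<le> m * Suc b" using Cons m by auto
  moreover have "size (enc x) \<le> b" using Cons.prems by auto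
  ultimately show ?case using m by simp
qed simp


subsection \<open>Polynomially bounded functions\<close>

text \<open>The base is at least 2, so raising the exponent absorbs constants, the factor 2 of a
  sum, and an outer polynomial under composition.\<close>

definition pbd :: "('a::encodable \<Rightarrow> nat) \<Rightarrow> bool" where
  "pbd g \<longleftrightarrow> (\<exists>k. \<forall>x. g x \<le> (size (enc x) + 2) ^ k)"

lemma pbd_mono: "pbd g \<Longrightarrow> (\<And>x. f x \<le> g x) \<Longrightarrow> pbd f"
  unfolding pbd_def using le_trans by blast

lemma pbd_const: "pbd (\<lambda>x::'a::encodable. c)"
proof -
  have "c \<le> (size (enc x) + 2) ^ c" for x :: 'a
  proof -
    have "c \<le> 2 ^ c" by (simp add: less_imp_le)
    also have "\<dots> \<le> (size (enc x) + 2) ^ c" by (rule power_mono) auto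
    finally show ?thesis .
  qed
  then show ?thesis unfolding pbd_def by blast
qed

lemma pbd_mult: assumes "pbd f" "pbd g" shows "pbd (\<lambda>x. f x * g x)"
proof -
  obtain k l where "\<forall>x. f x \<le> (size (enc x) + 2) ^ k" "\<forall>x. g x \<le> (size (enc x) + 2) ^ l"
    using assms unfolding pbd_def by blast
  then have "\<forall>x. f x * g x \<le> (size (enc x) + 2) ^ (k + l)"
    by (simp add: power_add mult_le_mono)
  then show ?thesis unfolding pbd_def by blast
qed

lemma pbd_add: assumes "pbd f" "pbd g" shows "pbd (\<lambda>x. f x + g x)"
proof -
  obtain k l where kl: "\<And>x. f x \<le> (size (enc x) + 2) ^ k" "\<And>x. g x \<le> (size (enc x) + 2) ^ l"
    using assms unfolding pbd_def by blast
  have "f x + g x \<le> (size (enc x) + 2) ^ Suc (max k l)" for x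
  proof -
    have "f x \<le> (size (enc x) + 2) ^ max k l" "g x \<le> (size (enc x) + 2) ^ max k l"
      using kl[of x] by (meson le_trans power_increasing max.cobounded1 max.cobounded2 trans_le_add2 one_le_numeral)+
    then have "f x + g x \<le> 2 * (size (enc x) + 2) ^ max k l" by linarith
    also have "\<dots> \<le> (size (enc x) + 2) ^ Suc (max k l)" by simp
    finally show ?thesis .
  qed
  then show ?thesis unfolding pbd_def by blast
qed

lemma pbd_power: "pbd f \<Longrightarrow> pbd (\<lambda>x. f x ^ k)"
  by (induction k) (auto intro: pbd_mult pbd_const)

lemma pbd_Suc: "pbd f \<Longrightarrow> pbd (\<lambda>x. Suc (f x))"
  using pbd_add[OF _ pbd_const[of 1]] by simp

lemma pbd_size: "pbd (\<lambda>x. size (enc x))"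
  unfolding pbd_def by (rule exI[of _ 1]) auto

lemma pbd_le_size: "(\<And>x. f x \<le> size (enc x)) \<Longrightarrow> pbd f"
  using pbd_mono[OF pbd_size] .

lemma pbd_comp: assumes "pbd g" "pbd (\<lambda>x. size (enc (f x)))" shows "pbd (\<lambda>x. g (f x))"
proof -
  obtain k where "\<forall>x. g x \<le> (size (enc x) + 2) ^ k" using assms unfolding pbd_def by blast
  then show ?thesis
    by (intro pbd_mono[of "\<lambda>x. (size (enc (f x)) + 2) ^ k" "\<lambda>x. g (f x)"] pbd_power pbd_add pbd_const assms) auto
qed

lemmas pbd_intros = pbd_const pbd_mult pbd_add pbd_Suc pbd_power


subsection \<open>Programs with time bounds\<close>

text \<open>Total correctness with an upper bound instead of the exact time, so that bounds can be
  added up without knowing which branch runs.\<close>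

definition exe :: "com \<Rightarrow> store \<Rightarrow> nat \<Rightarrow> (store \<Rightarrow> bool) \<Rightarrow> bool" where
  "exe c s T Q \<longleftrightarrow> (\<exists>t s'. exec c s t s' \<and> t \<le> T \<and> Q s')"

lemma exe_weaken: "exe c s T Q \<Longrightarrow> T \<le> T' \<Longrightarrow> (\<And>s'. Q s' \<Longrightarrow> Q' s') \<Longrightarrow> exe c s T' Q'"
  unfolding exe_def using le_trans by blast

lemma exe_Assign: "Q (s(x := eval_exp e s)) \<Longrightarrow> exe (Assign x e) s (1 + size (eval_exp e s)) Q"
  unfolding exe_def using exec.Assign by blast

lemma exe_Seq:
  assumes "exe c1 s T1 Q1" "\<And>s'. Q1 s' \<Longrightarrow> exe c2 s' T2 Q2"
  shows "exe (Seq c1 c2) s (T1 + T2) Q2"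
proof -
  obtain t1 s1 where 1: "exec c1 s t1 s1" "t1 \<le> T1" "Q1 s1" using assms(1) unfolding exe_def by blast
  obtain t2 s2 where 2: "exec c2 s1 t2 s2" "t2 \<le> T2" "Q2 s2" using assms(2)[OF 1(3)] unfolding exe_def by blast
  show ?thesis unfolding exe_def using exec.Seq[OF 1(1) 2(1)] 1 2 by (meson add_le_mono)
qed

lemma exe_AssignSeq:
  "exe c (s(x := eval_exp e s)) T Q \<Longrightarrow> 1 + size (eval_exp e s) \<le> T1 \<Longrightarrow> exe (Seq (Assign x e) c) s (T1 + T) Q"
  by (rule exe_Seq[where ?Q1.0 = "\<lambda>s'. s' = s(x := eval_exp e s)"])
    (auto intro: exe_weaken[OF exe_Assign[of "\<lambda>s'. s' = s(x := eval_exp e s)"]])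

lemma exe_If:
  assumes "eval_exp e s \<noteq> Leaf \<Longrightarrow> exe c1 s T Q" "eval_exp e s = Leaf \<Longrightarrow> exe c2 s T Q"
  shows "exe (If e c1 c2) s (1 + T) Q"
proof (cases "eval_exp e s = Leaf")
  case True
  then obtain t s' where "exec c2 s t s'" "t \<le> T" "Q s'" using assms unfolding exe_def by blast
  then show ?thesis unfolding exe_def using exec.IfFalse[OF True] by (meson add_left_mono)
next
  case False
  then obtain t s' where "exec c1 s t s'" "t \<le> T" "Q s'" using assms unfolding exe_def by blast
  then show ?thesis unfolding exe_def using exec.IfTrue[OF False] by (meson add_left_mono)
qed

lemma exe_WhileFalse: "eval_exp e s = Leaf \<Longrightarrow> Q s \<Longrightarrow> exe (While e c) s 1 Q"
  unfolding exe_def using exec.WhileFalse by blast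

lemma exe_WhileTrue:
  assumes "eval_exp e s \<noteq> Leaf" "exe c s T1 Q1" "\<And>s'. Q1 s' \<Longrightarrow> exe (While e c) s' T2 Q"
  shows "exe (While e c) s (1 + T1 + T2) Q"
proof -
  obtain t1 s1 where 1: "exec c s t1 s1" "t1 \<le> T1" "Q1 s1" using assms(2) unfolding exe_def by blast
  obtain t2 s2 where 2: "exec (While e c) s1 t2 s2" "t2 \<le> T2" "Q s2" using assms(3)[OF 1(3)] unfolding exe_def by blast
  show ?thesis unfolding exe_def using exec.WhileTrue[OF assms(1) 1(1) 2(1)] 1 2 by (meson add_le_mono order_refl)
qed

text \<open>The result must not depend on the other variables, as a subprogram is called with
  leftovers in the store. Variables from \<open>K\<close> on survive the call and serve as registers
  of the caller.\<close>

definition computes :: "com \<Rightarrow> nat \<Rightarrow> ('a::encodable \<Rightarrow> nat) \<Rightarrow> ('a \<Rightarrow> 'b::encodable) \<Rightarrow> bool" where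
  "computes c K T f \<longleftrightarrow>
     (\<forall>s x. s 0 = enc x \<longrightarrow> exe c s (T x) (\<lambda>s'. s' 0 = enc (f x) \<and> (\<forall>i\<ge>K. s' i = s i)))"

definition pt :: "('a::encodable \<Rightarrow> 'b::encodable) \<Rightarrow> bool" where
  "pt f \<longleftrightarrow> (\<exists>c K T. pbd T \<and> computes c K T f)"

lemma computes_mono:
  fixes f :: "'a::encodable \<Rightarrow> 'b::encodable"
  assumes "computes c K T f" "K \<le> K'" shows "computes c K' T f"
  unfolding computes_def
proof (intro allI impI)
  fix s :: store and x :: 'a assume "s 0 = enc x"
  then have "exe c s (T x) (\<lambda>s'. s' 0 = enc (f x) \<and> (\<forall>i\<ge>K. s' i = s i))"
    using assms(1) unfolding computes_def by blast
  then show "exe c s (T x) (\<lambda>s'. s' 0 = enc (f x) \<and> (\<forall>i\<ge>K'. s' i = s i))"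
    by (rule exe_weaken) (use assms(2) in auto)
qed

lemma computesD: "computes c K T f \<Longrightarrow> s 0 = enc x \<Longrightarrow>
    exe c s (T x) (\<lambda>s'. s' 0 = enc (f x) \<and> (\<forall>i\<ge>K. s' i = s i))"
  unfolding computes_def by blast

lemma exe_computesSeq:
  assumes "computes cf K T f" "s 0 = enc x" "T x \<le> T1"
    and "\<And>s'. s' 0 = enc (f x) \<Longrightarrow> (\<And>i. i \<ge> K \<Longrightarrow> s' i = s i) \<Longrightarrow> exe c s' T2 Q"
  shows "exe (Seq cf c) s (T1 + T2) Q"
  by (rule exe_Seq[OF exe_weaken[OF computesD[where x = x and s = s, OF assms(1,2)] assms(3)]]) (use assms(4) in auto)

lemma exe_computes:
  assumes "computes cf K T f" "s 0 = enc x" "T x \<le> T1"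
    and "\<And>s'. s' 0 = enc (f x) \<Longrightarrow> (\<And>i. i \<ge> K \<Longrightarrow> s' i = s i) \<Longrightarrow> Q s'"
  shows "exe cf s T1 Q"
  by (rule exe_weaken[OF computesD[where x = x and s = s, OF assms(1,2)] assms(3)]) (use assms(4) in auto)

lemma exe_lastAssign: "Q (s(x := eval_exp e s)) \<Longrightarrow> 1 + size (eval_exp e s) \<le> T \<Longrightarrow> exe (Assign x e) s T Q"
  using exe_weaken[OF exe_Assign] by blast

lemma exec_size_le: "exec c s t s' \<Longrightarrow> size (s' i) \<le> size (s i) + t"
  by (induction rule: exec.induct) auto

text \<open>Since an assignment is charged for the whole tree, the output size is at most the input
  size plus the time. Composition rests on this.\<close>

lemma pt_pbd_size: assumes "pt f" shows "pbd (\<lambda>x. size (enc (f x)))"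
proof -
  obtain c K T where T: "pbd T" and c: "computes c K T f" using assms unfolding pt_def by blast
  have "size (enc (f x)) \<le> size (enc x) + T x" for x
  proof -
    have "exe c ((\<lambda>_. Leaf)(0 := enc x)) (T x) (\<lambda>s'. s' 0 = enc (f x) \<and> (\<forall>i\<ge>K. s' i = ((\<lambda>_. Leaf)(0 := enc x)) i))"
      by (rule computesD[OF c]) simp
    then obtain t s' where "exec c ((\<lambda>_. Leaf)(0 := enc x)) t s'" "t \<le> T x" "s' 0 = enc (f x)"
      unfolding exe_def by blast
    then show ?thesis using exec_size_le[of c _ t s' 0] by fastforce
  qed
  then show ?thesis by (intro pbd_mono[OF pbd_add[OF pbd_size T]])
qed

section \<open>Closure properties of the polynomial-time computable functions\<close>

named_theorems pt_intros

lemma pt_expression: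
  assumes "\<And>s x. s 0 = enc x \<Longrightarrow> eval_exp e s = enc (f x)" "pbd (\<lambda>x. size (enc (f x)))"
  shows "pt f"
proof -
  have "computes (Assign 0 e) 1 (\<lambda>x. 1 + size (enc (f x))) f"
    unfolding computes_def
  proof (intro allI impI)
    fix s :: store and x :: 'a assume "s 0 = enc x"
    then have "eval_exp e s = enc (f x)" by (rule assms)
    then show "exe (Assign 0 e) s (1 + size (enc (f x))) (\<lambda>s'. s' 0 = enc (f x) \<and> (\<forall>i\<ge>1. s' i = s i))"
      using exe_Assign[of "\<lambda>s'. s' 0 = enc (f x) \<and> (\<forall>i\<ge>1. s' i = s i)" s 0 e] by simp
  qed
  moreover have "pbd (\<lambda>x. 1 + size (enc (f x)))" by (intro pbd_intros assms)
  ultimately show ?thesis unfolding pt_def by blast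
qed

text \<open>Only codes matter, and the two result types may differ: a list cell is a pair, and a
  list of units is a number.\<close>

lemma pt_cast: "pt f \<Longrightarrow> (\<And>x. enc (g x) = enc (f x)) \<Longrightarrow> pt g"
  unfolding pt_def computes_def by auto

lemma pt_id [pt_intros]: "pt (\<lambda>x. x)"
  by (rule pt_expression[of "Var 0"]) (auto intro: pbd_size)

primrec quote :: "bt \<Rightarrow> exp" where
  "quote Leaf = ELeaf"
| "quote (Node l r) = ENode (quote l) (quote r)"

lemma eval_quote [simp]: "eval_exp (quote t) s = t"
  by (induction t) auto

lemma pt_const [pt_intros]: "pt (\<lambda>x. c)"
  by (rule pt_expression[of "quote (enc c)"]) (auto intro: pbd_const)

lemma pt_comp:
  fixes f :: "'a::encodable \<Rightarrow> 'b::encodable" and g :: "'b \<Rightarrow> 'c::encodable"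
  assumes "pt g" "pt f"
  shows "pt (\<lambda>x. g (f x))"
proof -
  obtain cf Kf Tf where Tf: "pbd Tf" and cf: "computes cf Kf Tf f" using assms unfolding pt_def by blast
  obtain cg Kg Tg where Tg: "pbd Tg" and cg: "computes cg Kg Tg g" using assms unfolding pt_def by blast
  have "computes (Seq cf cg) (max Kf Kg) (\<lambda>x. Tf x + Tg (f x)) (\<lambda>x. g (f x))"
    unfolding computes_def
    by (intro allI impI, rule exe_computesSeq[OF cf], assumption, simp)
      (rule exe_computes[OF cg], auto)
  moreover have "pbd (\<lambda>x. Tf x + Tg (f x))"
    by (intro pbd_intros Tf pbd_comp[OF Tg] pt_pbd_size assms)
  ultimately show ?thesis unfolding pt_def by blast
qed

lemma pt_fst0: "pt fst"
proof (rule pt_expression[of "ELeft (Var 0)"])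
  show "eval_exp (ELeft (Var 0)) s = enc (fst x)" if "s 0 = enc x" for s and x :: "'a \<times> 'b"
    using that by (cases x) auto
qed (rule pbd_le_size, auto)

lemma pt_snd0: "pt snd"
proof (rule pt_expression[of "ERight (Var 0)"])
  show "eval_exp (ERight (Var 0)) s = enc (snd x)" if "s 0 = enc x" for s and x :: "'a \<times> 'b"
    using that by (cases x) auto
qed (rule pbd_le_size, auto)

lemmas pt_fst [pt_intros] = pt_comp[OF pt_fst0]
lemmas pt_snd [pt_intros] = pt_comp[OF pt_snd0]

lemma pt_Some [pt_intros]: "pt f \<Longrightarrow> pt (\<lambda>x. Some (f x))"
proof (rule pt_comp[of Some])
  show "pt (Some :: 'b \<Rightarrow> 'b option)"
    by (rule pt_expression[of "ENode ELeaf (Var 0)"]) (auto intro!: pbd_intros pbd_size)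
qed

lemma pt_Suc [pt_intros]: "pt f \<Longrightarrow> pt (\<lambda>x. Suc (f x))"
proof (rule pt_comp[of Suc])
  show "pt Suc"
    by (rule pt_expression[of "ENode ELeaf (Var 0)"]) (simp, simp, intro pbd_Suc pbd_le_size, simp)
qed

lemma pt_pair [pt_intros]:
  fixes f :: "'a::encodable \<Rightarrow> 'b::encodable" and g :: "'a \<Rightarrow> 'c::encodable"
  assumes "pt f" "pt g" shows "pt (\<lambda>x. (f x, g x))"
proof -
  obtain cf Kf Tf where Tf: "pbd Tf" and cf: "computes cf Kf Tf f" using assms unfolding pt_def by blast
  obtain cg Kg Tg where Tg: "pbd Tg" and cg: "computes cg Kg Tg g" using assms unfolding pt_def by blast
  define K where "K = Suc (max Kf Kg)"
  have cf: "computes cf K Tf f" and cg: "computes cg K Tg g" and K: "0 < K"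
    using cf cg by (auto simp: K_def intro: computes_mono)
  let ?c = "Seq (Assign K (Var 0)) (Seq cf (Seq (Assign (K+1) (Var 0)) (Seq (Assign 0 (Var K))
              (Seq cg (Assign 0 (ENode (Var (K+1)) (Var 0)))))))"
  let ?T = "\<lambda>x. (1 + size (enc x)) + (Tf x + ((1 + size (enc (f x))) + ((1 + size (enc x)) +
              (Tg x + (1 + Suc (size (enc (f x)) + size (enc (g x))))))))"
  have "computes ?c (K+2) ?T (\<lambda>x. (f x, g x))"
    unfolding computes_def
  proof (intro allI impI)
    fix s :: store and x :: 'a assume s: "s 0 = enc x"
    let ?s1 = "s(K := enc x)"
    show "exe ?c s (?T x) (\<lambda>s'. s' 0 = enc (f x, g x) \<and> (\<forall>i\<ge>K+2. s' i = s i))"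
      apply (rule exe_AssignSeq, rule exe_computesSeq[OF cf, of _ x])
      using s K apply (simp, simp)
      apply (rule exe_AssignSeq, rule exe_AssignSeq, rule exe_computesSeq[OF cg, of _ x])
      using s K apply (simp, simp)
      apply (rule exe_lastAssign)
      using s K apply auto
      done
  qed
  moreover have "pbd ?T"
    by (intro pbd_intros Tf Tg pt_pbd_size assms pbd_size)
  ultimately show ?thesis unfolding pt_def by blast
qed

lemma pt_Cons [pt_intros]: "pt f \<Longrightarrow> pt g \<Longrightarrow> pt (\<lambda>x. f x # g x)"
  by (rule pt_cast[OF pt_pair]) auto

text \<open>One rule for if and all case expressions. A tree \<open>enc (d x)\<close> that is not a
  leaf is passed on as it is, and \<open>k x\<close> reads it, paired with the input, at whatever
  type suits the branch: head and tail, value of an option, predecessor.\<close>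

lemma pt_branch:
  fixes d :: "'a::encodable \<Rightarrow> 'd::encodable" and f g :: "'a \<Rightarrow> 'b::encodable"
    and h :: "'c::encodable \<Rightarrow> 'b" and k :: "'a \<Rightarrow> 'c"
  assumes "pt d" "pt f" "pt h"
    and leaf: "\<And>x. enc (d x) = Leaf \<Longrightarrow> g x = f x"
    and node: "\<And>x. enc (d x) \<noteq> Leaf \<Longrightarrow> g x = h (k x) \<and> enc (k x) = Node (enc x) (enc (d x))"
  shows "pt g"
proof -
  obtain cd Kd Td where Td: "pbd Td" and cd: "computes cd Kd Td d" using assms unfolding pt_def by blast
  obtain cf Kf Tf where Tf: "pbd Tf" and cf: "computes cf Kf Tf f" using assms unfolding pt_def by blast
  obtain ch Kh Th where Th: "pbd Th" and ch: "computes ch Kh Th h" using assms unfolding pt_def by blast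
  \<comment> \<open>\<open>k x\<close> is known only when \<open>enc (d x)\<close> is not a leaf, so
    the bound on \<open>Th\<close> is restated in terms of the size of the pair.\<close>
  obtain e where e: "\<And>x. Th x \<le> (size (enc x) + 2) ^ e" using Th unfolding pbd_def by blast
  define K where "K = Suc (max Kd (max Kf Kh))"
  have cd: "computes cd K Td d" and cf: "computes cf K Tf f" and ch: "computes ch K Th h" and K: "0 < K"
    using cf cd ch by (auto simp: K_def intro: computes_mono)
  let ?c = "Seq (Assign K (Var 0)) (Seq cd (Seq (Assign (K+1) (Var 0)) (Seq (Assign 0 (Var K))
              (If (Var (K+1)) (Seq (Assign 0 (ENode (Var 0) (Var (K+1)))) ch) cf))))"
  let ?B = "\<lambda>x. size (enc x) + size (enc (d x)) + 1"
  let ?T = "\<lambda>x. (1 + size (enc x)) + (Td x + ((1 + size (enc (d x))) + ((1 + size (enc x)) +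
              (1 + ((1 + ?B x) + (?B x + 2) ^ e + Tf x)))))"
  have "computes ?c (K+2) ?T g"
    unfolding computes_def
  proof (intro allI impI)
    fix s :: store and x :: 'a assume s: "s 0 = enc x"
    have Th: "Th (k x) \<le> (?B x + 2) ^ e" if "enc (d x) \<noteq> Leaf"
      using e[of "k x"] node[OF that] by (simp add: add.commute)
    show "exe ?c s (?T x) (\<lambda>s'. s' 0 = enc (g x) \<and> (\<forall>i\<ge>K+2. s' i = s i))"
    proof (rule exe_AssignSeq, rule exe_computesSeq[OF cd, of _ x])
      fix s2 assume s2: "s2 0 = enc (d x)" "\<And>i. i \<ge> K \<Longrightarrow> s2 i = (s(K := eval_exp (Var 0) s)) i"
      let ?s = "s2(K+1 := enc (d x), 0 := enc x)"
      have "exe (If (Var (K+1)) (Seq (Assign 0 (ENode (Var 0) (Var (K+1)))) ch) cf) ?s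
          (1 + ((1 + ?B x) + (?B x + 2) ^ e + Tf x)) (\<lambda>s'. s' 0 = enc (g x) \<and> (\<forall>i\<ge>K+2. s' i = s i))"
      proof (rule exe_If)
        assume "eval_exp (Var (K+1)) ?s \<noteq> Leaf"
        then have nl: "enc (d x) \<noteq> Leaf" using K by auto
        have "exe (Seq (Assign 0 (ENode (Var 0) (Var (K+1)))) ch) ?s
           ((1 + ?B x) + (?B x + 2) ^ e) (\<lambda>s'. s' 0 = enc (g x) \<and> (\<forall>i\<ge>K+2. s' i = s i))"
          apply (rule exe_AssignSeq)
           apply (rule exe_computes[OF ch, of _ "k x"])
          using K node[OF nl] Th[OF nl] s2 s by auto
        then show "exe (Seq (Assign 0 (ENode (Var 0) (Var (K+1)))) ch) ?s
           ((1 + ?B x) + (?B x + 2) ^ e + Tf x) (\<lambda>s'. s' 0 = enc (g x) \<and> (\<forall>i\<ge>K+2. s' i = s i))"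
          by (rule exe_weaken) auto
      next
        assume "eval_exp (Var (K+1)) ?s = Leaf"
        then have nl: "enc (d x) = Leaf" using K by auto
        show "exe cf ?s ((1 + ?B x) + (?B x + 2) ^ e + Tf x) (\<lambda>s'. s' 0 = enc (g x) \<and> (\<forall>i\<ge>K+2. s' i = s i))"
          by (rule exe_computes[OF cf, of _ x]) (use K s2 s leaf[OF nl] in auto)
      qed
      then show "exe (Seq (Assign (K+1) (Var 0)) (Seq (Assign 0 (Var K))
         (If (Var (K+1)) (Seq (Assign 0 (ENode (Var 0) (Var (K+1)))) ch) cf))) s2
         ((1 + size (enc (d x))) + ((1 + size (enc x)) + (1 + ((1 + ?B x) + (?B x + 2) ^ e + Tf x))))
         (\<lambda>s'. s' 0 = enc (g x) \<and> (\<forall>i\<ge>K+2. s' i = s i))"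
        using s2 s K by (intro exe_AssignSeq) auto
    qed (use s K in auto)
  qed
  moreover have "pbd ?T"
    by (intro pbd_intros Tf Td pt_pbd_size assms pbd_size)
  ultimately show ?thesis unfolding pt_def by blast
qed

lemma pt_if [pt_intros]: assumes "pt b" "pt f" "pt g" shows "pt (\<lambda>x. if b x then f x else g x)"
  by (rule pt_branch[OF assms(1,3) pt_comp[OF assms(2) pt_fst0], where k = "\<lambda>x. (x, True)"])
    (auto split: if_splits)

lemma pt_case_list [pt_intros]:
  assumes "pt l" "pt f" "pt (\<lambda>z. g (fst z) (fst (snd z)) (snd (snd z)))"
  shows "pt (\<lambda>x. case l x of [] \<Rightarrow> f x | a # as \<Rightarrow> g x a as)"
  by (rule pt_branch[OF assms, where k = "\<lambda>x. (x, (hd (l x), tl (l x)))"]) (auto split: list.splits)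

lemma pt_case_option [pt_intros]:
  assumes "pt l" "pt f" "pt (\<lambda>z. g (fst z) (snd z))"
  shows "pt (\<lambda>x. case l x of None \<Rightarrow> f x | Some a \<Rightarrow> g x a)"
proof (rule pt_branch[OF assms(1,2), where k = "\<lambda>x. (x, ((), the (l x)))"])
  show "pt (\<lambda>z. g (fst z) (snd (snd z)))"
    using pt_comp[OF assms(3), of "\<lambda>z. (fst z, snd (snd z))"] by (simp add: pt_intros)
qed (auto split: option.splits)

lemma pt_case_nat [pt_intros]:
  assumes "pt l" "pt f" "pt (\<lambda>z. g (fst z) (snd z))"
  shows "pt (\<lambda>x. case l x of 0 \<Rightarrow> f x | Suc n \<Rightarrow> g x n)"
proof (rule pt_branch[OF assms(1,2), where k = "\<lambda>x. (x, ((), l x - 1))"])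
  show "pt (\<lambda>z. g (fst z) (snd (snd z)))"
    using pt_comp[OF assms(3), of "\<lambda>z. (fst z, snd (snd z))"] by (simp add: pt_intros)
  show "(case l x of 0 \<Rightarrow> f x | Suc n \<Rightarrow> g x n) =
      g (fst (x, (), l x - 1)) (snd (snd (x, (), l x - 1))) \<and>
      enc (x, (), l x - 1) = Node (enc x) (enc (l x))" if "enc (l x) \<noteq> Leaf" for x
    using that by (cases "l x") auto
qed auto

text \<open>The registers \<open>K\<close>, \<open>K+1\<close> and \<open>K+2\<close> hold the
  parameter, the unread part of the list and the accumulator.\<close>

lemma exe_foldl_loop:
  assumes cF: "computes cF K TF (\<lambda>z. F (fst z) (fst (snd z)) (snd (snd z)))" and K: "0 < K"
    and TF: "\<And>z. TF z \<le> (size (enc z) + 2) ^ e"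
    and B: "\<And>j. j \<le> length l \<Longrightarrow> size (enc (foldl (F x) a (take j l))) \<le> B" and L: "size (enc l) \<le> L"
    and s: "s K = enc x" "s (K+1) = enc l" "s (K+2) = enc a"
  shows "exe (While (Var (K+1)) (Seq (Assign 0 (ENode (Var K) (ENode (Var (K+2)) (ELeft (Var (K+1))))))
     (Seq cF (Seq (Assign (K+2) (Var 0)) (Assign (K+1) (ERight (Var (K+1)))))))) s
    (length l * (1 + ((3 + size (enc x) + B + L) + ((size (enc x) + B + L + 4) ^ e + ((1 + B) + (1 + L))))) + 1)
    (\<lambda>s'. s' (K+2) = enc (foldl (F x) a l) \<and> (\<forall>i\<ge>K+3. s' i = s i))"
  (is "exe (While ?b ?c) s (_ * (1 + ?D) + 1) _")
  using B L s
proof (induction l arbitrary: s a)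
  case Nil
  then show ?case by (intro exe_weaken[OF exe_WhileFalse[where Q = "\<lambda>s'. s' = s"]]) auto
next
  case (Cons y l)
  have Ba: "size (enc a) \<le> B" using Cons.prems(1)[of 0] by simp
  have BF: "size (enc (F x a y)) \<le> B" using Cons.prems(1)[of 1] by simp
  have "exe (While ?b ?c) s (1 + ?D + (length l * (1 + ?D) + 1))
      (\<lambda>s'. s' (K+2) = enc (foldl (F x) a (y # l)) \<and> (\<forall>i\<ge>K+3. s' i = s i))"
  proof (rule exe_WhileTrue[where ?Q1.0 = "\<lambda>s'. s' K = enc x \<and> s' (K+1) = enc l \<and> s' (K+2) = enc (F x a y) \<and> (\<forall>i\<ge>K+3. s' i = s i)"])
    show "eval_exp ?b s \<noteq> Leaf" using Cons by simp
  next
    have TFb: "TF (x, a, y) \<le> (size (enc x) + B + L + 4) ^ e"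
    proof -
      have "size (enc (x, a, y)) + 2 \<le> size (enc x) + B + L + 4" using Ba Cons.prems(2) by simp
      then show ?thesis using TF[of "(x, a, y)"] by (meson le_trans power_mono zero_le)
    qed
    show "exe ?c s ?D (\<lambda>s'. s' K = enc x \<and> s' (K+1) = enc l \<and> s' (K+2) = enc (F x a y) \<and> (\<forall>i\<ge>K+3. s' i = s i))"
      apply (rule exe_AssignSeq, rule exe_computesSeq[OF cF, of _ "(x, a, y)"])
      using Cons.prems Ba TFb BF K apply (simp, simp)
      apply (rule exe_AssignSeq, rule exe_lastAssign)
      using Cons.prems Ba TFb BF K apply auto
      done
  next
    fix s' assume s': "s' K = enc x \<and> s' (K+1) = enc l \<and> s' (K+2) = enc (F x a y) \<and> (\<forall>i\<ge>K+3. s' i = s i)"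
    have "exe (While ?b ?c) s' (length l * (1 + ?D) + 1)
      (\<lambda>s''. s'' (K+2) = enc (foldl (F x) (F x a y) l) \<and> (\<forall>i\<ge>K+3. s'' i = s' i))"
      by (rule Cons.IH) (use Cons.prems(1)[of "Suc _"] Cons.prems(2) s' in auto)
    then show "exe (While ?b ?c) s' (length l * (1 + ?D) + 1)
      (\<lambda>s'. s' (K+2) = enc (foldl (F x) a (y # l)) \<and> (\<forall>i\<ge>K+3. s' i = s i))"
      by (rule exe_weaken) (use s' in auto)
  qed
  then show ?case by (rule exe_weaken) auto
qed

text \<open>A polynomial-time step alone is not enough, as it might double the accumulator in every
  round. Hence the a priori bound \<open>B\<close> on all intermediate accumulators.\<close>

lemma pt_foldl:
  fixes a :: "'a::encodable \<Rightarrow> 'b::encodable" and l :: "'a \<Rightarrow> 'c::encodable list"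
  assumes "pt a" "pt l" "pt (\<lambda>z. F (fst z) (fst (snd z)) (snd (snd z)))"
    and B: "pbd B" "\<And>x j. j \<le> length (l x) \<Longrightarrow> size (enc (foldl (F x) (a x) (take j (l x)))) \<le> B x"
  shows "pt (\<lambda>x. foldl (F x) (a x) (l x))"
proof -
  obtain ca Ka Ta where Ta: "pbd Ta" and ca: "computes ca Ka Ta a" using assms unfolding pt_def by blast
  obtain cl Kl Tl where Tl: "pbd Tl" and cl: "computes cl Kl Tl l" using assms unfolding pt_def by blast
  obtain cF KF TF where TF: "pbd TF" and cF: "computes cF KF TF (\<lambda>z. F (fst z) (fst (snd z)) (snd (snd z)))"
    using assms unfolding pt_def by blast
  obtain e where e: "\<And>x. TF x \<le> (size (enc x) + 2) ^ e" using TF unfolding pbd_def by blast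
  define K where "K = Suc (max Ka (max Kl KF))"
  have ca: "computes ca K Ta a" and cl: "computes cl K Tl l"
    and cF: "computes cF K TF (\<lambda>z. F (fst z) (fst (snd z)) (snd (snd z)))" and K: "0 < K"
    using ca cl cF by (auto simp: K_def intro: computes_mono)
  let ?w = "While (Var (K+1)) (Seq (Assign 0 (ENode (Var K) (ENode (Var (K+2)) (ELeft (Var (K+1))))))
     (Seq cF (Seq (Assign (K+2) (Var 0)) (Assign (K+1) (ERight (Var (K+1)))))))"
  let ?c = "Seq (Assign K (Var 0)) (Seq cl (Seq (Assign (K+1) (Var 0)) (Seq (Assign 0 (Var K))
              (Seq ca (Seq (Assign (K+2) (Var 0)) (Seq ?w (Assign 0 (Var (K+2)))))))))"
  let ?X = "\<lambda>x. size (enc (x::'a))" and ?L = "\<lambda>x. size (enc (l x))"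
  let ?W = "\<lambda>x. length (l x) * (1 + ((3 + ?X x + B x + ?L x) + ((?X x + B x + ?L x + 4) ^ e + ((1 + B x) + (1 + ?L x))))) + 1"
  let ?T = "\<lambda>x. (1 + ?X x) + (Tl x + ((1 + ?L x) + ((1 + ?X x) + (Ta x + ((1 + size (enc (a x))) + (?W x + (1 + B x)))))))"
  have "computes ?c (K+3) ?T (\<lambda>x. foldl (F x) (a x) (l x))"
    unfolding computes_def
  proof (intro allI impI)
    fix s :: store and x :: 'a assume s: "s 0 = enc x"
    have Bx: "size (enc (foldl (F x) (a x) (l x))) \<le> B x" using B(2)[of "length (l x)" x] by simp
    show "exe ?c s (?T x) (\<lambda>s'. s' 0 = enc (foldl (F x) (a x) (l x)) \<and> (\<forall>i\<ge>K+3. s' i = s i))"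
      apply (rule exe_AssignSeq, rule exe_computesSeq[OF cl, of _ x])
      using s K apply (simp, simp)
      apply (rule exe_AssignSeq, rule exe_AssignSeq, rule exe_computesSeq[OF ca, of _ x])
      using s K apply (simp, simp)
      apply (rule exe_AssignSeq, rule exe_Seq[OF exe_foldl_loop[OF cF K e B(2) order_refl]])
      using s K apply (simp, simp, simp, simp)
      apply (rule exe_lastAssign)
      using s K Bx apply auto
      done
  qed
  moreover have "pbd ?T"
    by (intro pbd_intros Ta Tl pt_pbd_size assms pbd_size pbd_mono[OF pt_pbd_size[OF assms(2)] length_le_size_enc])
  ultimately show ?thesis unfolding pt_def by blast
qed

text \<open>If the growth per round is bounded independently of the accumulator, the intermediate
  sizes take care of themselves.\<close>

lemma pt_foldl_additive:
  assumes "pt a" "pt l" "pt (\<lambda>z. F (fst z) (fst (snd z)) (snd (snd z)))"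
    and q: "pbd q" "\<And>x acc y. y \<in> set (l x) \<Longrightarrow> size (enc (F x acc y)) \<le> size (enc acc) + q (x, y)"
  shows "pt (\<lambda>x. foldl (F x) (a x) (l x))"
proof -
  obtain e where e: "\<And>x. q x \<le> (size (enc x) + 2) ^ e" using q unfolding pbd_def by blast
  let ?D = "\<lambda>x. (size (enc x) + size (enc (l x)) + 3) ^ e"
  have *: "size (enc (foldl (F x) b ys)) \<le> size (enc b) + length ys * ?D x" if "set ys \<subseteq> set (l x)" for x b ys
    using that
  proof (induction ys arbitrary: b)
    case (Cons y ys)
    have "q (x, y) \<le> ?D x"
    proof -
      have "size (enc (x, y)) + 2 \<le> size (enc x) + size (enc (l x)) + 3"
        using size_enc_member[of y "l x"] Cons.prems by auto
      then show ?thesis using e[of "(x, y)"] by (meson le_trans power_mono zero_le)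
    qed
    moreover have "size (enc (F x b y)) \<le> size (enc b) + q (x, y)" using q Cons.prems by auto
    moreover have "size (enc (foldl (F x) (F x b y) ys)) \<le> size (enc (F x b y)) + length ys * ?D x"
      using Cons by auto
    ultimately show ?case by simp
  qed simp
  show ?thesis
  proof (rule pt_foldl[OF assms(1-3)])
    show "size (enc (foldl (F x) (a x) (take j (l x)))) \<le> size (enc (a x)) + size (enc (l x)) * ?D x"
      if "j \<le> length (l x)" for x j
    proof -
      have "size (enc (foldl (F x) (a x) (take j (l x)))) \<le> size (enc (a x)) + length (take j (l x)) * ?D x"
        by (rule *) (rule set_take_subset)
      also have "\<dots> \<le> size (enc (a x)) + size (enc (l x)) * ?D x"
        using length_le_size_enc[of "l x"] that by (intro add_left_mono mult_right_mono) auto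
      finally show ?thesis .
    qed
    show "pbd (\<lambda>x. size (enc (a x)) + size (enc (l x)) * ?D x)"
      by (intro pbd_intros pt_pbd_size assms pbd_size)
  qed
qed

lemma pt_rev [pt_intros]: assumes "pt l" shows "pt (\<lambda>x. rev (l x))"
proof -
  have eq: "rev xs = foldl (\<lambda>acc a. a # acc) [] xs" for xs :: "'b list"
    by (simp add: foldl_conv_fold rev_conv_fold)
  show ?thesis unfolding eq
    by (rule pt_foldl_additive[where q = "\<lambda>z. Suc (size (enc (snd z)))"])
      (intro pt_intros assms pbd_intros pbd_le_size | simp add: enc_prod_def)+
qed

lemma pt_append [pt_intros]: assumes "pt l" "pt m" shows "pt (\<lambda>x. l x @ m x)"
proof -
  have eq: "xs @ ys = foldl (\<lambda>acc a. a # acc) ys (rev xs)" for xs ys :: "'b list"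
    by (induction xs arbitrary: ys) auto
  show ?thesis unfolding eq
    by (rule pt_foldl_additive[where q = "\<lambda>z. Suc (size (enc (snd z)))"])
      (intro pt_intros assms pbd_intros pbd_le_size | simp add: enc_prod_def)+
qed

lemma concat_map_conv_foldl: "concat (map f xs) = rev (foldl (\<lambda>acc a. rev (f a) @ acc) [] xs)"
  by (induction xs rule: rev_induct) auto

lemma pt_concat_map [pt_intros]:
  assumes "pt l" "pt (\<lambda>z. F (fst z) (snd z))"
  shows "pt (\<lambda>x. concat (map (F x) (l x)))"
proof -
  have F: "pt (\<lambda>z. F (fst z) (snd (snd z)))"
    using pt_comp[OF assms(2), of "\<lambda>z. (fst z, snd (snd z))"] by (simp add: pt_intros)
  show ?thesis unfolding concat_map_conv_foldl
    apply (intro pt_rev pt_foldl_additive[where q = "\<lambda>z. size (enc (F (fst z) (snd z)))"])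
        apply (rule pt_const)
       apply (rule assms)
      apply (intro pt_append pt_rev F pt_fst pt_snd pt_id)
     apply (rule pt_pbd_size[OF assms(2)])
    apply simp
    done
qed

lemma map_conv_concat: "map f xs = concat (map (\<lambda>a. [f a]) xs)"
  by simp

lemma pt_map [pt_intros]:
  assumes "pt l" "pt (\<lambda>z. F (fst z) (snd z))"
  shows "pt (\<lambda>x. map (F x) (l x))"
  by (subst map_conv_concat) (intro pt_intros assms)


section \<open>Reduced walks\<close>

lemma last_take: "0 < k \<Longrightarrow> k \<le> length s \<Longrightarrow> last (take k s) = s ! (k - 1)"
  by (cases k) (auto simp: take_Suc_conv_app_nth)

text \<open>The stack is a reduced walk read backwards: its top is the current end, and a push onto
  a nonempty stack moves this end by at most one edge of the tree.\<close>

fun push :: "'b list \<Rightarrow> 'b \<Rightarrow> 'b list" where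
  "push [] x = [x]"
| "push [y] x = (if x = y then [y] else [x, y])"
| "push (y # z # st) x = (if x = y then y # z # st else if x = z then z # st else x # y # z # st)"

definition red :: "'b list \<Rightarrow> 'b list" where
  "red xs = rev (foldl push [] xs)"

fun reduced :: "'b list \<Rightarrow> bool" where
  "reduced (x # y # z # xs) \<longleftrightarrow> x \<noteq> y \<and> x \<noteq> z \<and> reduced (y # z # xs)"
| "reduced [x, y] \<longleftrightarrow> x \<noteq> y"
| "reduced xs \<longleftrightarrow> True"

lemma reduced_Cons: "reduced (x # xs) \<Longrightarrow> reduced xs"
  by (cases "x # xs" rule: reduced.cases) auto

lemma reduced_snoc3: "reduced (xs @ [x, y, z]) \<longleftrightarrow> reduced (xs @ [x, y]) \<and> x \<noteq> z \<and> y \<noteq> z"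
proof (induction xs rule: reduced.induct)
  case (2 a b)
  then show ?case by auto
qed (auto split: list.splits)

text \<open>The condition concerns three consecutive entries at a time, so two reduced walks can be
  glued along two common entries.\<close>

lemma reduced_append_iff: "reduced (xs @ [x, y] @ ys) \<longleftrightarrow> reduced (xs @ [x, y]) \<and> reduced (x # y # ys)"
proof (induction ys rule: rev_induct)
  case Nil
  have "reduced (xs @ [x, y]) \<Longrightarrow> reduced [x, y]"
    by (induction xs) (auto dest: reduced_Cons)
  then show ?case by auto
next
  case (snoc z ys)
  show ?case
  proof (cases ys rule: rev_cases)
    case Nil
    have "reduced (xs @ [x, y]) \<Longrightarrow> x \<noteq> y"
      by (induction xs) (auto dest: reduced_Cons)
    then show ?thesis using Nil reduced_snoc3[of xs x y z] by auto
  next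
    case (snoc zs w)
    obtain v us where 2: "x # y # zs = us @ [v]"
      by (metis rev_exhaust list.distinct(1))
    have eqs: "xs @ [x, y] @ ys @ [z] = (xs @ us) @ [v, w, z]" "xs @ [x, y] @ ys = (xs @ us) @ [v, w]"
      "x # y # ys @ [z] = us @ [v, w, z]" "x # y # ys = us @ [v, w]"
      using 2 snoc by (metis append_Cons append_Nil append_assoc)+
    have "reduced (xs @ [x, y] @ ys @ [z]) \<longleftrightarrow> reduced (xs @ [x, y] @ ys) \<and> v \<noteq> z \<and> w \<noteq> z"
      unfolding eqs by (rule reduced_snoc3)
    moreover have "reduced (x # y # ys @ [z]) \<longleftrightarrow> reduced (x # y # ys) \<and> v \<noteq> z \<and> w \<noteq> z"
      unfolding eqs by (rule reduced_snoc3)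
    ultimately show ?thesis using snoc.IH by auto
  qed
qed

lemma reduced_rev [simp]: "reduced (rev xs) \<longleftrightarrow> reduced xs"
proof -
  have "reduced xs \<Longrightarrow> reduced (rev xs)" for xs :: "'b list"
    by (induction xs rule: reduced.induct) (auto simp: reduced_snoc3)
  from this[of xs] this[of "rev xs"] show ?thesis by auto
qed

lemma reduced_appendD2: "reduced (xs @ ys) \<Longrightarrow> reduced ys"
  by (induction xs) (auto dest: reduced_Cons)

lemma reduced_appendD1: "reduced (xs @ ys) \<Longrightarrow> reduced xs"
  using reduced_appendD2[of "rev ys" "rev xs"] by (metis reduced_rev rev_append)

lemma reduced_prefix: "prefix xs ys \<Longrightarrow> reduced ys \<Longrightarrow> reduced xs"
  by (auto simp: prefix_def dest: reduced_appendD1)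

lemma reduced_take: "reduced xs \<Longrightarrow> reduced (take i xs)"
  using reduced_prefix take_is_prefix by blast

lemma reduced_push: "reduced st \<Longrightarrow> reduced (push st x)"
  by (cases "(st, x)" rule: push.cases) (auto dest: reduced_Cons)

lemma reduced_foldl_push: "reduced st \<Longrightarrow> reduced (foldl push st xs)"
  by (induction xs arbitrary: st) (auto intro: reduced_push)

lemma reduced_red [simp]: "reduced (red xs)"
  unfolding red_def by (simp add: reduced_foldl_push)

lemma push_hd [simp]: "push (x # st) x = x # st"
  by (cases st) auto

lemma push_new [simp]: "reduced (x # st) \<Longrightarrow> push st x = x # st"
  by (cases "x # st" rule: reduced.cases) auto

lemma push_push_hd: "reduced (x # st) \<Longrightarrow> push (push (x # st) y) x = x # st"
  by (cases "x # st" rule: reduced.cases; cases "tl st") auto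

lemma push_stay [simp]: "push (push st x) x = push st x"
  by (cases "(st, x)" rule: push.cases) auto

lemma push_back [simp]: "reduced st \<Longrightarrow> push (push (push st x) y) x = push st x"
  by (cases "(st, x)" rule: push.cases) (auto simp: push_push_hd dest: reduced_Cons)

lemma foldl_push_rev_reduced: "reduced xs \<Longrightarrow> foldl push [] xs = rev xs"
proof (induction xs rule: rev_induct)
  case (snoc x xs)
  then have "foldl push [] xs = rev xs" using reduced_appendD1 by blast
  moreover have "push (rev xs) x = x # rev xs"
    using snoc.prems unfolding reduced_rev[symmetric, of "xs @ [x]"]
    by (cases "(rev xs, x)" rule: push.cases) auto
  ultimately show ?case by simp
qed simp

lemma red_reduced [simp]: "reduced xs \<Longrightarrow> red xs = xs"
  unfolding red_def by (simp add: foldl_push_rev_reduced)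

text \<open>The reduction rules do not change the effect of a walk on a reduced stack. Hence
  \<open>red\<close> is compatible with concatenation, which then behaves like the product in a
  fundamental groupoid.\<close>

lemma foldl_push_red:
  assumes "reduced st"
  shows "foldl push st (red xs) = foldl push st xs"
proof (induction xs rule: rev_induct)
  case (snoc x xs)
  define s where "s = foldl push [] xs"
  have s: "red xs = rev s" "red (xs @ [x]) = rev (push s x)" by (auto simp: red_def s_def)
  have *: "foldl push st xs = foldl push st (rev s)" using snoc s by simp
  show ?case
    unfolding s foldl_append * by (cases "(s, x)" rule: push.cases) (auto simp: assms reduced_foldl_push)
qed (simp add: red_def)

lemma red_append_red [simp]: "red (xs @ red ys) = red (xs @ ys)"
  by (simp add: red_def[of "xs @ _"] foldl_push_red reduced_foldl_push)

lemma red_red_append [simp]: "red (red xs @ ys) = red (xs @ ys)"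
  by (simp add: red_def[of "_ @ ys"] foldl_push_red)

lemma red_Cons_red [simp]: "red (x # red ys) = red (x # ys)"
  using red_append_red[of "[x]"] by simp

lemma red_cong: "red xs = red xs' \<Longrightarrow> red ys = red ys' \<Longrightarrow> red (xs @ ys) = red (xs' @ ys')"
  by (metis red_append_red red_red_append)

lemma red_stay: "red (xs @ x # x # ys) = red (xs @ x # ys)"
  by (simp add: red_def)

lemma red_back: "red (xs @ x # y # x # ys) = red (xs @ x # ys)"
  by (simp add: red_def reduced_foldl_push)

lemmas red_stay0 [simp] = red_stay[of "[]", simplified]
lemmas red_back0 [simp] = red_back[of "[]", simplified]

lemma red_mid: "red (xs @ [a, b] @ [c] @ ys) = red (xs @ [a] @ [c] @ ys)" if "c = a \<or> c = b"
  using that red_back[of xs a b ys] red_stay[of xs a ys] red_stay[of "xs @ [a]" b ys] by auto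

lemma red_Nil [simp]: "red [] = []" by (simp add: red_def)

lemma red_eq_Nil [simp]: "red xs = [] \<longleftrightarrow> xs = []"
proof (cases xs rule: rev_cases)
  case (snoc ys y)
  have "push st y \<noteq> []" for st by (cases "(st, y)" rule: push.cases) auto
  then show ?thesis using snoc by (simp add: red_def)
qed simp

lemma last_red [simp]: "last (red xs) = last xs"
proof (cases xs rule: rev_cases)
  case (snoc ys y)
  have "hd (push st y) = y" for st by (cases "(st, y)" rule: push.cases) auto
  then show ?thesis using snoc by (simp add: red_def last_rev)
qed simp

lemma hd_red [simp]: "hd (red xs) = hd xs"
proof (induction xs rule: rev_induct)
  case (snoc x xs)
  have *: "last (push st x) = last st" if "st \<noteq> []" for st
    using that by (cases "(st, x)" rule: push.cases) auto
  show ?case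
  proof (cases "xs = []")
    case False
    then have "foldl push [] xs \<noteq> []" using red_eq_Nil[of xs] by (simp add: red_def)
    then show ?thesis using snoc False * by (simp add: red_def hd_rev)
  qed (simp add: red_def)
qed simp

lemma red_snoc:
  assumes "reduced R" "R \<noteq> []"
  shows "red (R @ [x]) = (if x = last R then R else if length R \<ge> 2 \<and> x = last (butlast R) then butlast R else R @ [x])"
proof -
  have "foldl push [] R = rev R" using assms foldl_push_rev_reduced by blast
  then have "red (R @ [x]) = rev (push (rev R) x)" by (simp add: red_def)
  then show ?thesis using assms(2)
    by (cases R rule: rev_cases; cases "butlast R" rule: rev_cases) (auto simp: butlast_append)
qed

text \<open>A walk in the tree can enter the subtree above \<open>p\<close> only through
  \<open>p\<close> itself.\<close>

lemma prefix_red_snoc: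
  assumes "reduced R" "R \<noteq> []" "prefix p (red (R @ [x]))"
  shows "prefix p R \<or> p = red (R @ [x])"
  using assms(3) red_snoc[OF assms(1,2), of x]
  by (auto split: if_splits dest: prefix_order.trans[OF _ prefixeq_butlast])

lemma length_red_le: "length (red xs) \<le> length xs"
proof (induction xs rule: rev_induct)
  case (snoc x xs)
  have "length (push st x) \<le> Suc (length st)" for st by (cases "(st, x)" rule: push.cases) auto
  then show ?case using snoc by (simp add: red_def) (meson Suc_le_mono le_trans)
qed simp

text \<open>Walks are lists of vertices, so a walk followed by its reverse does not vanish but
  collapses to its base point.\<close>

lemma red_append_rev: "xs \<noteq> [] \<Longrightarrow> red (zs @ xs @ rev xs @ ws) = red (zs @ hd xs # ws)"
proof (induction xs rule: rev_induct)
  case (snoc x xs)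
  show ?case
  proof (cases xs rule: rev_cases)
    case Nil
    then show ?thesis by (simp add: red_stay)
  next
    case (snoc ys y)
    have "red (zs @ (xs @ [x]) @ rev (xs @ [x]) @ ws) = red (zs @ xs @ x # rev xs @ ws)"
      using red_stay[of "zs @ xs" x "rev xs @ ws"] by simp
    also have "\<dots> = red (zs @ ys @ y # rev ys @ ws)"
      using red_back[of "zs @ ys" y x "rev ys @ ws"] snoc by simp
    also have "\<dots> = red (zs @ xs @ rev xs @ ws)"
      using red_stay[of "zs @ ys" y "rev ys @ ws"] snoc by simp
    finally show ?thesis using snoc.IH snoc by (simp add: hd_append)
  qed
qed simp

lemma red_rev_append: "xs \<noteq> [] \<Longrightarrow> red (zs @ rev xs @ xs @ ws) = red (zs @ last xs # ws)"
  using red_append_rev[of "rev xs"] by (simp add: hd_rev)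

lemma red_last: "xs \<noteq> [] \<Longrightarrow> red (zs @ xs @ last xs # ys) = red (zs @ xs @ ys)"
  by (cases xs rule: rev_cases) (auto simp: red_stay[of "zs @ _", simplified])

lemma red_hd: "xs \<noteq> [] \<Longrightarrow> red (zs @ hd xs # xs @ ys) = red (zs @ xs @ ys)"
  by (cases xs) (auto simp: red_stay)

lemma red_cancel_left:
  assumes "red (p @ xs) = red (p @ ys)" "p \<noteq> []"
  shows "red (last p # xs) = red (last p # ys)"
  using red_cong[OF refl assms(1), of "rev p"] red_rev_append[OF assms(2), of "[]"] by simp

lemma red_cancel_right:
  assumes "red (xs @ p) = red (ys @ p)" "p \<noteq> []"
  shows "red (xs @ [hd p]) = red (ys @ [hd p])"
  using red_cong[OF assms(1) refl, of "rev p"] red_append_rev[OF assms(2), of _ "[]"] by simp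

text \<open>\<open>red\<close> reads from the left, so its symmetry needs proof: prepending to a
  reduced walk leads to the same three cases as appending.\<close>

lemma red_rev: "red (rev xs) = rev (red xs)"
proof (induction xs rule: rev_induct)
  case (snoc x xs)
  define R where "R = red xs"
  have R: "reduced R" by (simp add: R_def)
  have "red (rev (xs @ [x])) = red (x # rev R)"
    using snoc red_Cons_red[of x "rev xs"] by (simp add: R_def)
  also have "\<dots> = rev (red (R @ [x]))"
  proof (cases "R = []")
    case False
    have "red (x # rev R) = rev R" if "x = last R"
      using that False R by (cases R rule: rev_cases) (auto simp: reduced_rev[of "_ @ [_]", symmetric] simp del: reduced_rev)
    moreover have "red (x # rev R) = rev (butlast R)" if len: "length R \<ge> 2" "x = last (butlast R)"
    proof -
      obtain S a where R': "R = S @ [a]" using False by (metis rev_exhaust)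
      then obtain T where R'': "R = T @ [x, a]" using len by (cases S rule: rev_cases) (auto simp: butlast_append)
      have "reduced (T @ [x])" using R R'' reduced_appendD1[of "T @ [x]" "[a]"] by simp
      then have "reduced (x # rev T)" using reduced_rev[of "T @ [x]"] by simp
      then show ?thesis using R'' by (simp add: butlast_append)
    qed
    moreover have "red (x # rev R) = x # rev R" if "red (R @ [x]) = R @ [x]"
    proof -
      have "reduced (R @ [x])" using that reduced_red[of "R @ [x]"] by simp
      then have "reduced (x # rev R)" using reduced_rev[of "R @ [x]"] by simp
      then show ?thesis by simp
    qed
    ultimately show ?thesis using red_snoc[OF R False, of x] by (auto split: if_splits)
  qed auto
  also have "\<dots> = rev (red (xs @ [x]))" by (simp add: R_def)
  finally show ?case .
qed simp


section \<open>Push-or-pull recoloring\<close>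

text \<open>The square made of \<open>p\<close>, \<open>q\<close>, the edge between their starts and
  the edge between their ends closes up in the tree.\<close>

definition adj :: "'b list \<Rightarrow> 'b list \<Rightarrow> bool" where
  "adj p q \<longleftrightarrow> red (hd p # q) = red (p @ [last q])"

lemma adj_refl: "p \<noteq> [] \<Longrightarrow> adj p p"
  unfolding adj_def using red_hd[of p "[]" "[]"] red_last[of p "[]" "[]"] by simp

lemma adj_sym: assumes "adj p q" "p \<noteq> []" "q \<noteq> []" shows "adj q p"
proof -
  have "red (hd q # hd p # q @ [last p]) = red (hd q # p @ [last q, last p])"
    using red_cong[OF red_cong[OF refl assms(1)[unfolded adj_def], of "[hd q]"] refl, of "[last p]"] by simp
  moreover have "red (hd q # hd p # q @ [last p]) = red (q @ [last p])"
    using assms(3) by (cases q) auto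
  moreover have "red (hd q # p @ [last q, last p]) = red (hd q # p)"
    using assms(2) red_back[of "hd q # butlast p" "last p" "last q" "[]"]
    by (cases p rule: rev_cases) auto
  ultimately show ?thesis by (simp add: adj_def)
qed

lemma adj_red [simp]: "adj (red p) q \<longleftrightarrow> adj p q" "adj p (red q) \<longleftrightarrow> adj p q"
  by (simp_all add: adj_def)

text \<open>The hypothesis on \<open>last q\<close> is the push-or-pull condition for the
  neighbour.\<close>

lemma adj_snoc:
  assumes "adj p q" "p \<noteq> []" "last q = last p \<or> last q = b"
  shows "adj (p @ [b]) q"
proof -
  have "red (p @ [b, last q]) = red (p @ [last q])"
    using assms(2,3) red_mid[of "last q" "last p" b "butlast p" "[]"] by (cases p rule: rev_cases) auto
  then show ?thesis using assms by (simp add: adj_def)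
qed

locale recoloring =
  fixes V :: "'a set" and EG :: "'a \<Rightarrow> 'a \<Rightarrow> bool" and EH :: "'b \<Rightarrow> 'b \<Rightarrow> bool"
  assumes finite_V: "finite V" and EG_V: "EG u v \<Longrightarrow> u \<in> V \<and> v \<in> V" and EG_refl: "v \<in> V \<Longrightarrow> EG v v"
begin

definition nb :: "'a \<Rightarrow> 'a \<Rightarrow> bool" where
  "nb u v \<longleftrightarrow> EG u v \<or> EG v u"

definition hom :: "('a \<Rightarrow> 'b) \<Rightarrow> bool" where
  "hom \<phi> \<longleftrightarrow> (\<forall>u v. EG u v \<longrightarrow> EH (\<phi> u) (\<phi> v))"

text \<open>For a homomorphism \<open>\<phi>\<close> these are the conditions under which recolouring \<open>u\<close> with \<open>b\<close> is a
  push-or-pull step. A neighbour that keeps the old colour forces the reverse arc only if it is an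
  out-neighbour.\<close>

definition valid :: "('a \<Rightarrow> 'b) \<Rightarrow> 'a \<Rightarrow> 'b \<Rightarrow> bool" where
  "valid \<phi> u b \<longleftrightarrow> u \<in> V \<and> \<phi> u \<noteq> b \<and> EH (\<phi> u) b \<and> EH b b \<and>
     (\<forall>w. w \<noteq> u \<longrightarrow> (EG u w \<longrightarrow> \<phi> w = b \<or> \<phi> w = \<phi> u \<and> EH b (\<phi> u)) \<and> (EG w u \<longrightarrow> \<phi> w = \<phi> u \<or> \<phi> w = b))"

lemma nb_sym: "nb u v \<Longrightarrow> nb v u" by (auto simp: nb_def)

lemma nb_V: "nb u v \<Longrightarrow> u \<in> V \<and> v \<in> V" using EG_V by (auto simp: nb_def)

lemma hom_valid: "hom \<phi> \<Longrightarrow> valid \<phi> u b \<Longrightarrow> hom (\<phi>(u := b))"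
  unfolding hom_def valid_def by (auto split: if_splits)

fun final :: "('a \<Rightarrow> 'b) \<Rightarrow> ('a \<times> 'b) list \<Rightarrow> 'a \<Rightarrow> 'b" where
  "final \<phi> [] = \<phi>"
| "final \<phi> (m # ms) = final (\<phi>(fst m := snd m)) ms"

fun ok :: "('a \<Rightarrow> 'b) \<Rightarrow> ('a \<times> 'b) list \<Rightarrow> bool" where
  "ok \<phi> [] \<longleftrightarrow> True"
| "ok \<phi> (m # ms) \<longleftrightarrow> valid \<phi> (fst m) (snd m) \<and> ok (\<phi>(fst m := snd m)) ms"

definition moves :: "('a \<times> 'b) list \<Rightarrow> 'a \<Rightarrow> 'b list" where
  "moves ms v = map snd (filter (\<lambda>m. fst m = v) ms)"

definition tr :: "('a \<Rightarrow> 'b) \<Rightarrow> ('a \<times> 'b) list \<Rightarrow> 'a \<Rightarrow> 'b list" where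
  "tr \<phi> ms v = \<phi> v # moves ms v"

lemma final_append: "final \<phi> (ms @ ms') = final (final \<phi> ms) ms'"
  by (induction ms arbitrary: \<phi>) auto

lemma ok_append: "ok \<phi> (ms @ ms') \<longleftrightarrow> ok \<phi> ms \<and> ok (final \<phi> ms) ms'"
  by (induction ms arbitrary: \<phi>) auto

lemma moves_append [simp]: "moves (ms @ ms') v = moves ms v @ moves ms' v"
  by (simp add: moves_def)

lemma moves_Nil [simp]: "moves [] v = []" by (simp add: moves_def)

lemma moves_Cons: "moves (m # ms) v = (if fst m = v then snd m # moves ms v else moves ms v)"
  by (simp add: moves_def)

lemma tr_Nil [simp]: "tr \<phi> [] v = [\<phi> v]" by (simp add: tr_def)

lemma tr_not_Nil [simp]: "tr \<phi> ms v \<noteq> []" by (simp add: tr_def)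

lemma hd_tr [simp]: "hd (tr \<phi> ms v) = \<phi> v" by (simp add: tr_def)

lemma tr_snoc: "tr \<phi> (ms @ [m]) v = (if fst m = v then tr \<phi> ms v @ [snd m] else tr \<phi> ms v)"
  by (simp add: tr_def moves_Cons)

lemma last_tr [simp]: "last (tr \<phi> ms v) = final \<phi> ms v"
proof (induction ms rule: rev_induct)
  case (snoc m ms)
  then show ?case by (simp add: tr_snoc final_append)
qed simp

lemma hom_final: "hom \<phi> \<Longrightarrow> ok \<phi> ms \<Longrightarrow> hom (final \<phi> ms)"
  by (induction ms arbitrary: \<phi>) (auto simp: hom_valid)

lemma tr_outside: "ok \<phi> ms \<Longrightarrow> v \<notin> V \<Longrightarrow> tr \<phi> ms v = [\<phi> v]"
proof (induction ms rule: rev_induct)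
  case (snoc m ms)
  then show ?case by (auto simp: tr_snoc ok_append valid_def)
qed simp

lemma adj_valid:
  assumes "valid \<phi> u b" "nb u w" "u \<noteq> w" "adj p q" "p \<noteq> []" "last p = \<phi> u" "last q = \<phi> w"
  shows "adj (p @ [b]) q"
  by (rule adj_snoc) (use assms in \<open>auto simp: valid_def nb_def\<close>)

lemma adj_valid_family:
  assumes "valid \<phi> u b" "\<And>v. P v \<noteq> []" "\<And>v. last (P v) = \<phi> v" "\<And>v w. nb v w \<Longrightarrow> adj (P v) (P w)" "nb v w"
  shows "adj ((P(u := P u @ [b])) v) ((P(u := P u @ [b])) w)"
proof (cases "v = w")
  case True
  then show ?thesis using assms(2) by (auto intro: adj_refl)
next
  case False
  have *: "adj (P u @ [b]) (P w)" if "nb u w" "u \<noteq> w" for w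
    using adj_valid[OF assms(1) that assms(4)[OF that(1)] assms(2) assms(3) assms(3)] .
  have "adj (P v) (P u @ [b])" if "w = u"
    using adj_sym[OF *[of v]] that False assms(2,5) nb_sym by auto
  then show ?thesis using False * assms(4,5) by (cases "v = u"; cases "w = u") auto
qed

lemma adj_tr: "ok \<phi> ms \<Longrightarrow> nb v w \<Longrightarrow> adj (tr \<phi> ms v) (tr \<phi> ms w)"
proof (induction ms arbitrary: v w rule: rev_induct)
  case Nil
  then show ?case by (simp add: adj_def)
next
  case (snoc m ms)
  let ?P = "tr \<phi> ms" and ?u = "fst m"
  have "tr \<phi> (ms @ [m]) = ?P(?u := ?P ?u @ [snd m])" by (auto simp: tr_snoc fun_eq_iff)
  then show ?case
    using adj_valid_family[of "final \<phi> ms" ?u "snd m" ?P v w] snoc by (simp add: ok_append)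
qed

text \<open>A family of walks that start in the colours of \<open>\<alpha>\<close> stands for the colouring by the last colours,
  together with a lift of every colour to the universal cover of \<open>H\<close>. The condition \<^const>\<open>adj\<close>
  says that the lifts of adjacent vertices have distance at most one.\<close>

definition feasible :: "('a \<Rightarrow> 'b) \<Rightarrow> ('a \<Rightarrow> 'b list) \<Rightarrow> bool" where
  "feasible \<alpha> P \<longleftrightarrow> (\<forall>v. P v \<noteq> [] \<and> hd (P v) = \<alpha> v) \<and> hom (\<lambda>v. last (P v)) \<and> (\<forall>v w. nb v w \<longrightarrow> adj (P v) (P w))"

lemma feasible_step:
  assumes "feasible \<alpha> P" "valid (\<lambda>v. last (P v)) u b"
  shows "feasible \<alpha> (P(u := P u @ [b]))"
proof -
  have "(\<lambda>v. last ((P(u := P u @ [b])) v)) = (\<lambda>v. last (P v))(u := b)" by auto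
  then show ?thesis
    using assms hom_valid[of "\<lambda>v. last (P v)" u b] adj_valid_family[OF assms(2), of P]
    unfolding feasible_def by auto
qed

lemma feasible_init: "hom \<alpha> \<Longrightarrow> feasible \<alpha> (\<lambda>v. [\<alpha> v])"
  by (simp add: feasible_def adj_def)

lemma feasible_trace: "hom \<alpha> \<Longrightarrow> ok \<alpha> ms \<Longrightarrow> feasible \<alpha> (\<lambda>v. red (tr \<alpha> ms v))"
  by (simp add: feasible_def adj_tr hom_final)

text \<open>The prefixes of the reduced trace are the vertices of the geodesic to its end, and a
  walk in a tree cannot avoid them.\<close>

lemma trace_hits:
  assumes "prefix p (red (tr \<phi> (take t ms) v))" "p \<noteq> []"
  shows "\<exists>t'\<le>t. red (tr \<phi> (take t' ms) v) = p"
  using assms(1)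
proof (induction t)
  case 0
  then have "p = [\<phi> v]" using assms(2) by (auto simp: prefix_Cons)
  then show ?case by auto
next
  case (Suc t)
  let ?R = "red (tr \<phi> (take t ms) v)"
  have "prefix p ?R \<or> p = red (tr \<phi> (take (Suc t) ms) v)"
  proof (cases "t < length ms \<and> fst (ms ! t) = v")
    case True
    then have "red (tr \<phi> (take (Suc t) ms) v) = red (?R @ [snd (ms ! t)])"
      by (simp add: take_Suc_conv_app_nth tr_snoc)
    then show ?thesis using prefix_red_snoc[of ?R p] Suc.prems by auto
  next
    case False
    then have "tr \<phi> (take (Suc t) ms) v = tr \<phi> (take t ms) v"
      by (cases "t < length ms") (auto simp: take_Suc_conv_app_nth tr_snoc)
    then show ?thesis using Suc.prems by simp
  qed
  then show ?case using Suc.IH le_SucI by blast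
qed

text \<open>The key to greedy recolouring: the vertex whose next lifted position is reached first in the given
  recolouring \<open>ms\<close> can move in \<open>P\<close> as well.\<close>

lemma feasible_progress:
  assumes ok: "ok \<alpha> ms" and P: "feasible \<alpha> P" and Q: "feasible \<alpha> Q"
    and PQ: "\<And>v. prefix (P v) (Q v)" and QS: "\<And>v. prefix (Q v) (red (tr \<alpha> ms v))" and ne: "P \<noteq> Q"
  shows "\<exists>v b. prefix (P v @ [b]) (Q v) \<and> valid (\<lambda>v. last (P v)) v b"
proof -
  define q where "q t v = red (tr \<alpha> (take t ms) v)" for t v
  \<comment> \<open>At time \<open>t\<close> the lift of \<open>v\<close> lies beyond
    \<open>P v\<close> on the way to \<open>Q v\<close>. The vertex for which this happens first
    will be the one that moves.\<close>
  define hit where "hit t v \<longleftrightarrow> strict_prefix (P v) (q t v) \<and> prefix (q t v) (Q v)" for t v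
  have Pne: "P v \<noteq> []" and Phd: "hd (P v) = \<alpha> v" for v using P by (auto simp: feasible_def)
  have redQ: "reduced (Q v)" for v using QS[of v] reduced_prefix by fastforce
  have redP: "reduced (P v)" for v using PQ[of v] redQ reduced_prefix by blast
  obtain v0 where v0: "P v0 \<noteq> Q v0" using ne by auto
  have "\<exists>t v. hit t v"
  proof -
    have "prefix (Q v0) (red (tr \<alpha> (take (length ms) ms) v0))" using QS[of v0] by simp
    moreover have "Q v0 \<noteq> []" using Q by (simp add: feasible_def)
    ultimately obtain t' where "red (tr \<alpha> (take t' ms) v0) = Q v0" using trace_hits by blast
    then have "hit t' v0" using PQ[of v0] v0 by (auto simp: hit_def q_def)
    then show ?thesis by blast
  qed
  then obtain T where T: "\<exists>v. hit T v" "\<And>t v. t < T \<Longrightarrow> \<not> hit t v"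
    using exists_least_iff[of "\<lambda>t. \<exists>v. hit t v"] by auto
  then obtain v where v: "hit T v" by blast
  have nohit: False if nh: "t < T" "prefix p (q t w)" "strict_prefix (P w) p" "prefix p (Q w)" for t p w
  proof -
    have "p \<noteq> []" using that(3) by auto
    then obtain t' where "t' \<le> t" "q t' w = p" using trace_hits[of p \<alpha> t ms w] nh(2) by (auto simp: q_def)
    then show False using T(2)[of t' w] nh by (auto simp: hit_def)
  qed
  have "T \<noteq> 0"
  proof
    assume "T = 0"
    then have "strict_prefix (P v) [\<alpha> v]" using v by (simp add: hit_def q_def)
    then show False using Pne[of v] by (auto simp: strict_prefix_def prefix_Cons)
  qed
  then obtain t where t: "T = Suc t" by (cases T) auto
  have tl: "t < length ms"
  proof (rule ccontr)
    assume "\<not> t < length ms"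
    then have "q T v = q t v" by (simp add: q_def t)
    then show False using v T(2)[of t v] by (simp add: hit_def t)
  qed
  define \<psi> where "\<psi> = final \<alpha> (take t ms)"
  define b where "b = snd (ms ! t)"
  have okt: "ok \<alpha> (take t ms)" and validm: "valid \<psi> (fst (ms ! t)) b"
  proof -
    have "ms = take t ms @ ms ! t # drop (Suc t) ms" using tl by (simp add: id_take_nth_drop)
    then have "ok \<alpha> (take t ms @ ms ! t # drop (Suc t) ms)" using ok by simp
    then show "ok \<alpha> (take t ms)" "valid \<psi> (fst (ms ! t)) b" by (simp_all add: ok_append \<psi>_def b_def)
  qed
  have qT: "q T w = (if fst (ms ! t) = w then red (q t w @ [b]) else q t w)" for w
    using tl by (simp add: q_def t take_Suc_conv_app_nth tr_snoc b_def)
  have mv: "fst (ms ! t) = v"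
    using v T(2)[of t v] qT[of v] by (auto simp: hit_def t split: if_splits)
  have qne: "q s w \<noteq> []" and qred: "reduced (q s w)" for s w by (simp_all add: q_def)
  have lastq: "last (q t w) = \<psi> w" for w by (simp add: q_def \<psi>_def)
  have qTv: "q T v = red (q t v @ [b])" using qT[of v] mv by simp
  \<comment> \<open>A step backwards would mean that the new position was passed before, against the
    minimality of \<open>T\<close>.\<close>
  have "\<not> prefix (q T v) (q t v)"
    using nohit[of t "q T v" v] v by (auto simp: hit_def t)
  then have qTv': "q T v = q t v @ [b]"
    using qTv red_snoc[OF qred qne, of t v b] by (auto split: if_splits simp: prefixeq_butlast)
  have qtP: "q t v = P v"
  proof -
    have "prefix (q t v) (Q v)" using v qTv' by (auto simp: hit_def dest: append_prefixD)
    moreover have "prefix (P v) (q t v)" using v qTv' by (auto simp: hit_def strict_prefix_def)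
    ultimately show ?thesis using T(2)[of t v] by (auto simp: hit_def t)
  qed
  have pre: "prefix (P v @ [b]) (Q v)" using v qTv' qtP by (simp add: hit_def)
  then obtain r where Qv: "Q v = P v @ b # r" by (auto simp: prefix_def)
  define a where "a = last (P v)"
  have Pv: "P v = butlast (P v) @ [a]" using Pne[of v] by (simp add: a_def)
  have a\<psi>: "a = \<psi> v" using lastq[of v] qtP by (simp add: a_def)
  have ab: "reduced (a # b # r)"
    using redQ[of v] Qv Pv reduced_appendD2[of "butlast (P v)" "a # b # r"] by (metis append_Cons append_Nil append_assoc)
  have adjPQ: "red (\<alpha> v # P w) = red (P v @ [last (P w)])" "red (\<alpha> v # Q w) = red (Q v @ [last (Q w)])"
    if "nb v w" for w
    using P Q that Phd[of v] by (auto simp: feasible_def adj_def)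
  have adjq: "red (\<alpha> v # q t w) = red (P v @ [\<psi> w])" if "nb v w" for w
    using adj_tr[OF okt that] qtP[unfolded q_def, symmetric] by (simp add: adj_def q_def \<psi>_def)
  text \<open>A neighbour that stops short of the edge from \<open>a\<close> to \<open>b\<close> would end too far from \<open>v\<close>.\<close>
  have far: False if w: "nb v w" and c: "c = last (P w)" "c \<noteq> b" and rest: "Q w = P w @ rest"
    and end1: "c \<noteq> a \<Longrightarrow> rest = [] \<or> hd rest \<noteq> a" and end2: "c = a \<Longrightarrow> rest \<noteq> [] \<and> hd rest \<noteq> b" for w c rest
  proof -
    have crest: "reduced (c # rest)"
      using redQ[of w] Pne[of w] c rest reduced_appendD2[of "butlast (P w)" "c # rest"]
      by (metis append_Cons append_Nil append_assoc append_butlast_last_id)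
    have "red (P v @ c # rest) = red (P v @ b # r @ [last (Q w)])"
      using adjPQ(2)[OF w] red_cong[OF adjPQ(1)[OF w], of rest rest] Qv rest c by simp
    from red_cancel_left[OF this Pne[of v]]
    have *: "red (a # c # rest) = red ((a # b # r) @ [last (Q w)])"
      by (simp only: a_def append_Cons)
    let ?L = "if c = a then a # rest else a # c # rest"
    have L: "red (a # c # rest) = ?L"
    proof (cases "c = a")
      case False
      then have "reduced (a # c # rest)" using crest end1 by (cases rest) auto
      then show ?thesis using False by simp
    qed (use crest in simp)
    have len: "length ?L \<ge> 2" "?L ! 1 \<noteq> b" using c end2 by (cases rest; auto)+
    have "length (red ((a # b # r) @ [x])) < 2 \<or> red ((a # b # r) @ [x]) ! 1 = b" for x
      using red_snoc[OF ab, of x] by (cases r rule: rev_cases) (auto simp: butlast_append nth_append)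
    from this[of "last (Q w)"] show False
      unfolding *[symmetric] L using len by (elim disjE) linarith+
  qed
  have near: "last (P w) = a \<or> last (P w) = b" if w: "nb v w" "w \<noteq> v" for w
  proof (rule ccontr)
    define c where "c = last (P w)"
    assume "\<not> (last (P w) = a \<or> last (P w) = b)"
    then have cn: "c \<noteq> a" "c \<noteq> b" by (auto simp: c_def)
    obtain rest where rest: "Q w = P w @ rest" using PQ[of w] by (auto simp: prefix_def)
    have x: "\<psi> w = a \<or> \<psi> w = b" using validm mv w a\<psi> by (auto simp: valid_def nb_def)
    show False
    proof (cases "rest = [] \<or> hd rest \<noteq> a")
      case True
      then show False using far[OF w(1) c_def cn(2) rest] cn by auto
    next
      case False
      \<comment> \<open>Here \<open>Q w\<close> goes on to \<open>a\<close>. At time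
        \<open>t\<close> the lift of \<open>w\<close> is \<open>P w @ [a]\<close> or one step
        beyond, so \<open>w\<close> has been at \<open>P w @ [a]\<close> before time
        \<open>T\<close>, against minimality.\<close>
      then obtain rest' where rest': "rest = a # rest'" by (cases rest) auto
      have "red (\<alpha> v # P w @ [a, \<psi> w]) = red (P v @ [c, a, \<psi> w])"
        using red_cong[OF adjPQ(1)[OF w(1)], of "[a, \<psi> w]"] by (simp add: c_def)
      also have "\<dots> = red (P v @ [\<psi> w])" using Pv red_back[of "butlast (P v)" a c "[\<psi> w]"] by (metis append_Cons append_Nil append_assoc)
      finally have "red ([\<alpha> v] @ P w @ [a, \<psi> w]) = red ([\<alpha> v] @ q t w)" using adjq[OF w(1)] by simp
      from red_cancel_left[OF this] have "red ([\<alpha> w] @ \<alpha> v # P w @ [a, \<psi> w]) = red ([\<alpha> w] @ \<alpha> v # q t w)"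
        by (intro red_cong) auto
      moreover have "\<alpha> w = hd (P w)" "\<alpha> w = hd (q t w)" using Phd[of w] by (simp_all add: q_def)
      ultimately have qw: "q t w = red (P w @ [a, \<psi> w])"
        using Pne[of w] qne[of t w] qred[of t w] by (cases "P w"; cases "q t w") auto
      have preQ: "prefix (P w @ [a]) (Q w)" using rest rest' by auto
      have redPa: "reduced (P w @ [a])" using preQ redQ reduced_prefix by blast
      have "prefix (P w @ [a]) (q t w)"
      proof (cases "\<psi> w = a")
        case True
        then show ?thesis using qw redPa red_snoc[OF redPa, of a] by simp
      next
        case False
        then have "\<psi> w = b" using x by simp
        moreover have "red (P w @ [a, b]) = P w @ [a, b]"
          using red_snoc[OF redPa, of b] cn \<open>\<psi> w = b\<close> False by (auto simp: c_def butlast_append)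
        ultimately show ?thesis using qw by auto
      qed
      then show False using nohit[of t "P w @ [a]" w] preQ t by (auto simp: strict_prefix_def)
    qed
  qed
  have revarc: "EH b a" if w: "EG v w" "w \<noteq> v" "last (P w) = a" for w
  proof -
    have nbw: "nb v w" using w by (simp add: nb_def)
    have x: "\<psi> w = b \<or> \<psi> w = a \<and> EH b a" using validm mv w a\<psi> by (auto simp: valid_def)
    show ?thesis
    proof (rule ccontr)
      assume nba: "\<not> EH b a"
      then have "\<psi> w = b" using x by simp
      obtain rest where rest: "Q w = P w @ rest" using PQ[of w] by (auto simp: prefix_def)
      have aneb: "a \<noteq> b" using ab by (cases r) auto
      \<comment> \<open>At time \<open>t\<close> the neighbour \<open>w\<close> has colour
        \<open>b\<close>. If \<open>Q w\<close> goes on to \<open>b\<close>, then \<open>w\<close>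
        was beyond \<open>P w\<close> before \<open>T\<close>. If it goes on elsewhere, it ends too
        far from \<open>Q v\<close>. If it stops, then \<open>Q v\<close> stops at \<open>b\<close>,
        and the homomorphism given by the ends of \<open>Q\<close> supplies the arc.\<close>
      show False
      proof (cases "rest = []")
        case False
        show False
        proof (cases "hd rest = b")
          case True
          then have preQ: "prefix (P w @ [b]) (Q w)" using False rest by (cases rest) auto
          have redPb: "reduced (P w @ [b])" using preQ redQ reduced_prefix by blast
          have "red (\<alpha> v # P w @ [b]) = red (P v @ [a, b])"
            using red_cong[OF adjPQ(1)[OF nbw] refl, of "[b]"] w by simp
          also have "\<dots> = red (P v @ [b])" using red_last[OF Pne[of v], of "[]" "[b]"] by (simp add: a_def)
          finally have "red ([\<alpha> v] @ P w @ [b]) = red ([\<alpha> v] @ q t w)" using adjq[OF nbw] \<open>\<psi> w = b\<close> by simp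
          from red_cancel_left[OF this] have "red ([\<alpha> w] @ \<alpha> v # P w @ [b]) = red ([\<alpha> w] @ \<alpha> v # q t w)"
            by (intro red_cong) auto
          moreover have "\<alpha> w = hd (P w)" "\<alpha> w = hd (q t w)" using Phd[of w] by (simp_all add: q_def)
          ultimately have qw: "q t w = P w @ [b]"
            using Pne[of w] qne[of t w] qred[of t w] redPb by (cases "P w"; cases "q t w") auto
          then show False using nohit[of t "P w @ [b]" w] preQ t by (auto simp: strict_prefix_def)
        next
          case False
          then show False using far[OF nbw refl _ rest] w aneb \<open>rest \<noteq> []\<close> by auto
        qed
      next
        case True
        have "red (P v @ [a]) = red (P v @ b # r @ [a])"
          using adjPQ(1)[OF nbw] adjPQ(2)[OF nbw] rest True Qv w by simp
        from red_cancel_left[OF this Pne[of v]]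
        have "red [a, a] = red ((a # b # r) @ [a])"
          by (simp only: a_def append_Cons)
        then have "r = []"
          using red_snoc[OF ab, of a] red_stay0[of a "[]"] by (cases r rule: rev_cases) (auto split: if_splits simp: butlast_append)
        moreover have "hom (\<lambda>v. last (Q v))" using Q by (simp add: feasible_def)
        ultimately have "EH b a" using w rest True Qv by (auto simp: hom_def dest!: spec)
        then show False using nba by simp
      qed
    qed
  qed
  have "valid (\<lambda>v. last (P v)) v b"
    unfolding valid_def
    using validm mv a\<psi> near revarc by (auto simp: valid_def a_def[symmetric] nb_def)
  with pre show ?thesis by blast
qed

end


section \<open>Offsets between the walks of adjacent vertices\<close>

lemma red_Cons_cases:
  assumes "reduced R" "R \<noteq> []"
  shows "red (x # R) = (if x = hd R then R else if length R \<ge> 2 \<and> x = R ! 1 then tl R else x # R)"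
proof (cases R rule: reduced.cases)
  case (1 a b c xs)
  then show ?thesis using assms red_stay0[of a "b # c # xs"] red_back0[of b a "c # xs"] by auto
next
  case (2 a b)
  then show ?thesis using assms red_stay0[of a "[b]"] red_back0[of b a "[]"] by auto
next
  case ("3_2" a)
  then show ?thesis by auto
qed (use assms in auto)

lemma reduced_ne: "reduced p \<Longrightarrow> Suc i < length p \<Longrightarrow> p ! i \<noteq> p ! Suc i"
proof -
  assume "reduced p" "Suc i < length p"
  then have "reduced (drop i p)" using reduced_appendD2[of "take i p" "drop i p"] by simp
  then show ?thesis using \<open>Suc i < length p\<close>
    by (simp add: Cons_nth_drop_Suc[symmetric]) (cases "drop (Suc (Suc i)) p"; auto)
qed

lemma red_take_step:
  assumes "reduced s" "2 \<le> i" "i < length s" "j = i - 1 \<or> j = i \<or> j = i + 1"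
  shows "red (take i s @ [last (take j s)]) = take j s"
proof -
  have R: "reduced (take i s)" "take i s \<noteq> []" using assms by (auto simp: reduced_take)
  have bl: "butlast (take i s) = take (i - 1) s" using assms by (simp add: butlast_take)
  consider "j = i - 1" | "j = i" | "j = i + 1" using assms(4) by blast
  then show ?thesis
  proof cases
    case 1
    have "last (take j s) \<noteq> last (take i s)"
      using reduced_ne[OF assms(1), of "i - 2"] assms 1 by (simp add: last_take numeral_2_eq_2 Suc_diff_Suc)
    then show ?thesis using red_snoc[OF R, of "last (take j s)"] assms 1 bl by simp
  next
    case 2
    then show ?thesis using red_snoc[OF R] by simp
  next
    case 3
    have "take i s @ [last (take j s)] = take j s"
      using assms 3 by (simp add: last_take take_Suc_conv_app_nth)
    then show ?thesis using reduced_take[OF assms(1), of j] by simp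
  qed
qed

lemma adj_length:
  assumes "adj p q" "reduced p" "reduced q" "p \<noteq> []" "q \<noteq> []"
  shows "length q \<le> length p + 2"
proof -
  have "length (red (hd p # q)) \<ge> length q - 1"
    using red_Cons_cases[OF assms(3,5), of "hd p"] by auto
  moreover have "length (red (p @ [last q])) \<le> length p + 1" using length_red_le[of "p @ [last q]"] by simp
  ultimately show ?thesis using assms(1) by (simp add: adj_def)
qed

text \<open>The walks of adjacent vertices run, apart from their ends, along the same edges of the universal
  cover, with a constant offset \<open>d\<close>.\<close>

lemma adj_shift:
  assumes "adj p q" "reduced p" "reduced q" "p \<noteq> []" "q \<noteq> []"
  shows "\<exists>d::int. \<bar>d\<bar> \<le> 1 \<and> int (length p) + d - 1 \<le> int (length q) \<and>
    (\<forall>i. 2 \<le> i \<and> i < length p \<longrightarrow> 1 \<le> int i + d \<and> int i + d \<le> int (length q) \<and>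
       take i p = red (hd p # take (nat (int i + d)) q))"
proof -
  define Z where "Z = red (hd p # q)"
  have Z: "reduced Z" "Z \<noteq> []" by (simp_all add: Z_def)
  have "red (hd q # p) = red (q @ [last p])" using adj_sym[OF assms(1,4,5)] by (simp add: adj_def)
  then have "red ([hd p] @ hd q # p) = red ([hd p] @ q @ [last p])" by (intro red_cong) auto
  moreover have "red ([hd p] @ hd q # p) = p" using assms(2,4) by (cases p) auto
  moreover have "red ([hd p] @ q @ [last p]) = red (Z @ [last p])" by (simp add: Z_def)
  ultimately have "p = red (Z @ [last p])" by simp
  \<comment> \<open>\<open>Z\<close> and \<open>p\<close> start at the same vertex and their ends
    have distance at most one in the tree, so one extends the other by at most one vertex.\<close>
  then have pZ: "p = Z \<or> p = butlast Z \<or> p = Z @ [last p]"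
    using red_snoc[OF Z, of "last p"] by metis
  have takeZ: "take i p = take i Z \<and> i \<le> length Z" if "i < length p" for i
    using pZ
  proof (elim disjE)
    assume "p = Z @ [last p]"
    then have "take i p = take i (Z @ [last p])" "length p = length Z + 1" by (metis, metis length_append_singleton Suc_eq_plus1)
    then show ?thesis using that by simp
  next
    assume *: "p = butlast Z"
    then have "take i p = take i (take (length Z - 1) Z)" by (simp add: butlast_conv_take)
    then show ?thesis using that * by simp
  qed (use that in auto)
  have lenp: "length p \<le> length Z + 1" using pZ
    by (elim disjE) (simp_all, metis length_append_singleton Suc_eq_plus1 order_refl)
  obtain h q' where q: "q = h # q'" using assms(5) by (cases q) auto
  have redt: "reduced (take k q)" for k using assms(3) reduced_take by blast
  \<comment> \<open>Prepending \<open>hd p\<close> to \<open>q\<close> keeps \<open>q\<close>,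
    removes its first vertex or adds one; these give the offsets 0, 1 and -1.\<close>
  consider (a) "hd p = hd q" | (b) q'' where "hd p \<noteq> hd q" "q' = hd p # q''"
    | (c) "hd p \<noteq> hd q" "Z = hd p # q"
    using red_Cons_cases[OF assms(3,5), of "hd p"] q by (cases q') (auto simp: Z_def split: if_splits)
  then show ?thesis
  proof cases
    case a
    then have Zq: "Z = q" using red_Cons_cases[OF assms(3,5), of "hd p"] by (simp add: Z_def)
    have "take i p = red (hd p # take i q) \<and> i \<le> length q" if "2 \<le> i" "i < length p" for i
    proof -
      have "red (hd p # take i q) = take i q"
        using red_Cons_cases[OF redt, of i "hd p"] a q that by (cases i) auto
      then show ?thesis using takeZ[OF that(2)] Zq by simp
    qed
    then show ?thesis using lenp Zq by (intro exI[of _ 0]) auto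
  next
    case b
    then have Zq: "Z = q'" using red_Cons_cases[OF assms(3,5), of "hd p"] q by (simp add: Z_def)
    have "take i p = red (hd p # take (Suc i) q) \<and> Suc i \<le> length q" if i: "2 \<le> i" "i < length p" for i
    proof -
      obtain k where k: "i = Suc k" using i by (cases i) auto
      have "reduced (hd p # take k q'')" using redt[of "Suc i"] q b k reduced_Cons by auto
      then have "red (hd p # take (Suc i) q) = take i q'" using q b k by simp
      then show ?thesis using takeZ[OF i(2)] Zq q by simp
    qed
    then show ?thesis using lenp Zq q by (intro exI[of _ 1]) (auto simp: nat_add_distrib)
  next
    case c
    have "take i p = red (hd p # take (i - 1) q) \<and> i - 1 \<le> length q" if i: "2 \<le> i" "i < length p" for i
    proof -
      obtain k where k: "i = Suc k" using i by (cases i) auto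
      have "reduced (take i Z)" using Z reduced_take by blast
      then have "red (hd p # take k q) = take i Z" using c k by simp
      then show ?thesis using takeZ[OF i(2)] k c by simp
    qed
    moreover have "nat (int i + -1) = i - 1" for i by linarith
    ultimately show ?thesis using lenp c by (intro exI[of _ "-1"]) (auto simp: le_diff_conv)
  qed
qed

section \<open>Straight recolourings, and periodicity of long walks\<close>

context recoloring
begin

lemma length_moves: "ok \<phi> ms \<Longrightarrow> length ms = (\<Sum>v\<in>V. length (moves ms v))"
proof (induction ms arbitrary: \<phi>)
  case (Cons m ms)
  have "fst m \<in> V" using Cons.prems by (simp add: valid_def)
  then have "(\<Sum>v\<in>V. length (moves (m # ms) v)) = (\<Sum>v\<in>V. length (moves ms v) + (if fst m = v then 1 else 0))"
    by (intro sum.cong) (auto simp: moves_Cons)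
  also have "\<dots> = length ms + 1"
  proof -
    have "length ms = (\<Sum>v\<in>V. length (moves ms v))"
      using Cons.IH Cons.prems unfolding ok.simps by blast
    then show ?thesis using \<open>fst m \<in> V\<close> finite_V by (simp add: sum.distrib)
  qed
  finally show ?case by simp
qed simp

text \<open>The states that a recolouring without detours passes through: each lift lies on the
  geodesic from its start to its position after \<open>ms\<close>.\<close>

definition traced :: "('a \<Rightarrow> 'b) \<Rightarrow> ('a \<times> 'b) list \<Rightarrow> ('a \<Rightarrow> 'b list) \<Rightarrow> bool" where
  "traced \<alpha> ms P \<longleftrightarrow> ok \<alpha> ms \<and> feasible \<alpha> P \<and> (\<forall>v. prefix (P v) (red (tr \<alpha> ms v)))"

lemma traced_outside: "traced \<alpha> ms P \<Longrightarrow> v \<notin> V \<Longrightarrow> P v = [\<alpha> v]"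
proof -
  assume *: "traced \<alpha> ms P" "v \<notin> V"
  then have "prefix (P v) (red (tr \<alpha> ms v))" "P v \<noteq> []" by (auto simp: traced_def feasible_def)
  then show ?thesis using tr_outside[of \<alpha> ms v] * by (auto simp: traced_def prefix_Cons)
qed

lemma traced_ne: "traced \<alpha> ms P \<Longrightarrow> P v \<noteq> []" by (auto simp: traced_def feasible_def)

lemma traced_hd: "traced \<alpha> ms P \<Longrightarrow> hd (P v) = \<alpha> v" by (auto simp: traced_def feasible_def)

lemma traced_reduced: "traced \<alpha> ms P \<Longrightarrow> reduced (P v)"
  unfolding traced_def using reduced_prefix reduced_red by blast

lemma traced_adj: "traced \<alpha> ms P \<Longrightarrow> nb v w \<Longrightarrow> adj (P v) (P w)" by (auto simp: traced_def feasible_def)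

lemma traced_full: "hom \<alpha> \<Longrightarrow> ok \<alpha> ms \<Longrightarrow> traced \<alpha> ms (\<lambda>v. red (tr \<alpha> ms v))"
  by (simp add: traced_def feasible_trace)

lemma traced_init: "hom \<alpha> \<Longrightarrow> ok \<alpha> ms \<Longrightarrow> traced \<alpha> ms (\<lambda>v. [\<alpha> v])"
proof -
  assume *: "hom \<alpha>" "ok \<alpha> ms"
  have "prefix [\<alpha> v] (red (tr \<alpha> ms v))" for v
  proof -
    have "hd (red (tr \<alpha> ms v)) = \<alpha> v" "red (tr \<alpha> ms v) \<noteq> []" by simp_all
    then show ?thesis by (cases "red (tr \<alpha> ms v)") auto
  qed
  then show ?thesis using * by (simp add: traced_def feasible_init)
qed

lemma traced_step:
  assumes "traced \<alpha> ms P" "traced \<alpha> ms Q" "\<And>v. prefix (P v) (Q v)" "P \<noteq> Q"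
  obtains u b where "traced \<alpha> ms (P(u := P u @ [b]))" "\<And>v. prefix ((P(u := P u @ [b])) v) (Q v)"
    "valid (\<lambda>v. last (P v)) u b" "u \<in> V"
proof -
  obtain u b where ub: "prefix (P u @ [b]) (Q u)" "valid (\<lambda>v. last (P v)) u b"
    using feasible_progress[of \<alpha> ms P Q] assms unfolding traced_def by blast
  show thesis
  proof (rule that)
    show "prefix ((P(u := P u @ [b])) v) (Q v)" for v using ub assms by simp
    then have "prefix ((P(u := P u @ [b])) v) (red (tr \<alpha> ms v))" for v
      using assms(2) unfolding traced_def by (blast intro: prefix_order.trans)
    then show "traced \<alpha> ms (P(u := P u @ [b]))"
      using assms(1) feasible_step[OF _ ub(2)] unfolding traced_def by blast
  qed (use ub in \<open>auto simp: valid_def\<close>)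
qed

lemma traced_size_decreases:
  assumes "\<And>v. prefix ((P(u := P u @ [b])) v) (Q v)" "u \<in> V"
  shows "(\<Sum>v\<in>V. length (Q v) - length ((P(u := P u @ [b])) v)) < (\<Sum>v\<in>V. length (Q v) - length (P v))"
proof (rule sum_strict_mono_ex1)
  show "\<exists>v\<in>V. length (Q v) - length ((P(u := P u @ [b])) v) < length (Q v) - length (P v)"
    using assms prefix_length_le[OF assms(1)[of u]] by (intro bexI[of _ u]) auto
qed (use finite_V in auto)

text \<open>Iteration of \<open>feasible_progress\<close>. Each move extends a walk of
  \<open>P\<close> towards \<open>Q\<close>, so the run makes no detours.\<close>

lemma traced_run:
  assumes "traced \<alpha> ms P" "traced \<alpha> ms Q" "\<And>v. prefix (P v) (Q v)"
  shows "\<exists>ms'. ok (\<lambda>v. last (P v)) ms' \<and> (\<forall>v. Q v = P v @ moves ms' v)"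
  using assms
proof (induction "\<Sum>v\<in>V. length (Q v) - length (P v)" arbitrary: P rule: less_induct)
  case less
  show ?case
  proof (cases "P = Q")
    case True
    then show ?thesis by (intro exI[of _ "[]"]) auto
  next
    case False
    then obtain u b where ub: "traced \<alpha> ms (P(u := P u @ [b]))" "\<And>v. prefix ((P(u := P u @ [b])) v) (Q v)"
      "valid (\<lambda>v. last (P v)) u b" "u \<in> V"
      using traced_step[OF less.prems] by blast
    obtain ms' where ms': "ok (\<lambda>v. last ((P(u := P u @ [b])) v)) ms'" "\<And>v. Q v = (P(u := P u @ [b])) v @ moves ms' v"
      using less.hyps[OF traced_size_decreases[OF ub(2,4)] ub(1) less.prems(2) ub(2)] by blast
    have "(\<lambda>v. last ((P(u := P u @ [b])) v)) = (\<lambda>v. last (P v))(u := b)" by auto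
    then have "ok (\<lambda>v. last (P v)) ((u, b) # ms')" using ms' ub by simp
    moreover have "Q v = P v @ moves ((u, b) # ms') v" for v using ms'(2)[of v] by (simp add: moves_Cons)
    ultimately show ?thesis by blast
  qed
qed

lemma final_last: "P v \<noteq> [] \<Longrightarrow> final (\<lambda>v. last (P v)) ms v = last (P v @ moves ms v)"
proof -
  assume "P v \<noteq> []"
  have "final (\<lambda>v. last (P v)) ms v = last (tr (\<lambda>v. last (P v)) ms v)" by simp
  also have "\<dots> = last (P v @ moves ms v)" using \<open>P v \<noteq> []\<close> by (simp add: tr_def)
  finally show ?thesis .
qed

text \<open>A discrete intermediate value argument: the walks grow by one vertex at a time, so the
  run from \<open>P\<close> to \<open>Q\<close> can be stopped when the walk of \<open>r\<close> has
  length \<open>m\<close>.\<close>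

lemma traced_between:
  assumes "traced \<alpha> ms P" "traced \<alpha> ms Q" "\<And>v. prefix (P v) (Q v)" "length (P r) \<le> m" "m \<le> length (Q r)"
  shows "\<exists>R. traced \<alpha> ms R \<and> (\<forall>v. prefix (P v) (R v) \<and> prefix (R v) (Q v)) \<and> length (R r) = m"
  using assms
proof (induction "\<Sum>v\<in>V. length (Q v) - length (P v)" arbitrary: P rule: less_induct)
  case less
  show ?case
  proof (cases "length (P r) = m")
    case True
    then show ?thesis using less.prems by blast
  next
    case False
    then have "P \<noteq> Q" using less.prems by auto
    then obtain u b where ub: "traced \<alpha> ms (P(u := P u @ [b]))" "\<And>v. prefix ((P(u := P u @ [b])) v) (Q v)"
      "valid (\<lambda>v. last (P v)) u b" "u \<in> V"
      using traced_step[OF less.prems(1-3)] by blast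
    have "length ((P(u := P u @ [b])) r) \<le> m" using False less.prems(4) by auto
    then obtain R where R: "traced \<alpha> ms R" "\<And>v. prefix ((P(u := P u @ [b])) v) (R v) \<and> prefix (R v) (Q v)" "length (R r) = m"
      using less.hyps[OF traced_size_decreases[OF ub(2,4)] ub(1) less.prems(2) ub(2) _ less.prems(5)] by blast
    have "prefix (P v) ((P(u := P u @ [b])) v)" for v by simp
    then have "prefix (P v) (R v)" for v using R(2)[of v] prefix_order.trans by blast
    then show ?thesis using R by blast
  qed
qed

lemma traced_length_walk:
  assumes "traced \<alpha> ms P" "successively nb C" "C \<noteq> []"
  shows "length (P (last C)) + 2 \<le> length (P (hd C)) + 2 * length C"
  using assms(2,3)
proof (induction C rule: induct_list012)
  case (3 v w C)
  have "length (P w) \<le> length (P v) + 2"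
    using 3 by (intro adj_length traced_adj[OF assms(1)] traced_reduced[OF assms(1)] traced_ne[OF assms(1)]) auto
  then show ?case using 3 by auto
qed auto

text \<open>The offsets of \<open>adj_shift\<close> add up along \<open>C\<close>. Each edge may
  spoil one more vertex at either end, whence the margin \<open>length C\<close>.\<close>

lemma traced_shift_walk:
  assumes S: "traced \<alpha> ms S" and "successively nb C" "C \<noteq> []"
  shows "\<exists>d::int. \<bar>d\<bar> < int (length C) \<and> int (length (S (hd C))) + d + 1 - int (length C) \<le> int (length (S (last C))) \<and>
    (\<forall>i. length C \<le> i \<and> i + length C \<le> length (S (hd C)) + 1 \<longrightarrow>
       1 \<le> int i + d \<and> int i + d \<le> int (length (S (last C))) \<and>
       take i (S (hd C)) = red (map \<alpha> C @ take (nat (int i + d)) (S (last C))))"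
  using assms(2,3)
proof (induction C rule: induct_list012)
  case (2 v)
  have "take i (S v) = red (\<alpha> v # take i (S v))" if "1 \<le> i" for i
  proof -
    have "reduced (take i (S v))" using traced_reduced[OF S] reduced_take by blast
    moreover have "take i (S v) \<noteq> []" "hd (take i (S v)) = \<alpha> v" using that traced_ne[OF S, of v] traced_hd[OF S, of v] by auto
    ultimately show ?thesis using red_Cons_cases[of "take i (S v)" "\<alpha> v"] by simp
  qed
  then show ?case by (intro exI[of _ 0]) auto
next
  case (3 v w C)
  let ?C = "w # C"
  obtain d1 :: int where d1: "\<bar>d1\<bar> \<le> 1" "int (length (S v)) + d1 - 1 \<le> int (length (S w))"
    "\<And>i. 2 \<le> i \<Longrightarrow> i < length (S v) \<Longrightarrow> 1 \<le> int i + d1 \<and> int i + d1 \<le> int (length (S w)) \<and>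
       take i (S v) = red (\<alpha> v # take (nat (int i + d1)) (S w))"
    using adj_shift[OF traced_adj[OF S] traced_reduced[OF S] traced_reduced[OF S] traced_ne[OF S] traced_ne[OF S], of v w]
      3 traced_hd[OF S] by auto
  obtain d2 :: int where d2: "\<bar>d2\<bar> < int (length ?C)" "int (length (S w)) + d2 + 1 - int (length ?C) \<le> int (length (S (last ?C)))"
    "\<And>i. length ?C \<le> i \<Longrightarrow> i + length ?C \<le> length (S w) + 1 \<Longrightarrow>
       1 \<le> int i + d2 \<and> int i + d2 \<le> int (length (S (last ?C))) \<and>
       take i (S w) = red (map \<alpha> ?C @ take (nat (int i + d2)) (S (last ?C)))"
    using 3 by auto
  have "1 \<le> int i + (d1 + d2) \<and> int i + (d1 + d2) \<le> int (length (S (last ?C))) \<and>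
       take i (S v) = red (map \<alpha> (v # ?C) @ take (nat (int i + (d1 + d2))) (S (last ?C)))"
    if i: "length (v # ?C) \<le> i" "i + length (v # ?C) \<le> length (S v) + 1" for i
  proof -
    define i' where "i' = nat (int i + d1)"
    have i1: "1 \<le> int i + d1 \<and> take i (S v) = red (\<alpha> v # take i' (S w))"
      using d1(3)[of i] i by (simp add: i'_def)
    then have ii: "int i' = int i + d1" by (simp add: i'_def)
    have "1 \<le> int i' + d2 \<and> int i' + d2 \<le> int (length (S (last ?C))) \<and>
       take i' (S w) = red (map \<alpha> ?C @ take (nat (int i' + d2)) (S (last ?C)))"
    proof (rule d2(3))
      show "length ?C \<le> i'" using i(1) ii d1(1) by simp
      show "i' + length ?C \<le> length (S w) + 1" using i(2) ii d1(2) by simp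
    qed
    then show ?thesis using i1 ii by (simp add: add.assoc)
  qed
  moreover have "\<bar>d1 + d2\<bar> < int (length (v # ?C))"
    "int (length (S v)) + (d1 + d2) + 1 - int (length (v # ?C)) \<le> int (length (S (last ?C)))"
    using d1(1,2) d2(1,2) by auto
  moreover have "hd (v # ?C) = v" "last (v # ?C) = last ?C" by simp_all
  ultimately show ?case by (intro exI[of _ "d1 + d2"]) (simp only: refl conj_assoc, blast)
qed simp

lemma traced_shift_nth:
  assumes S: "traced \<alpha> ms S" and C: "successively nb C" "C \<noteq> []"
  obtains d :: int where "\<bar>d\<bar> < int (length C)"
    "int (length (S (hd C))) + d + 1 - int (length C) \<le> int (length (S (last C)))"
    "\<And>j. length C \<le> j + 1 \<Longrightarrow> j + length C \<le> length (S (hd C)) \<Longrightarrow>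
       0 \<le> int j + d \<and> S (hd C) ! j = S (last C) ! nat (int j + d)"
    "\<And>i. length C \<le> i \<Longrightarrow> i + length C \<le> length (S (hd C)) + 1 \<Longrightarrow>
       take i (S (hd C)) = red (map \<alpha> C @ take (nat (int i + d)) (S (last C)))"
proof -
  obtain d :: int where d: "\<bar>d\<bar> < int (length C)"
    "int (length (S (hd C))) + d + 1 - int (length C) \<le> int (length (S (last C)))"
    "\<And>i. length C \<le> i \<Longrightarrow> i + length C \<le> length (S (hd C)) + 1 \<Longrightarrow>
       1 \<le> int i + d \<and> int i + d \<le> int (length (S (last C))) \<and>
       take i (S (hd C)) = red (map \<alpha> C @ take (nat (int i + d)) (S (last C)))"
    using traced_shift_walk[OF S C] by blast
  have "0 \<le> int j + d \<and> S (hd C) ! j = S (last C) ! nat (int j + d)"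
    if j: "length C \<le> j + 1" "j + length C \<le> length (S (hd C))" for j
  proof -
    have D: "1 \<le> int (j+1) + d" "int (j+1) + d \<le> int (length (S (last C)))"
       "take (j+1) (S (hd C)) = red (map \<alpha> C @ take (nat (int (j+1) + d)) (S (last C)))"
      using d(3)[of "j+1"] j by auto
    have ne: "take (nat (int (j+1) + d)) (S (last C)) \<noteq> []" using D(1) traced_ne[OF S, of "last C"] by auto
    have "S (hd C) ! j = last (take (j+1) (S (hd C)))" using j C(2) by (subst last_take) (cases C; auto)+
    also have "\<dots> = last (take (nat (int (j+1) + d)) (S (last C)))" using D(3) ne by simp
    also have "\<dots> = S (last C) ! (nat (int (j+1) + d) - 1)" using D(1,2) by (subst last_take) auto
    also have "nat (int (j+1) + d) - 1 = nat (int j + d)" by linarith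
    finally show ?thesis using D(1) by simp
  qed
  then show thesis using that d by blast
qed

text \<open>The walk of \<open>hd C\<close> agrees with itself up to the total offset
  \<open>d\<close> around \<open>C\<close>. A nontrivial closed walk acts on the tree without fixed
  points, so \<open>d\<close> is not 0 and the agreement is a period.\<close>

lemma traced_period:
  assumes S: "traced \<alpha> ms S" and C: "successively nb C" "C \<noteq> []" "last C = hd C" "red (map \<alpha> C) \<noteq> [\<alpha> (hd C)]"
    and len: "2 * length C \<le> length (S (hd C))"
  obtains d where "1 \<le> d" "d < length C"
    "\<And>j. length C \<le> j \<Longrightarrow> j + 2 * length C \<le> length (S (hd C)) \<Longrightarrow> S (hd C) ! j = S (hd C) ! (j + d)"
proof -
  let ?s = "S (hd C)"
  obtain d :: int where d: "\<bar>d\<bar> < int (length C)"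
    "\<And>j. length C \<le> j + 1 \<Longrightarrow> j + length C \<le> length ?s \<Longrightarrow> 0 \<le> int j + d \<and> ?s ! j = ?s ! nat (int j + d)"
    "\<And>i. length C \<le> i \<Longrightarrow> i + length C \<le> length ?s + 1 \<Longrightarrow>
       take i ?s = red (map \<alpha> C @ take (nat (int i + d)) ?s)"
    using traced_shift_nth[OF S C(1,2)] C(3) by metis
  have "d \<noteq> 0"
  proof
    assume "d = 0"
    let ?t = "take (length C) ?s"
    have t: "?t = red (map \<alpha> C @ ?t)" using d(3)[of "length C"] len \<open>d = 0\<close> by simp
    have ne: "?t \<noteq> []" using C(2) traced_ne[OF S, of "hd C"] by simp
    have ht: "hd ?t = \<alpha> (hd C)" using ne traced_hd[OF S, of "hd C"] by simp
    have "red ([\<alpha> (hd C)] @ ?t) = red (map \<alpha> C @ ?t)"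
      using t red_hd[OF ne, of "[]" "[]"] ht reduced_take[OF traced_reduced[OF S]] by simp
    from red_cancel_right[OF this ne]
    have "red (map \<alpha> C @ [\<alpha> (hd C)]) = [\<alpha> (hd C)]" using ht by simp
    moreover have "red (map \<alpha> C @ [\<alpha> (hd C)]) = red (map \<alpha> C)"
      using red_last[of "map \<alpha> C" "[]" "[]"] C by (simp add: last_map)
    ultimately show False using C(4) by simp
  qed
  show thesis
  proof (cases "d > 0")
    case True
    show thesis
      by (rule that[of "nat d"]) (use d True in \<open>auto simp: nat_add_distrib\<close>)
  next
    case False
    \<comment> \<open>A negative offset is a period read from the other end.\<close>
    define e where "e = nat (- d)"
    have e: "d = - int e" "e \<ge> 1" using False \<open>d \<noteq> 0\<close> by (auto simp: e_def)
    show thesis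
    proof (rule that[of e])
      show "?s ! j = ?s ! (j + e)" if "length C \<le> j" "j + 2 * length C \<le> length ?s" for j
        using d(2)[of "j + e"] that d(1) e by simp
    qed (use d e in auto)
  qed
qed

text \<open>The period is transported to \<open>v\<close> along a walk to \<open>hd C\<close>, whose
  offset \<open>e\<close> cancels. The margins make room for \<open>e\<close> and for the margins of
  \<open>traced_period\<close>.\<close>

lemma traced_period_all:
  assumes S: "traced \<alpha> ms S" and C: "successively nb C" "C \<noteq> []" "last C = hd C" "red (map \<alpha> C) \<noteq> [\<alpha> (hd C)]"
    and M: "length C \<le> M" "2 * M \<le> length (S (hd C))"
    and W: "\<And>v. v \<in> V \<Longrightarrow> \<exists>W. successively nb W \<and> W \<noteq> [] \<and> hd W = v \<and> last W = hd C \<and> length W \<le> M"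
  obtains d where "1 \<le> d" "d < M"
    "\<And>v j. v \<in> V \<Longrightarrow> 2 * M \<le> j \<Longrightarrow> j + 5 * M \<le> length (S v) \<Longrightarrow> S v ! j = S v ! (j + d)"
proof -
  let ?s = "S (hd C)"
  obtain d where d: "1 \<le> d" "d < length C"
    "\<And>j. length C \<le> j \<Longrightarrow> j + 2 * length C \<le> length ?s \<Longrightarrow> ?s ! j = ?s ! (j + d)"
    using traced_period[OF S C] M by auto
  have "S v ! j = S v ! (j + d)" if v: "v \<in> V" "2 * M \<le> j" "j + 5 * M \<le> length (S v)" for v j
  proof -
    obtain W where W: "successively nb W" "W \<noteq> []" "hd W = v" "last W = hd C" "length W \<le> M"
      using W[OF v(1)] by blast
    obtain e :: int where e: "\<bar>e\<bar> < int (length W)"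
      "int (length (S v)) + e + 1 - int (length W) \<le> int (length ?s)"
      "\<And>j. length W \<le> j + 1 \<Longrightarrow> j + length W \<le> length (S v) \<Longrightarrow>
       0 \<le> int j + e \<and> S v ! j = ?s ! nat (int j + e)"
      using traced_shift_nth[OF S W(1,2)] W(3,4) by metis
    define k where "k = nat (int j + e)"
    have k: "int k = int j + e" using e(1) v(2) W(5) by (simp add: k_def)
    have "S v ! j = ?s ! k" using e(3)[of j] v W(5) by (simp add: k_def)
    also have "\<dots> = ?s ! (k + d)"
      by (rule d(3)) (use k e v W(5) M in linarith)+
    also have "k + d = nat (int (j + d) + e)" using k by linarith
    also have "?s ! nat (int (j + d) + e) = S v ! (j + d)" using e(3)[of "j + d"] v W(5) d(2) M by simp
    finally show ?thesis .
  qed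
  then show thesis using that d M by (meson le_trans less_le_trans)
qed

definition shortest :: "('a \<Rightarrow> 'b) \<Rightarrow> ('a \<times> 'b) list \<Rightarrow> bool" where
  "shortest \<alpha> ms \<longleftrightarrow> ok \<alpha> ms \<and> (\<forall>ms'. ok \<alpha> ms' \<longrightarrow> final \<alpha> ms' = final \<alpha> ms \<longrightarrow> length ms \<le> length ms')"

text \<open>Away from the ends, \<open>q\<close> runs along \<open>p\<close> with a fixed offset, so
  adjacency of two prefixes depends on the difference of their lengths alone.\<close>

lemma adj_shifted:
  assumes "adj p q" "reduced p" "reduced q" "p \<noteq> []" "q \<noteq> []"
    and ij: "adj (take i p) (take j q)" "4 \<le> i" "i + d + 3 < length p" "4 \<le> j" "j + d < length q" "j \<le> i + 2"
  shows "adj (take (i + d) p) (take (j + d) q)"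
proof -
  obtain e :: int where e: "\<bar>e\<bar> \<le> 1" "\<And>i. 2 \<le> i \<Longrightarrow> i < length p \<Longrightarrow> 1 \<le> int i + e \<and> int i + e \<le> int (length q) \<and>
       take i p = red (hd p # take (nat (int i + e)) q)"
    using adj_shift[OF assms(1-5)] by blast
  \<comment> \<open>The length of the prefix of \<open>p\<close> that corresponds to
    \<open>take j q\<close>; adjacency makes it differ from \<open>i\<close> by at most one.\<close>
  define k where "k = nat (int j - e)"
  have k: "int k = int j - e" "2 \<le> k" "k + d < length p" using e(1) ij by (auto simp: k_def)
  have hp: "hd (take m p) = hd p" if "0 < m" for m using that by simp
  have tk: "take k p = red (hd p # take j q)" "take (k + d) p = red (hd p # take (j + d) q)"
  proof -
    have n: "nat (int k + e) = j" "nat (int (k + d) + e) = j + d" using k by auto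
    show "take k p = red (hd p # take j q)" "take (k + d) p = red (hd p # take (j + d) q)"
      using e(2)[of k] e(2)[of "k + d"] k unfolding n by auto
  qed
  have "take k p = red (take i p @ [last (take j q)])"
    using ij(1,2) tk(1) hp[of i] by (simp add: adj_def)
  then have "length (take k p) = i - 1 \<or> length (take k p) = i \<or> length (take k p) = i + 1"
    using red_snoc[OF reduced_take[OF assms(2)], of i "last (take j q)"] ij assms(4) by (auto split: if_splits)
  then have "k + d = (i + d) - 1 \<or> k + d = i + d \<or> k + d = i + d + 1" using k ij by auto
  then have "red (take (i + d) p @ [last (take (k + d) p)]) = take (k + d) p"
    using red_take_step[OF assms(2), of "i + d" "k + d"] ij by simp
  moreover have "take (j + d) q \<noteq> []" using assms(5) ij by simp
  moreover from this have "last (take (k + d) p) = last (take (j + d) q)" by (metis last_ConsR last_red tk(2))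
  ultimately show ?thesis using tk(2) hp[of "i + d"] ij(2) by (simp add: adj_def)
qed

text \<open>Along a cycle with nontrivial holonomy the walks are periodic. If they are long, then some
  colouring occurs twice, and the part in between can be cut out.\<close>

lemma shortest_bound:
  assumes short: "shortest \<alpha> ms" and hom: "hom \<alpha>"
    and C: "successively nb C" "C \<noteq> []" "last C = hd C" "red (map \<alpha> C) \<noteq> [\<alpha> (hd C)]" "hd C \<in> V"
    and M: "length C \<le> M"
    and W: "\<And>v. v \<in> V \<Longrightarrow> \<exists>W. successively nb W \<and> W \<noteq> [] \<and> hd W = v \<and> last W = hd C \<and> length W \<le> M"
    and W': "\<And>v. v \<in> V \<Longrightarrow> \<exists>W. successively nb W \<and> W \<noteq> [] \<and> hd W = hd C \<and> last W = v \<and> length W \<le> M"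
  shows "length (red (tr \<alpha> ms (hd C))) < 30 * M"
proof (rule ccontr)
  define S where "S v = red (tr \<alpha> ms v)" for v
  define r where "r = hd C"
  assume "\<not> ?thesis"
  then have long: "30 * M \<le> length (S r)" by (simp add: S_def r_def)
  have ok: "ok \<alpha> ms" using short by (simp add: shortest_def)
  have S: "traced \<alpha> ms S" unfolding S_def using traced_full[OF hom ok] .
  have M1: "1 \<le> M" using C(2) M by (cases C) auto
  obtain d where d: "1 \<le> d" "d < M"
    "\<And>v j. v \<in> V \<Longrightarrow> 2 * M \<le> j \<Longrightarrow> j + 5 * M \<le> length (S v) \<Longrightarrow> S v ! j = S v ! (j + d)"
    using traced_period_all[OF S C(1-4) M _ W] long by (auto simp: r_def)
  have "M \<ge> 2" using d by simp
  have init: "traced \<alpha> ms (\<lambda>v. [\<alpha> v])" using traced_init[OF hom ok] .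
  have preS: "prefix [\<alpha> v] (S v)" for v
    using traced_ne[OF S, of v] traced_hd[OF S, of v] by (cases "S v") auto
  \<comment> \<open>With \<open>10 * M\<close> at the root, all walks of \<open>P\<close> have
    lengths between \<open>8 * M\<close> and \<open>12 * M\<close>, far enough from both ends of the
    walks of \<open>S\<close> for the period to hold.\<close>
  obtain P where P: "traced \<alpha> ms P" "\<And>v. prefix [\<alpha> v] (P v)" "\<And>v. prefix (P v) (S v)" "length (P r) = 10 * M"
    using traced_between[OF init S preS, of r "10 * M"] long M1 by auto
  have lenP: "10 * M \<le> length (P v) + 2 * M" "length (P v) \<le> 12 * M" "30 * M \<le> length (S v) + 2 * M" if v: "v \<in> V" for v
  proof -
    obtain W1 where W1: "successively nb W1" "W1 \<noteq> []" "hd W1 = v" "last W1 = r" "length W1 \<le> M"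
      using W[OF v] by (auto simp: r_def)
    obtain W2 where W2: "successively nb W2" "W2 \<noteq> []" "hd W2 = r" "last W2 = v" "length W2 \<le> M"
      using W'[OF v] by (auto simp: r_def)
    show "10 * M \<le> length (P v) + 2 * M" using traced_length_walk[OF P(1) W1(1,2)] W1 P(4) by simp
    show "length (P v) \<le> 12 * M" using traced_length_walk[OF P(1) W2(1,2)] W2 P(4) by simp
    show "30 * M \<le> length (S v) + 2 * M" using traced_length_walk[OF S W1(1,2)] W1 long by simp
  qed
  have Ptake: "P v = take (length (P v)) (S v)" for v using P(3)[of v] by (auto simp: prefix_def)
  \<comment> \<open>Every vertex of \<open>G\<close> is moved on by the same period at once, so both
    the last colours and the adjacencies of \<open>P\<close> persist.\<close>
  define Q where "Q v = take (length (P v) + d) (S v)" for v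
  have out: "P v = [\<alpha> v]" "S v = [\<alpha> v]" if "v \<notin> V" for v
    using that traced_outside[OF P(1)] traced_outside[OF S] by auto
  have lenQ: "length (Q v) = length (P v) + d" if "v \<in> V" for v using lenP[OF that] d(2) by (simp add: Q_def)
  have lastQ: "last (Q v) = last (P v)" for v
  proof (cases "v \<in> V")
    case True
    have "last (P v) = S v ! (length (P v) - 1)"
      by (subst Ptake, subst last_take) (use lenP[OF True] M1 in auto)
    also have "\<dots> = S v ! (length (P v) - 1 + d)"
      by (rule d(3)[OF True]) (use lenP[OF True] M1 in auto)
    also have "\<dots> = last (Q v)"
      unfolding Q_def by (subst last_take) (use lenP[OF True] M1 d in \<open>auto simp: algebra_simps\<close>)
    finally show ?thesis by simp
  qed (simp add: Q_def out)
  have Qne: "Q v \<noteq> []" for v using traced_ne[OF S, of v] d(1) by (simp add: Q_def)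
  have PQ: "prefix (P v) (Q v)" for v
    by (subst Ptake) (auto simp: Q_def intro: take_is_prefix prefix_order.trans simp: take_add)
  have QS: "prefix (Q v) (S v)" for v by (simp add: Q_def take_is_prefix)
  have Q: "traced \<alpha> ms Q"
    unfolding traced_def feasible_def
  proof (intro conjI allI impI)
    show "ok \<alpha> ms" by fact
    show "Q v \<noteq> []" for v by (rule Qne)
    show "hd (Q v) = \<alpha> v" for v using Qne[of v] traced_hd[OF S, of v] by (simp add: Q_def)
    show "local.hom (\<lambda>v. last (Q v))" using P(1) by (simp add: lastQ traced_def feasible_def)
    show "prefix (Q v) (red (tr \<alpha> ms v))" for v using QS[of v] by (simp add: S_def)
    show "adj (Q v) (Q w)" if vw: "nb v w" for v w
    proof -
      have V: "v \<in> V" "w \<in> V" using nb_V[OF vw] by auto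
      have a: "adj (take (length (P v)) (S v)) (take (length (P w)) (S w))"
        using traced_adj[OF P(1) vw] Ptake by metis
      have "length (P w) \<le> length (P v) + 2"
        by (intro adj_length traced_adj[OF P(1) vw] traced_reduced[OF P(1)] traced_ne[OF P(1)])
      then show ?thesis unfolding Q_def
        by (intro adj_shifted[OF traced_adj[OF S vw] traced_reduced[OF S] traced_reduced[OF S] traced_ne[OF S] traced_ne[OF S] a])
          (use lenP[OF V(1)] lenP[OF V(2)] d \<open>M \<ge> 2\<close> in auto)
    qed
  qed
  obtain ms1 where ms1: "ok \<alpha> ms1" "\<And>v. P v = [\<alpha> v] @ moves ms1 v"
    using traced_run[OF init P(1,2)] by auto
  obtain ms2 where ms2: "ok (\<lambda>v. last (Q v)) ms2" "\<And>v. S v = Q v @ moves ms2 v"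
    using traced_run[OF Q S QS] by blast
  have f1: "final \<alpha> ms1 = (\<lambda>v. last (P v))"
    using last_tr[of \<alpha> ms1] ms1(2) by (auto simp: tr_def fun_eq_iff)
  have ok12: "ok \<alpha> (ms1 @ ms2)" using ms1(1) ms2(1) f1 by (simp add: ok_append lastQ)
  have "final (\<lambda>v. last (Q v)) ms2 v = last (S v)" for v using final_last[of Q v ms2] Qne ms2(2) by simp
  then have "final \<alpha> (ms1 @ ms2) = final \<alpha> ms"
    by (simp add: final_append f1 lastQ S_def fun_eq_iff)
  then have le: "length ms \<le> length (ms1 @ ms2)" using short ok12 unfolding shortest_def by blast
  \<comment> \<open>Every vertex saves at least \<open>d\<close> moves.\<close>
  have "length (ms1 @ ms2) = (\<Sum>v\<in>V. length (moves ms1 v) + length (moves ms2 v))"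
    using length_moves[OF ok12] by simp
  also have "\<dots> < (\<Sum>v\<in>V. length (moves ms v))"
  proof (rule sum_strict_mono)
    show "length (moves ms1 v) + length (moves ms2 v) < length (moves ms v)" if v: "v \<in> V" for v
    proof -
      have "length (P v) = 1 + length (moves ms1 v)" using ms1(2)[of v] by simp
      moreover have "length (S v) = length (Q v) + length (moves ms2 v)" using ms2(2)[of v] by simp
      moreover have "length (S v) \<le> 1 + length (moves ms v)"
        using length_red_le[of "tr \<alpha> ms v"] by (simp add: S_def tr_def)
      ultimately show ?thesis using lenQ[OF v] d(1) by simp
    qed
  qed (use finite_V C(5) in auto)
  also have "\<dots> = length ms" using length_moves[OF ok] by simp
  finally show False using le by simp
qed

end


section \<open>Geodesics in the tree, powers and conjugation\<close>

text \<open>Two connected sets of vertices of the universal cover, given by \<open>a\<close> and \<open>b\<close>, are joined by a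
  segment from \<open>p\<close> to \<open>q\<close> if they are disjoint.\<close>

lemma bridge:
  fixes a b :: "'i \<Rightarrow> 'b list"
  assumes red: "\<And>i. reduced (a i)" "\<And>i. reduced (b i)" "\<And>i. a i \<noteq> []" "\<And>i. b i \<noteq> []"
    and root: "a i0 = [x]" "b i0 = s" "hd s = x"
    and step: "\<And>i j. R\<^sup>*\<^sup>* i0 i \<Longrightarrow> R i j \<Longrightarrow> (\<exists>y. a j = red (a i @ [y])) \<and> (\<exists>y. b j = red (b i @ [y]))"
    and disj: "\<And>i j. R\<^sup>*\<^sup>* i0 i \<Longrightarrow> R\<^sup>*\<^sup>* i0 j \<Longrightarrow> a i \<noteq> b j"
  obtains i j d z where "R\<^sup>*\<^sup>* i0 i" "R\<^sup>*\<^sup>* i0 j" "b j = a i @ d # z"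
    "\<And>k. R\<^sup>*\<^sup>* i0 k \<Longrightarrow> prefix (b j) (b k)" "\<And>k. R\<^sup>*\<^sup>* i0 k \<Longrightarrow> \<not> prefix (a i @ [d]) (a k)"
proof -
  \<comment> \<open>The geodesic \<open>s\<close> leads from a point of the first set to a point of
    the second; \<open>Max M\<close> marks the last point on it that belongs to the first
    set.\<close>
  define M where "M = {n. n \<le> length s \<and> (\<exists>i. R\<^sup>*\<^sup>* i0 i \<and> a i = take n s)}"
  have s: "s \<noteq> []" using red(4)[of i0] root by simp
  have "1 \<in> M" using root s unfolding M_def by (cases s) (auto intro!: exI[of _ i0])
  moreover have "finite M" by (auto simp: M_def)
  ultimately have m: "Max M \<in> M" "\<And>n. n \<in> M \<Longrightarrow> n \<le> Max M" by (auto intro: Max_in)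
  define m where "m = Max M"
  obtain i where i: "R\<^sup>*\<^sup>* i0 i" "a i = take m s" "m \<le> length s" using m(1) by (auto simp: M_def m_def)
  have "m \<noteq> length s" using disj[OF i(1), of i0] i root by auto
  then have ml: "m < length s" using i by simp
  have m0: "0 < m" using i(2) red(3)[of i] by (cases m) auto
  \<comment> \<open>The least such \<open>n\<close> marks the first later point of \<open>s\<close>
    that belongs to the second set.\<close>
  define Pn where "Pn n \<longleftrightarrow> m < n \<and> n \<le> length s \<and> (\<exists>j. R\<^sup>*\<^sup>* i0 j \<and> b j = take n s)" for n
  have "Pn (length s)" using ml root by (auto simp: Pn_def intro!: exI[of _ i0])
  define n where "n = (LEAST n. Pn n)"
  have n: "Pn n" "\<And>k. Pn k \<Longrightarrow> n \<le> k" unfolding n_def by (rule LeastI[of Pn, OF \<open>Pn (length s)\<close>], rule Least_le)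
  obtain j where j: "R\<^sup>*\<^sup>* i0 j" "b j = take n s" "m < n" "n \<le> length s" using n(1) by (auto simp: Pn_def)
  have mem: "k \<le> m" if "R\<^sup>*\<^sup>* i0 l" "a l = take k s" "k \<le> length s" for k l
  proof -
    have "k \<in> M" using that unfolding M_def by blast
    then show ?thesis using m(2) by (simp add: m_def)
  qed
  \<comment> \<open>To enter the subtree behind the first edge of the segment, the first set would
    have to contain the next point of \<open>s\<close>.\<close>
  have na: "\<not> prefix (take (Suc m) s) (a k)" if "R\<^sup>*\<^sup>* i0 k" for k
    using that
  proof (induction rule: rtranclp_induct)
    case base
    then show ?case using root ml m0 s by (auto dest!: prefix_length_le)
  next
    case (step k l)
    show ?case
    proof
      assume p: "prefix (take (Suc m) s) (a l)"
      obtain y where "a l = red (a k @ [y])" using assms(8)[OF step(1,2)] by blast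
      then have "take (Suc m) s = a l"
        using prefix_red_snoc[OF red(1)[of k] red(3)[of k], of "take (Suc m) s" y] p step.IH by auto
      then show False using mem[of l "Suc m"] step(1,2) ml by (simp add: rtranclp.rtrancl_into_rtrancl)
    qed
  qed
  \<comment> \<open>To leave the subtree above \<open>take n s\<close>, the second set would have to
    contain \<open>take (n - 1) s\<close>. This is excluded by disjointness if
    \<open>n - 1 = m\<close> and by the choice of \<open>n\<close> otherwise.\<close>
  have pb: "prefix (take n s) (b k)" if "R\<^sup>*\<^sup>* i0 k" for k
    using that
  proof (induction rule: rtranclp_induct)
    case base
    then show ?case using root by (simp add: take_is_prefix)
  next
    case (step k l)
    have l: "R\<^sup>*\<^sup>* i0 l" using step(1,2) by (rule rtranclp.rtrancl_into_rtrancl)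
    obtain y where y: "b l = red (b k @ [y])" using assms(8)[OF step(1,2)] by blast
    show ?case
    proof (rule ccontr)
      assume np: "\<not> prefix (take n s) (b l)"
      then have bl: "b l = butlast (b k)"
        using y red_snoc[OF red(2)[of k] red(4)[of k], of y] step.IH by (auto split: if_splits intro: prefix_order.trans)
      have "b k = take n s"
      proof (rule ccontr)
        assume "b k \<noteq> take n s"
        then have "strict_prefix (take n s) (b k)" using step.IH by auto
        then have "prefix (take n s) (butlast (b k))" by (auto simp: strict_prefix_def prefix_def butlast_append)
        then show False using bl np by simp
      qed
      then have bl': "b l = take (n - 1) s" using bl j by (simp add: butlast_take)
      show False
      proof (cases "n - 1 = m")
        case True
        then show False using disj[OF i(1) l] i(2) bl' by simp
      next
        case False
        then have "Pn (n - 1)" using j l bl' by (auto simp: Pn_def)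
        then show False using n(2)[of "n - 1"] j by simp
      qed
    qed
  qed
  have split: "take n s = take m s @ s ! m # drop (Suc m) (take n s)"
    using id_take_nth_drop[of m "take n s"] j ml by (simp add: min_def)
  have "take (Suc m) s = a i @ [s ! m]" using ml i by (simp add: take_Suc_conv_app_nth)
  then show thesis using that[of i j "s ! m" "drop (Suc m) (take n s)"] i j split pb na by auto
qed

text \<open>\<open>a\<close> lies on the near side of the edge from \<open>p\<close> to
  \<open>d\<close>, so the geodesic from the end of \<open>a\<close> has to cross this edge and
  keeps all of \<open>d # z\<close>.\<close>

lemma red_geodesic:
  assumes "reduced a" "a \<noteq> []" "reduced (p @ d # z)" "p \<noteq> []" "hd p = hd a" "\<not> prefix (p @ [d]) a"
  shows "red (rev a @ p @ d # z) = red (rev a @ p) @ d # z"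
proof -
  \<comment> \<open>\<open>l\<close> ends at the branch point of \<open>a\<close> and
    \<open>p @ [d]\<close>.\<close>
  obtain l e a1 where l: "p @ [d] = l @ e" "a = l @ a1" "e = [] \<or> a1 = [] \<or> hd e \<noteq> hd a1"
    using longest_common_prefix[of "p @ [d]" a] by (metis list.sel(1) list.exhaust)
  have "e \<noteq> []" using l assms(6) by auto
  then obtain e' where e': "e = e' @ [d]" "p = l @ e'" using l(1) by (metis append_assoc butlast_append butlast_snoc append_butlast_last_id last_appendR last_snoc)
  have lne: "l \<noteq> []"
  proof
    assume "l = []"
    then show False using l assms(2,4,5) e' by (cases p; cases a) auto
  qed
  define c where "c = last l"
  have lc: "l = butlast l @ [c]" using lne by (simp add: c_def)
  have r1: "reduced (rev a1 @ [c])"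
    using assms(1) l(2) lc reduced_appendD2[of "butlast l" "c # a1"] reduced_rev[of "c # a1"] by (metis append_assoc append_Cons append_Nil rev.simps(2))
  have r2: "reduced (c # e' @ d # z)"
    using assms(3) e'(2) lc reduced_appendD2[of "butlast l" "c # e' @ d # z"] by (metis append_assoc append_Cons append_Nil)
  have r: "reduced (rev a1 @ c # e' @ d # z)"
  proof (cases a1)
    case (Cons h t)
    have "h \<noteq> hd (e' @ [d])" using l(3) Cons e'(1) by auto
    moreover have "h \<noteq> c" using r1 Cons reduced_appendD2[of "rev t" "[h, c]"] by simp
    ultimately have "reduced (h # c # e' @ d # z)" using r2 by (cases e') auto
    then show ?thesis using reduced_append_iff[of "rev t" h c "e' @ d # z"] r1 Cons by simp
  qed (use r2 in simp)
  have *: "red (rev a @ l @ x) = red (rev a1 @ c # x)" for x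
    using red_rev_append[OF lne, of "rev a1" x] l(2) by (simp add: c_def)
  have "red (rev a @ p @ d # z) = rev a1 @ c # e' @ d # z" using *[of "e' @ d # z"] e' r by simp
  moreover have "reduced (rev a1 @ c # e')" using reduced_appendD1[of "rev a1 @ c # e'" "d # z"] r by simp
  then have "red (rev a @ p) = rev a1 @ c # e'" using *[of e'] e' by simp
  ultimately show ?thesis by simp
qed

text \<open>Every step of \<open>s\<close> removes at most one vertex of \<open>a\<close>.\<close>

lemma prefix_take_red_append: "reduced a \<Longrightarrow> a \<noteq> [] \<Longrightarrow> prefix (take (length a - length s) a) (red (a @ s))"
proof (induction s rule: rev_induct)
  case (snoc x s)
  let ?R = "red (a @ s)"
  have IH: "prefix (take (length a - length s) a) ?R" using snoc by simp
  have R: "red (a @ s @ [x]) = red (?R @ [x])" by simp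
  have "prefix (butlast ?R) (red (?R @ [x]))"
    using red_snoc[of ?R x] snoc.prems by (auto simp: prefixeq_butlast intro: prefix_order.trans[OF prefixeq_butlast])
  moreover have "prefix (take (length a - length (s @ [x])) a) (butlast ?R)"
  proof -
    have "prefix (butlast (take (length a - length s) a)) (butlast ?R)"
    proof -
      obtain z where z: "?R = take (length a - length s) a @ z" using IH by (auto simp: prefix_def)
      show ?thesis unfolding z by (cases "z = []") (auto simp: butlast_append intro: prefix_order.trans[OF prefixeq_butlast])
    qed
    moreover have "butlast (take (length a - length s) a) = take (length a - length (s @ [x])) a"
      by (cases "length a \<le> length s") (simp_all add: butlast_take)
    ultimately show ?thesis by simp
  qed
  ultimately show ?case using R prefix_order.trans by metis
qed simp

text \<open>Powers of a conjugate are conjugates of powers.\<close>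

lemma red_replicate_Cons_snoc:
  assumes "B \<noteq> []" "hd B = y" "last B = y"
  shows "red (concat (replicate (Suc k) (x # B @ [x]))) = red (x # concat (replicate (Suc k) B) @ [x])"
proof (induction k)
  case (Suc k)
  let ?Bk = "concat (replicate (Suc k) B)"
  obtain B' where B': "B = B' @ [y]" using assms by (metis append_butlast_last_id)
  obtain B2 where B2: "?Bk = y # B2" using assms by (cases B) auto
  have "red (concat (replicate (Suc (Suc k)) (x # B @ [x]))) = red ((x # B @ [x]) @ red (x # ?Bk @ [x]))"
    using Suc red_append_red[of "x # B @ [x]" "concat (replicate (Suc k) (x # B @ [x]))"] by simp
  also have "\<dots> = red ((x # B @ [x]) @ x # ?Bk @ [x])" by (rule red_append_red)
  also have "\<dots> = red ((x # B) @ x # x # ?Bk @ [x])" by simp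
  also have "\<dots> = red ((x # B) @ x # ?Bk @ [x])" by (rule red_stay)
  also have "\<dots> = red ((x # B') @ y # x # y # B2 @ [x])" using B' B2 by simp
  also have "\<dots> = red ((x # B') @ y # B2 @ [x])" by (rule red_back)
  also have "\<dots> = red ((x # B') @ y # y # B2 @ [x])" by (rule red_stay[symmetric])
  also have "\<dots> = red (x # concat (replicate (Suc (Suc k)) B) @ [x])" using B' B2 by simp
  finally show ?case .
qed simp

text \<open>Powers of a nontrivial closed walk get arbitrarily long. The two vertices at either end
  are carried through the induction to see that gluing a further copy, or adding \<open>x\<close> at
  both ends, leaves the walk reduced.\<close>

lemma red_power:
  assumes "reduced A" "hd A = last A" "2 \<le> length A" "1 \<le> k"
  shows "k < length (red (concat (replicate k A))) \<and>
    take 2 (red (concat (replicate k A))) = take 2 A \<and>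
    take 2 (rev (red (concat (replicate k A)))) = take 2 (rev A)"
  using assms
proof (induction "length A" arbitrary: A rule: less_induct)
  case less
  obtain x y A1 where A1: "A = x # y # A1" using less.prems(3) by (metis Suc_le_length_iff numeral_2_eq_2)
  obtain A2 z where A2: "A = A2 @ [z, x]"
  proof -
    obtain A3 where A3: "A = A3 @ [x]" using less.prems(2) A1 by (metis append_butlast_last_id list.sel(1) list.distinct(1))
    then obtain A4 z where "A3 = A4 @ [z]" using A1 by (cases A3 rule: rev_cases) auto
    then show thesis using that A3 by simp
  qed
  have xz: "z \<noteq> x" and xy: "x \<noteq> y"
    using less.prems(1) A1 A2 reduced_appendD2[of A2 "[z, x]"] reduced_appendD1[of "[x, y]" A1] by auto
  have A2ne: "A2 \<noteq> []" using A1 A2 xz by (cases A2) auto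
  show ?case
  proof (cases "y = z")
    \<comment> \<open>\<open>A\<close> is cyclically reduced: copies of it merge in their common
      vertex without further cancellation.\<close>
    case False
    have "Suc k < length (red (concat (replicate (Suc k) A))) \<and>
      (\<exists>R. red (concat (replicate (Suc k) A)) = x # y # R) \<and> (\<exists>R. red (concat (replicate (Suc k) A)) = R @ [z, x])" for k
    proof (induction k)
      case 0
      have "length A > 2" using A1 A2 A2ne by (metis One_nat_def Suc_less_eq length_append length_greater_0_conv add_2_eq_Suc' length_Cons list.size(3) numeral_2_eq_2)
      then show ?case using less.prems(1) A1 A2 by (metis Suc_lessD One_nat_def numeral_2_eq_2 append_Nil2 concat.simps red_reduced replicate_0 replicate_Suc)
    next
      case (Suc k)
      let ?R = "red (concat (replicate (Suc k) A))"
      obtain R1 where R1: "?R = x # y # R1" using Suc by blast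
      obtain R2 where R2: "?R = R2 @ [z, x]" using Suc by blast
      have "reduced (x # y # R1)" using R1 reduced_red[of "concat (replicate (Suc k) A)"] by metis
      then have "reduced (z # x # y # R1)" using False xz by auto
      then have rr: "reduced (A2 @ [z, x] @ y # R1)" using reduced_append_iff[of A2 z x "y # R1"] less.prems(1) A2 by simp
      have "red (concat (replicate (Suc (Suc k)) A)) = red (A @ ?R)" by simp
      also have "\<dots> = red ((A2 @ [z]) @ x # x # y # R1)" using A2 R1 by simp
      also have "\<dots> = A2 @ [z, x] @ y # R1" using red_stay[of "A2 @ [z]" x "y # R1"] rr by simp
      finally have eq: "red (concat (replicate (Suc (Suc k)) A)) = A2 @ [z, x] @ y # R1" .
      then have eq2: "red (concat (replicate (Suc (Suc k)) A)) = A2 @ [z] @ R2 @ [z, x]" using R1 R2 by simp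
      obtain A3 where A3: "A2 @ [z] = x # y # A3" using A1 A2 A2ne by (cases A2; cases "tl A2") auto
      show ?case
      proof (intro conjI)
        show "\<exists>R. red (concat (replicate (Suc (Suc k)) A)) = R @ [z, x]" using eq2 by (metis append_assoc)
        show "\<exists>R. red (concat (replicate (Suc (Suc k)) A)) = x # y # R" using eq A3
          by (intro exI[of _ "A3 @ x # y # R1"]) (metis append_Cons append_Nil append_assoc)
        have "Suc k < length ?R" using Suc by blast
        then have "Suc k < length (R2 @ [z, x])" unfolding R2 .
        then show "Suc (Suc k) < length (red (concat (replicate (Suc (Suc k)) A)))" unfolding eq2 by simp
      qed
    qed
    from this[of "k - 1"] less.prems(4)
    obtain R R1 R2 where R: "R = red (concat (replicate k A))" "k < length R" "R = x # y # R1" "R = R2 @ [z, x]"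
      by auto
    have "take 2 R = take 2 A" by (simp add: R(3) A1)
    moreover have "take 2 (rev R) = take 2 (rev A)" by (simp add: R(4) A2)
    ultimately show ?thesis using R(1,2) by simp
  next
    \<comment> \<open>\<open>A\<close> is the conjugate, by one edge, of a shorter closed walk
      \<open>B\<close>.\<close>
    case True
    obtain A3 where A3: "A2 = x # A3" using A1 A2 A2ne by (cases A2) auto
    define B where "B = A3 @ [y]"
    have AB: "A = x # B @ [x]" using A2 A3 True by (simp add: B_def)
    have B: "hd B = y" "last B = y" "B \<noteq> []" using A1 AB by (cases A3; auto simp: B_def)+
    have "B \<noteq> [y]" using less.prems(1) AB by auto
    then have len: "2 \<le> length B" using B by (cases B; cases "tl B") auto
    have rB: "reduced B" using less.prems(1) AB reduced_Cons reduced_appendD1 by metis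
    let ?R = "red (concat (replicate k B))"
    have IH: "k < length ?R" "take 2 ?R = take 2 B" "take 2 (rev ?R) = take 2 (rev B)"
      using less.hyps[of B] AB rB B len less.prems(4) by auto
    obtain k' where k': "k = Suc k'" using less.prems(4) by (cases k) auto
    obtain y2 B1 where B1: "B = y # y2 # B1" using len B by (cases B; cases "tl B") auto
    obtain y3 B2 where B2: "rev B = y # y3 # B2" using len B by (cases "rev B"; cases "tl (rev B)") (auto simp: last_rev hd_rev[symmetric])
    obtain R1 where R1: "?R = y # y2 # R1" using IH(2) B1 by (cases ?R; cases "tl ?R") auto
    obtain R2 where R2: "rev ?R = y # y3 # R2" using IH(3) B2 by (cases "rev ?R"; cases "tl (rev ?R)") auto
    have r1: "reduced (x # ?R)" using R1 less.prems(1) AB B1 reduced_red[of "concat (replicate k B)"] by (metis append_Cons reduced.simps(1))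
    have "reduced (rev A)" using less.prems(1) by simp
    then have "x \<noteq> y" "x \<noteq> y3" using AB B2 by auto
    moreover have "reduced (rev (x # ?R))" using r1 reduced_rev by blast
    ultimately have "reduced (x # y # y3 # R2 @ [x])"
      using R2 by simp
    then have "reduced (rev (x # ?R @ [x]))" using R2 by simp
    then have "reduced (x # ?R @ [x])" using reduced_rev by blast
    moreover have "red (concat (replicate k A)) = red (x # ?R @ [x])"
      using red_replicate_Cons_snoc[OF B(3,1,2), of k' x] red_cong[of "[x]" "[x]" "concat (replicate k B) @ [x]" "?R @ [x]"]
      unfolding AB k' by simp
    ultimately have eq: "red (concat (replicate k A)) = x # ?R @ [x]" by simp
    have "take 2 (x # ?R @ [x]) = take 2 A" using R1 AB B1 by (simp add: numeral_2_eq_2)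
    moreover have "take 2 (rev (x # ?R @ [x])) = take 2 (rev A)" using R2 AB B2 by (simp add: numeral_2_eq_2)
    ultimately show ?thesis using IH(1) eq by simp
  qed
qed

lemma concat_replicate_Suc: "concat (replicate (Suc k) xs) = concat (replicate k xs) @ xs"
  by (induction k) auto

text \<open>\<open>S\<close> can be moved past one factor after the other.\<close>

lemma red_power_commute:
  assumes "red (A @ S) = red (S @ B)"
  shows "red (concat (replicate k A) @ S) = red (S @ concat (replicate k B))"
proof (induction k)
  case (Suc k)
  have "red (concat (replicate (Suc k) A) @ S) = red (A @ S @ concat (replicate k B))"
    using red_cong[OF refl Suc, of A] by simp
  also have "\<dots> = red (S @ concat (replicate (Suc k) B))"
    using red_cong[OF assms refl, of "concat (replicate k B)"] by simp
  finally show ?case .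
qed simp

lemma red_power_inverse:
  assumes "A \<noteq> []" "hd A = last A" "X \<noteq> []" "hd X = hd A"
  shows "red (concat (replicate k (rev A)) @ concat (replicate k A) @ X) = red X"
proof (induction k)
  case (Suc k)
  have 1: "concat (replicate (Suc k) (rev A)) = concat (replicate k (rev A)) @ rev A"
    by (rule concat_replicate_Suc)
  let ?Y = "concat (replicate k A) @ X"
  have Y: "?Y \<noteq> []" "hd ?Y = last A" using assms by (cases k; simp add: hd_append)+
  have "red (concat (replicate (Suc k) (rev A)) @ concat (replicate (Suc k) A) @ X)
      = red (concat (replicate k (rev A)) @ rev A @ A @ ?Y)" by (simp add: 1 del: replicate_Suc) simp
  also have "\<dots> = red (concat (replicate k (rev A)) @ last A # ?Y)" by (rule red_rev_append[OF assms(1)])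
  also have "\<dots> = red (concat (replicate k (rev A)) @ ?Y)" using red_hd[OF Y(1), of _ "[]"] Y(2) by simp
  finally show ?case using Suc by simp
qed simp

text \<open>The solutions of \<open>A S = S B\<close> in a free group: the lines through the powers of \<open>A\<close> and, translated
  by \<open>S\<close>, of \<open>B\<close> must meet in the universal cover, as they stay at bounded distance.\<close>

lemma conjugacy:
  assumes AB: "red (A @ S) = red (S @ B)" and c: "length A = c" "length B = c" and A: "A \<noteq> []" "hd A = last A" "hd S = hd A"
    and B: "hd B = last B" "last S = hd B" and S: "reduced S" "S \<noteq> []" and nt: "red A \<noteq> [hd A]"
  obtains D k i j where "D = A \<or> D = rev A" "k \<le> length S + 2 * c" "1 \<le> i" "i \<le> c" "1 \<le> j" "j \<le> c"
    "S = red (concat (replicate k D) @ take i A @ rev (take j B))" "A ! (i - 1) = B ! (j - 1)"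
proof -
  have c0: "0 < c" and Bne: "B \<noteq> []" using A(1) c by auto
  \<comment> \<open>The first \<open>i\<close> vertices of the periodic walk through endlessly many
    copies of \<open>L\<close>.\<close>
  define X where "X L i = map (\<lambda>t. L ! (t mod c)) [0..<i]" for i and L :: "'a list"
  have X_Suc: "X L (Suc i) = X L i @ [L ! (i mod c)]" for L i by (simp add: X_def)
  have X0: "X L (Suc 0) = [hd L]" if "length L = c" for L using that c0 by (cases L) (auto simp: X_def)
  have X_add: "X L (k * c + j) = X L (k * c) @ take j L" if "length L = c" "j \<le> c" for L k j
    using that(2)
  proof (induction j)
    case (Suc j)
    then have "(k * c + j) mod c = j" by simp
    then show ?case using Suc X_Suc[of L "k * c + j"] that(1) by (simp add: take_Suc_conv_app_nth)
  qed simp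
  have X_mult: "X L (k * c) = concat (replicate k L)" if "length L = c" for L k
  proof (induction k)
    case (Suc k)
    have "X L (Suc k * c) = X L (k * c + c)" by (simp add: add.commute)
    also have "\<dots> = concat (replicate k L) @ L" using X_add[OF that, of c k] Suc that by simp
    also have "\<dots> = concat (replicate (Suc k) L)" by (rule concat_replicate_Suc[symmetric])
    finally show ?case .
  qed (simp add: X_def)
  define a where "a i = red (X A (Suc i))" for i
  define b where "b i = red (S @ X B (Suc i))" for i
  have Xne: "X L (Suc i) \<noteq> []" for L i by (simp add: X_def)
  have all: "(\<lambda>i j. j = Suc i)\<^sup>*\<^sup>* 0 i" for i
    by (induction i) (auto intro: rtranclp.rtrancl_into_rtrancl)
  have b0: "b 0 = S" using X0[OF c(2)] red_last[OF S(2), of "[]" "[]"] B(2) S by (simp add: b_def)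
  \<comment> \<open>After whole periods \<open>b i\<close> is a power of \<open>A\<close> followed
    by \<open>S\<close>, so it shares with \<open>a i\<close> all but at most the last
    \<open>length S\<close> vertices of \<open>a i\<close>.\<close>
  have far: "length (a i) \<le> l + length S"
    if "i = Suc k * c - 1" "prefix q (b i)" "\<not> prefix q (a i)" "length q = l" for i k q l
  proof (rule ccontr)
    assume *: "\<not> ?thesis"
    have i: "Suc i = Suc k * c" using that(1) c0 by simp
    have "b i = red (concat (replicate (Suc k) A) @ S)"
      using red_power_commute[OF AB, of "Suc k"] X_mult[OF c(2), of "Suc k"] i by (simp add: b_def)
    also have "\<dots> = red (a i @ S)" using X_mult[OF c(1), of "Suc k"] i by (simp add: a_def)
    finally have "prefix (take (length (a i) - length S) (a i)) (b i)"
      using prefix_take_red_append[of "a i" S] Xne by (simp add: a_def)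
    then have "prefix q (take (length (a i) - length S) (a i))"
      using prefix_length_prefix[OF that(2)] * that(4) by auto
    then show False using that(3) prefix_order.trans take_is_prefix by blast
  qed
  have redA: "red (concat (replicate k A)) = red (concat (replicate k (red A)))" for k
    by (induction k) (auto intro: red_cong)
  have pow: "k \<le> length (red (concat (replicate k A)))" for k
  proof (cases "k = 0")
    case False
    have "length (red A) \<noteq> Suc 0" using nt A(1) hd_red[of A] by (cases "red A") auto
    then have "2 \<le> length (red A)" using A(1) red_eq_Nil[of A] by (cases "red A") (auto simp: Suc_le_eq simp del: red_eq_Nil)
    then have "k < length (red (concat (replicate k (red A))))"
      using red_power[of "red A" k] A False by auto
    then show ?thesis using redA by simp
  qed simp
  have "\<exists>i j. a i = b j"
  proof (rule ccontr)
    assume nomeet: "\<not> ?thesis"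
    obtain i j d z where br: "b j = a i @ d # z" "\<And>k. prefix (b j) (b k)" "\<And>k. \<not> prefix (a i @ [d]) (a k)"
    proof (rule bridge[of a b 0 "hd A" S "\<lambda>i j. j = Suc i"])
      show "a 0 = [hd A]" using X0[OF c(1)] by (simp add: a_def)
      show "\<And>i j. j = Suc i \<Longrightarrow> (\<exists>y. a j = red (a i @ [y])) \<and> (\<exists>y. b j = red (b i @ [y]))"
        by (auto simp: a_def b_def X_Suc)
    qed (use all nomeet that b0 A Xne S in \<open>auto simp: a_def b_def\<close>)
    \<comment> \<open>By \<open>far\<close>, the power with exponent \<open>Suc K\<close> would have
      length at most \<open>K\<close>, whereas \<open>pow\<close> gives at least
      \<open>Suc K\<close>.\<close>
    define K where "K = length (b j) + length S"
    have "\<not> prefix (b j) (a (Suc K * c - 1))"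
    proof
      assume "prefix (b j) (a (Suc K * c - 1))"
      then have "prefix (a i @ [d]) (a (Suc K * c - 1))" unfolding br(1)
        by (metis append_Cons append_Nil append_assoc append_prefixD)
      then show False using br(3) by blast
    qed
    from far[OF refl br(2) this refl] have "length (a (Suc K * c - 1)) \<le> K" by (simp add: K_def)
    moreover have "a (Suc K * c - 1) = red (concat (replicate (Suc K) A))"
      using X_mult[OF c(1), of "Suc K"] c0 by (simp add: a_def)
    ultimately show False using pow[of "Suc K"] by simp
  qed
  then obtain i j where ij: "a i = b j" by blast
  \<comment> \<open>The meeting point gives \<open>A^k1 x = S B^k2 y = A^k2 S y\<close> with initial
    parts \<open>x\<close> of \<open>A\<close> and \<open>y\<close> of \<open>B\<close>. Which of
    \<open>k1\<close> and \<open>k2\<close> is larger decides between \<open>A\<close> and its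
    reverse.\<close>
  define k1 i' where "k1 = i div c" and "i' = Suc (i mod c)"
  define k2 j' where "k2 = j div c" and "j' = Suc (j mod c)"
  have i': "1 \<le> i'" "i' \<le> c" "Suc i = k1 * c + i'" using c0 by (auto simp: i'_def k1_def Suc_le_eq)
  have j': "1 \<le> j'" "j' \<le> c" "Suc j = k2 * c + j'" using c0 by (auto simp: j'_def k2_def Suc_le_eq)
  define x y where "x = take i' A" and "y = take j' B"
  have x: "x \<noteq> []" "hd x = hd A" "length x \<le> c" and y: "y \<noteq> []" "hd y = hd B" "length y \<le> c"
    using i' j' A Bne by (auto simp: x_def y_def)
  have "red (concat (replicate k1 A) @ x) = red (S @ concat (replicate k2 B) @ y)"
    using ij X_add[OF c(1) i'(2), of k1] X_add[OF c(2) j'(2), of k2] X_mult[OF c(1)] X_mult[OF c(2)] i'(3) j'(3)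
    by (simp add: a_def b_def x_def y_def)
  also have "\<dots> = red (concat (replicate k2 A) @ S @ y)"
    using red_cong[OF red_power_commute[OF AB, of k2] refl, of y] by simp
  finally have eq: "red (concat (replicate k1 A) @ x) = red (concat (replicate k2 A) @ S @ y)" .
  have "last x = last (concat (replicate k1 A) @ x)" using x by simp
  also have "\<dots> = last (concat (replicate k2 A) @ S @ y)" using eq last_red by metis
  finally have last: "last x = last y" using y by simp
  have nth: "A ! (i' - 1) = B ! (j' - 1)"
    using last i' j' c by (simp add: x_def y_def last_take)
  have rep_add: "concat (replicate (m + n) A) = concat (replicate m A) @ concat (replicate n A)" for m n
    by (simp add: replicate_add)
  have Sy: "red (S @ y @ rev y) = S" using red_append_rev[OF y(1), of S "[]"] red_last[OF S(2), of "[]" "[]"] y(2) B(2) S(1) by simp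
  obtain D k where D: "D = A \<or> D = rev A" "red (concat (replicate k D) @ x) = red (S @ y)"
    "length (red (concat (replicate k D))) \<ge> k"
  proof (cases "k2 \<le> k1")
    case True
    let ?n = "concat (replicate (k1 - k2) A)"
    have 1: "?n @ x \<noteq> []" "hd (?n @ x) = hd A" using x A(1) by (cases "k1 - k2"; simp add: hd_append)+
    have 2: "S @ y \<noteq> []" "hd (S @ y) = hd A" using S A by auto
    have "red (concat (replicate k2 A) @ ?n @ x) = red (concat (replicate k2 A) @ S @ y)"
      using eq rep_add[of k2 "k1 - k2"] True by simp
    then have "red (concat (replicate k2 (rev A)) @ concat (replicate k2 A) @ ?n @ x)
        = red (concat (replicate k2 (rev A)) @ concat (replicate k2 A) @ S @ y)" by (rule red_cong[OF refl])
    then have "red (?n @ x) = red (S @ y)"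
      using red_power_inverse[OF A(1,2) 1] red_power_inverse[OF A(1,2) 2] by simp
    then show thesis using that[of A "k1 - k2"] pow by simp
  next
    case False
    let ?n = "concat (replicate (k2 - k1) A)"
    have 1: "?n @ S @ y \<noteq> []" "hd (?n @ S @ y) = hd A" using S A by (cases "k2 - k1"; simp add: hd_append)+
    have 2: "S @ y \<noteq> []" "hd (S @ y) = hd A" using S A by auto
    have "red (concat (replicate k1 A) @ x) = red (concat (replicate k1 A) @ ?n @ S @ y)"
      using eq rep_add[of k1 "k2 - k1"] False by simp
    then have "red (concat (replicate k1 (rev A)) @ concat (replicate k1 A) @ x)
        = red (concat (replicate k1 (rev A)) @ concat (replicate k1 A) @ ?n @ S @ y)" by (rule red_cong[OF refl])
    then have "red x = red (?n @ S @ y)"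
      using red_power_inverse[OF A(1,2) x(1,2)] red_power_inverse[OF A(1,2) 1] by simp
    then have "red (concat (replicate (k2 - k1) (rev A)) @ x) = red (concat (replicate (k2 - k1) (rev A)) @ ?n @ S @ y)"
      by (rule red_cong[OF refl])
    then have "red (concat (replicate (k2 - k1) (rev A)) @ x) = red (S @ y)"
      using red_power_inverse[OF A(1,2) 2] by simp
    moreover have "length (red (concat (replicate (k2 - k1) (rev A)))) \<ge> k2 - k1"
    proof -
      have "concat (replicate n (rev A)) = rev (concat (replicate n A))" for n
      proof (induction n)
        case (Suc n)
        then show ?case unfolding concat_replicate_Suc[of n "rev A"] by simp
      qed simp
      then show ?thesis using pow[of "k2 - k1"] by (simp add: red_rev)
    qed
    ultimately show thesis using that[of "rev A" "k2 - k1"] by simp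
  qed
  have "S = red (concat (replicate k D) @ x @ rev y)"
    using red_cong[OF D(2) refl, of "rev y"] Sy by simp
  \<comment> \<open>The power \<open>D^k\<close> has reduced length at least \<open>k\<close>, and
    it equals \<open>S\<close>, \<open>y\<close> and the reverse of \<open>x\<close> in a row, where
    \<open>x\<close> and \<open>y\<close> have length at most \<open>c\<close>.\<close>
  moreover have "k \<le> length S + 2 * c"
  proof (cases "k = 0")
    case False
    let ?n = "concat (replicate k D)"
    have n: "?n \<noteq> []" "last ?n = hd x"
    proof -
      have Dl: "last D = hd A" "D \<noteq> []" using D(1) A by (auto simp: last_rev)
      have "?n = concat (replicate (k - 1) D) @ D"
        using False concat_replicate_Suc[of "k - 1" D] by simp
      then show "?n \<noteq> []" "last ?n = hd x" using Dl x by auto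
    qed
    have "red ?n = red (?n @ x @ rev x)"
      using red_append_rev[OF x(1), of ?n "[]"] red_last[OF n(1), of "[]" "[]"] n(2) by simp
    also have "\<dots> = red (S @ y @ rev x)" using red_cong[OF D(2) refl, of "rev x"] by simp
    finally have "length (red ?n) \<le> length (S @ y @ rev x)" using length_red_le by metis
    then show ?thesis using D(3) x y by simp
  qed simp
  ultimately show thesis using that[OF D(1) _ i'(1,2) j'(1,2) _ nth] by (simp add: x_def y_def)
qed


section \<open>Traces along walks, and moves of constant colourings\<close>

context recoloring
begin

text \<open>The squares of \<open>adj\<close> are glued along \<open>W\<close>. For a closed walk
  the result is the conjugacy equation; for a path from the root it determines the trace of the
  other end.\<close>

lemma trace_walk:
  assumes "ok \<alpha> ms" "successively nb W" "W \<noteq> []"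
  shows "red (map \<alpha> W @ tr \<alpha> ms (last W)) = red (tr \<alpha> ms (hd W) @ map (final \<alpha> ms) W)"
  using assms(2,3)
proof (induction W rule: induct_list012)
  case (2 v)
  have "red (\<alpha> v # tr \<alpha> ms v) = red (tr \<alpha> ms v)" using red_hd[of "tr \<alpha> ms v" "[]" "[]"] by simp
  moreover have "red (tr \<alpha> ms v @ [final \<alpha> ms v]) = red (tr \<alpha> ms v)"
    using red_last[of "tr \<alpha> ms v" "[]" "[]"] by simp
  ultimately show ?case by simp
next
  case (3 u v W)
  let ?\<beta> = "final \<alpha> ms"
  have "red (map \<alpha> (u # v # W) @ tr \<alpha> ms (last (u # v # W))) = red ([\<alpha> u] @ tr \<alpha> ms v @ map ?\<beta> (v # W))"
    using red_cong[OF refl 3(2), of "[\<alpha> u]"] 3(3) by simp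
  also have "\<dots> = red (tr \<alpha> ms u @ [?\<beta> v] @ map ?\<beta> (v # W))"
    using red_cong[OF adj_tr[OF assms(1), of u v, unfolded adj_def] refl, of "map ?\<beta> (v # W)"] 3(3) by simp
  also have "\<dots> = red (tr \<alpha> ms u @ map ?\<beta> (u # v # W))"
    using red_stay[of "tr \<alpha> ms u" "?\<beta> v" "map ?\<beta> W"] red_last[of "tr \<alpha> ms u" "[]" "map ?\<beta> (v # W)"] by simp
  finally show ?case by simp
qed simp

lemma successively_tr: "ok \<phi> ms \<Longrightarrow> successively (\<lambda>a b. EH a b \<and> EH b b) (tr \<phi> ms v)"
proof (induction ms rule: rev_induct)
  case (snoc m ms)
  then show ?case by (auto simp: tr_snoc ok_append successively_append_iff valid_def)
qed simp

lemma set_red: "set (red xs) \<subseteq> set xs"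
proof (induction xs rule: rev_induct)
  case (snoc x xs)
  have "set (push st x) \<subseteq> insert x (set st)" for st :: "'c list" by (cases "(st, x)" rule: push.cases) auto
  then show ?case using snoc by (fastforce simp: red_def)
qed simp

lemma EH_refl_tr: "ok \<phi> ms \<Longrightarrow> EH (\<phi> v) (\<phi> v) \<Longrightarrow> c \<in> set (tr \<phi> ms v) \<Longrightarrow> EH c c"
proof (induction ms rule: rev_induct)
  case (snoc m ms)
  then show ?case by (auto simp: tr_snoc ok_append valid_def split: if_splits)
qed simp

definition const_on :: "('a \<Rightarrow> 'b) \<Rightarrow> 'b \<Rightarrow> 'a \<Rightarrow> 'b" where
  "const_on \<alpha> c v = (if v \<in> V then c else \<alpha> v)"

text \<open>If all vertices can move from \<open>a\<close> to \<open>b\<close> along an arc without reverse arc, then every vertex moves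
  after its out-neighbours. In the same order, all vertices can move along any arc.\<close>

lemma const_step_transfer:
  assumes "ok (const_on \<alpha> a) ms" "\<And>v. v \<in> V \<Longrightarrow> moves ms v = [b]" "a \<noteq> b"
    and E: "EH a' b'" "EH b' b'" "a' \<noteq> b'" "EH b' a' \<or> \<not> EH b a"
  shows "\<exists>ms'. ok (const_on \<alpha> a') ms' \<and> (\<forall>v\<in>V. moves ms' v = [b'])"
proof -
  define f where "f c = (if c = a then a' else b')" for c
  have gen: "ok (\<lambda>v. if v \<in> V then f (\<phi> v) else \<alpha> v) (map (\<lambda>m. (fst m, b')) ns)"
    if "ok \<phi> ns" "\<And>v. v \<in> V \<Longrightarrow> \<phi> v = a \<or> \<phi> v = b" "\<And>m. m \<in> set ns \<Longrightarrow> snd m = b" for \<phi> ns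
    using that
  proof (induction ns arbitrary: \<phi>)
    case (Cons m ns)
    let ?f = "\<lambda>\<phi> v. if v \<in> V then f (\<phi> v) else \<alpha> v"
    have m: "snd m = b" "fst m \<in> V" "\<phi> (fst m) = a" and val: "valid \<phi> (fst m) b"
      using Cons.prems by (auto simp: valid_def)
    have "valid (?f \<phi>) (fst m) b'"
      unfolding valid_def
    proof (intro conjI allI impI)
      fix w
      assume w: "w \<noteq> fst m"
      { assume "EG (fst m) w"
        then have "w \<in> V" "\<phi> w = b \<or> \<phi> w = a \<and> EH b a" using val w EG_V m by (auto simp: valid_def)
        then show "?f \<phi> w = b' \<or> ?f \<phi> w = ?f \<phi> (fst m) \<and> EH b' (?f \<phi> (fst m))"
          using m E assms(3) by (auto simp: f_def) }
      { assume "EG w (fst m)"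
        then have "w \<in> V" "\<phi> w = a \<or> \<phi> w = b" using Cons.prems EG_V by auto
        then show "?f \<phi> w = ?f \<phi> (fst m) \<or> ?f \<phi> w = b'"
          using m by (auto simp: f_def) }
    qed (use m E in \<open>auto simp: f_def\<close>)
    moreover have "(?f \<phi>)(fst m := b') = ?f (\<phi>(fst m := snd m))"
      using m assms(3) by (auto simp: f_def fun_eq_iff)
    moreover have "ok (?f (\<phi>(fst m := snd m))) (map (\<lambda>m. (fst m, b')) ns)"
    proof (rule Cons.IH)
      show "ok (\<phi>(fst m := snd m)) ns" using Cons.prems(1) unfolding ok.simps by blast
    qed (use Cons.prems m in auto)
    ultimately show ?case by simp
  qed simp
  have "ok (\<lambda>v. if v \<in> V then f (const_on \<alpha> a v) else \<alpha> v) (map (\<lambda>m. (fst m, b')) ms)"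
  proof (rule gen[OF assms(1)])
    fix m assume m: "m \<in> set ms"
    have "fst m \<in> V"
    proof -
      obtain xs ys where "ms = xs @ m # ys" using m by (meson split_list)
      then show ?thesis using assms(1) by (simp add: ok_append valid_def)
    qed
    moreover have "snd m \<in> set (moves ms (fst m))" using m by (auto simp: moves_def)
    ultimately show "snd m = b" using assms(2) by simp
  qed (auto simp: const_on_def)
  moreover have "(\<lambda>v. if v \<in> V then f (const_on \<alpha> a v) else \<alpha> v) = const_on \<alpha> a'"
    by (auto simp: const_on_def f_def)
  moreover have "moves (map (\<lambda>m. (fst m, b')) ms) v = [b']" if "v \<in> V" for v
  proof -
    have "moves (map (\<lambda>m. (fst m, b')) ms) v = map (\<lambda>_. b') (moves ms v)"
      by (induction ms) (auto simp: moves_Cons)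
    then show ?thesis using assms(2)[OF that] by simp
  qed
  ultimately show ?thesis by auto
qed

lemma final_moves_const:
  "(\<And>v. v \<in> V \<Longrightarrow> last (a # moves ms v) = b) \<Longrightarrow> ok (const_on \<alpha> a) ms \<Longrightarrow> final (const_on \<alpha> a) ms = const_on \<alpha> b"
proof
  fix v
  assume *: "\<And>v. v \<in> V \<Longrightarrow> last (a # moves ms v) = b" "ok (const_on \<alpha> a) ms"
  show "final (const_on \<alpha> a) ms v = const_on \<alpha> b v"
  proof (cases "v \<in> V")
    case True
    then have "tr (const_on \<alpha> a) ms v = a # moves ms v" by (simp add: tr_def const_on_def)
    then show ?thesis using *(1)[OF True] last_tr[of "const_on \<alpha> a" ms v] True by (simp add: const_on_def)
  next
    case False
    then show ?thesis using tr_outside[OF *(2) False] last_tr[of "const_on \<alpha> a" ms v] by (simp add: const_on_def)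
  qed
qed

text \<open>The arcs that a constant colouring is allowed to follow: all arcs, or with
  \<open>bi\<close> the symmetric ones.\<close>

definition EH_sym :: "bool \<Rightarrow> 'b \<Rightarrow> 'b \<Rightarrow> bool" where
  "EH_sym bi a b \<longleftrightarrow> EH a b \<and> (bi \<longrightarrow> EH b a)"

lemma const_path:
  assumes step: "\<And>a b. EH_sym bi a b \<Longrightarrow> a \<noteq> b \<Longrightarrow> \<exists>ms. ok (const_on \<alpha> a) ms \<and> (\<forall>v\<in>V. moves ms v = [b])"
    and "successively (EH_sym bi) g" "g \<noteq> []"
  shows "\<exists>ms. ok (const_on \<alpha> (hd g)) ms \<and> (\<forall>v\<in>V. red (hd g # moves ms v) = red g)"
  using assms(2,3)
proof (induction g rule: induct_list012)
  case (2 a)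
  then show ?case by (intro exI[of _ "[]"]) auto
next
  case (3 a b g)
  obtain ms where ms: "ok (const_on \<alpha> b) ms" "\<And>v. v \<in> V \<Longrightarrow> red (b # moves ms v) = red (b # g)"
    using 3 by auto
  show ?case
  proof (cases "a = b")
    case True
    then show ?thesis using ms by (intro exI[of _ ms]) auto
  next
    case False
    obtain ms0 where ms0: "ok (const_on \<alpha> a) ms0" "\<And>v. v \<in> V \<Longrightarrow> moves ms0 v = [b]"
      using step[of a b] 3 False by auto
    have "final (const_on \<alpha> a) ms0 = const_on \<alpha> b" by (rule final_moves_const) (use ms0 in auto)
    then have "ok (const_on \<alpha> a) (ms0 @ ms)" using ms0 ms by (simp add: ok_append)
    moreover have "red (a # moves (ms0 @ ms) v) = red (a # b # g)" if "v \<in> V" for v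
      using red_cong[OF refl ms(2)[OF that], of "[a]"] ms0(2)[OF that] by simp
    ultimately show ?thesis by auto
  qed
qed simp

lemma hom_const: "(\<And>u v. EG u v \<Longrightarrow> \<phi> u = c \<and> \<phi> v = c) \<Longrightarrow> EH c c \<Longrightarrow> hom \<phi>"
  by (simp add: hom_def)

section \<open>Colourings without holonomy\<close>

text \<open>Without holonomy the colourings lift to maps into the universal cover of \<open>H\<close>.\<close>

context
  fixes \<alpha> :: "'a \<Rightarrow> 'b" and ms :: "('a \<times> 'b) list" and r :: 'a and W :: "'a \<Rightarrow> 'a list"
  assumes hom: "hom \<alpha>" and ok: "ok \<alpha> ms" and r: "r \<in> V" "W r = [r]"
    and W: "\<And>v. v \<in> V \<Longrightarrow> successively nb (W v) \<and> W v \<noteq> [] \<and> hd (W v) = r \<and> last (W v) = v"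
    and trivial: "\<And>u v. nb u v \<Longrightarrow> red (map \<alpha> (W u @ rev (W v))) = [\<alpha> r]"
begin

definition lift0 :: "'a \<Rightarrow> 'b list" where "lift0 v = red (map \<alpha> (W v))"
text \<open>Starting with the trace of the root puts both lifts into the same tree. The trace of a
  vertex is then the geodesic between its two lifts, as shown in \<open>trace_lift\<close>.\<close>

definition lift1 :: "'a \<Rightarrow> 'b list" where "lift1 v = red (red (tr \<alpha> ms r) @ map (final \<alpha> ms) (W v))"

lemma lift0: "v \<in> V \<Longrightarrow> lift0 v \<noteq> [] \<and> reduced (lift0 v) \<and> hd (lift0 v) = \<alpha> r \<and> last (lift0 v) = \<alpha> v"
  using W[of v] by (simp add: lift0_def hd_map last_map)

text \<open>The closed walk along \<open>W u\<close>, over the edge to \<open>v\<close> and back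
  along \<open>W v\<close> has a trivial image.\<close>

lemma lift0_nb: assumes "nb u v" shows "lift0 v = red (lift0 u @ [\<alpha> v])"
proof -
  have uv: "u \<in> V" "v \<in> V" using nb_V[OF assms] by auto
  have "red ((map \<alpha> (W u) @ rev (map \<alpha> (W v))) @ map \<alpha> (W v)) = red ([\<alpha> r] @ map \<alpha> (W v))"
    by (rule red_cong) (use trivial[OF assms] r in \<open>auto simp: rev_map\<close>)
  moreover have "red ([\<alpha> r] @ map \<alpha> (W v)) = lift0 v"
    using red_hd[of "map \<alpha> (W v)" "[]" "[]"] W[OF uv(2)] by (simp add: lift0_def hd_map)
  moreover have "red (map \<alpha> (W u) @ rev (map \<alpha> (W v)) @ map \<alpha> (W v)) = red (map \<alpha> (W u) @ [\<alpha> v])"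
    using red_rev_append[of "map \<alpha> (W v)" "map \<alpha> (W u)" "[]"] W[OF uv(2)] by (simp add: last_map)
  ultimately show ?thesis by (simp add: lift0_def)
qed

lemma lift1: "v \<in> V \<Longrightarrow> lift1 v \<noteq> [] \<and> reduced (lift1 v) \<and> hd (lift1 v) = \<alpha> r \<and> last (lift1 v) = final \<alpha> ms v"
  using W[of v] by (simp add: lift1_def hd_append last_map)

lemma lift1_alt: "v \<in> V \<Longrightarrow> lift1 v = red (lift0 v @ tr \<alpha> ms v)"
  using trace_walk[OF ok, of "W v"] W[of v] by (simp add: lift1_def lift0_def)

lemma lift1_nb: assumes "nb u v" shows "lift1 v = red (lift1 u @ [final \<alpha> ms v])"
proof -
  have uv: "u \<in> V" "v \<in> V" using nb_V[OF assms] by auto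
  have "lift1 v = red (red (lift0 u @ [\<alpha> v]) @ tr \<alpha> ms v)" using lift1_alt[OF uv(2)] lift0_nb[OF assms] by simp
  also have "\<dots> = red (lift0 u @ tr \<alpha> ms v)" using red_hd[of "tr \<alpha> ms v" "lift0 u" "[]"] by simp
  also have "\<dots> = red (lift0 u @ \<alpha> u # tr \<alpha> ms v)"
    using red_last[of "lift0 u" "[]" "tr \<alpha> ms v"] lift0[OF uv(1)] by simp
  also have "\<dots> = red (lift0 u @ tr \<alpha> ms u @ [final \<alpha> ms v])"
    using red_cong[OF refl adj_tr[OF ok assms, unfolded adj_def], of "lift0 u"] by simp
  also have "\<dots> = red (lift1 u @ [final \<alpha> ms v])" using lift1_alt[OF uv(1)] by simp
  finally show ?thesis .
qed

lemma trace_lift: "v \<in> V \<Longrightarrow> red (tr \<alpha> ms v) = red (rev (lift0 v) @ lift1 v)"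
proof -
  assume v: "v \<in> V"
  have "red (rev (lift0 v) @ lift1 v) = red (rev (lift0 v) @ lift0 v @ tr \<alpha> ms v)" by (simp add: lift1_alt[OF v])
  also have "\<dots> = red (\<alpha> v # tr \<alpha> ms v)"
    using red_rev_append[of "lift0 v" "[]" "tr \<alpha> ms v"] lift0[OF v] by simp
  also have "\<dots> = red (tr \<alpha> ms v)" using red_hd[of "tr \<alpha> ms v" "[]" "[]"] by simp
  finally show ?thesis by simp
qed

lemma lift0_root: "lift0 r = [\<alpha> r]" using r by (simp add: lift0_def)

lemma lift1_root: "lift1 r = red (tr \<alpha> ms r)"
  using r red_last[of "tr \<alpha> ms r" "[]" "[]"] by (simp add: lift1_def)

lemma trace_meet:
  assumes "u \<in> V" "w \<in> V" "lift0 u = lift1 w"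
  shows "red (tr \<alpha> ms r) = red (map \<alpha> (W u) @ rev (map (final \<alpha> ms) (W w)))" "\<alpha> u = final \<alpha> ms w"
proof -
  let ?Y = "map (final \<alpha> ms) (W w)"
  have Y: "?Y \<noteq> []" "hd ?Y = final \<alpha> ms r" using W[OF assms(2)] by (auto simp: hd_map)
  have "red (map \<alpha> (W u) @ rev ?Y) = red (red (red (tr \<alpha> ms r) @ ?Y) @ rev ?Y)"
    using assms(3) red_red_append[of "map \<alpha> (W u)" "rev ?Y"] by (simp add: lift0_def lift1_def)
  also have "\<dots> = red (tr \<alpha> ms r @ ?Y @ rev ?Y)" by simp
  also have "\<dots> = red (tr \<alpha> ms r @ [final \<alpha> ms r])" using red_append_rev[OF Y(1), of "tr \<alpha> ms r" "[]"] Y by simp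
  also have "\<dots> = red (tr \<alpha> ms r)" using red_last[of "tr \<alpha> ms r" "[]" "[]"] by simp
  finally show "red (tr \<alpha> ms r) = red (map \<alpha> (W u) @ rev ?Y)" by simp
  show "\<alpha> u = final \<alpha> ms w" using lift0[OF assms(1)] lift1[OF assms(2)] assms(3) by metis
qed

lemma nb_reachable: "v \<in> V \<Longrightarrow> nb\<^sup>*\<^sup>* r v"
proof -
  have *: "successively nb xs \<Longrightarrow> xs \<noteq> [] \<Longrightarrow> nb\<^sup>*\<^sup>* (hd xs) (last xs)" for xs
  proof (induction xs rule: induct_list012)
    case (3 x y zs)
    then have "nb x y" "nb\<^sup>*\<^sup>* y (last (y # zs))" by auto
    then have "nb\<^sup>*\<^sup>* x (last (y # zs))" by (rule converse_rtranclp_into_rtranclp)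
    then show ?case by simp
  qed auto
  show "v \<in> V \<Longrightarrow> nb\<^sup>*\<^sup>* r v" using *[of "W v"] W[of v] by auto
qed

text \<open>All vertices can be gathered in any point that lies on the walks of all vertices.\<close>

definition gather :: "'b list \<Rightarrow> 'a \<Rightarrow> 'b list" where
  "gather z v = (if v \<in> V then red (rev (lift0 v) @ z) else [\<alpha> v])"

text \<open>All walks end in one vertex of the tree, so neighbours have distance 0, and the loop at
  its colour makes the constant map a homomorphism.\<close>

lemma traced_gather:
  assumes z: "z \<noteq> []" "hd z = \<alpha> r" "EH (last z) (last z)"
    and pre: "\<And>v. v \<in> V \<Longrightarrow> prefix (gather z v) (red (tr \<alpha> ms v))"
  shows "traced \<alpha> ms (gather z)"
proof -
  have "prefix (gather z v) (red (tr \<alpha> ms v))" for v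
    using pre tr_outside[OF ok, of v] by (cases "v \<in> V") (auto simp: gather_def)
  moreover have "adj (gather z v) (gather z w)" if vw: "nb v w" for v w
  proof -
    have V: "v \<in> V" "w \<in> V" using nb_V[OF vw] by auto
    have "red (hd (gather z v) # gather z w) = red (\<alpha> v # rev (lift0 w) @ z)"
      using V lift0[OF V(1)] by (simp add: gather_def hd_append hd_rev)
    also have "\<dots> = red ((\<alpha> v # rev (lift0 v @ [\<alpha> w])) @ z)"
      using red_cong[OF red_cong[OF refl, of "rev (lift0 w)" "rev (lift0 v @ [\<alpha> w])" "[\<alpha> v]"] refl, of z]
        lift0_nb[OF vw] red_rev[of "lift0 v @ [\<alpha> w]"] by (simp add: red_rev)
    also have "\<dots> = red (\<alpha> v # \<alpha> w # rev (lift0 v) @ z)" by simp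
    also have "\<dots> = red (rev (lift0 v) @ z)"
      using lift0[OF V(1)] by (cases "lift0 v" rule: rev_cases) auto
    also have "\<dots> = red (gather z v @ [last (gather z w)])"
      using V z(1) red_last[of "rev (lift0 v) @ z" "[]" "[]"] by (simp add: gather_def)
    finally show ?thesis by (simp add: adj_def)
  qed
  moreover have "hom (\<lambda>v. last (gather z v))"
    by (rule hom_const[of _ "last z"]) (use EG_V z in \<open>auto simp: gather_def\<close>)
  moreover have "gather z v \<noteq> [] \<and> hd (gather z v) = \<alpha> v" for v
    using lift0[of v] z by (auto simp: gather_def hd_append hd_rev)
  ultimately show ?thesis using ok by (simp add: traced_def feasible_def)
qed

text \<open>\<open>bi\<close> says that all arcs of the segment are symmetric, so the segment itself
  witnesses reachability. The path \<open>g\<close> may differ from it even in length; the release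
  from its far end is unaffected, as that part depends on the constant map alone.\<close>

lemma trace_disjoint:
  assumes loops: "\<And>a b. EH a b \<Longrightarrow> EH b b"
    and disj: "\<And>u w. u \<in> V \<Longrightarrow> w \<in> V \<Longrightarrow> lift0 u \<noteq> lift1 w"
  shows "\<exists>u\<in>V. \<exists>w\<in>V. \<exists>bi. (EH_sym bi)\<^sup>*\<^sup>* (\<alpha> u) (final \<alpha> ms w) \<and>
    (\<forall>g. successively (EH_sym bi) g \<longrightarrow> g \<noteq> [] \<longrightarrow> hd g = \<alpha> u \<longrightarrow> last g = final \<alpha> ms w \<longrightarrow>
      (\<exists>ms'. ok \<alpha> ms' \<and> final \<alpha> ms' = final \<alpha> ms \<and>
         red (tr \<alpha> ms' r) = red (map \<alpha> (W u) @ g @ rev (map (final \<alpha> ms) (W w)))))"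
proof -
  let ?\<beta> = "final \<alpha> ms"
  define R where "R u v \<longleftrightarrow> nb u v" for u v
  have nbV: "nb\<^sup>*\<^sup>* r v \<Longrightarrow> v \<in> V" for v by (induction rule: rtranclp_induct) (use r nb_V in auto)
  have lift0': "reduced (lift0 v)" and lift1': "reduced (lift1 v)" for v by (simp_all add: lift0_def lift1_def)
  \<comment> \<open>\<open>bridge\<close> asks for nonempty reduced walks at every index, hence the
    default off \<open>V\<close>.\<close>
  define a' where "a' v = (if v \<in> V then lift0 v else [\<alpha> v])" for v
  define b' where "b' v = (if v \<in> V then lift1 v else [\<alpha> v])" for v
  obtain u w d m where uw: "nb\<^sup>*\<^sup>* r u" "nb\<^sup>*\<^sup>* r w" "b' w = a' u @ d # m"
    "\<And>k. nb\<^sup>*\<^sup>* r k \<Longrightarrow> prefix (b' w) (b' k)" "\<And>k. nb\<^sup>*\<^sup>* r k \<Longrightarrow> \<not> prefix (a' u @ [d]) (a' k)"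
  proof (rule bridge[of a' b' r "\<alpha> r" "lift1 r" nb])
    show "(\<exists>y. a' j = red (a' i @ [y])) \<and> (\<exists>y. b' j = red (b' i @ [y]))" if "nb i j" for i j
      using nb_V[OF that] lift0_nb[OF that] lift1_nb[OF that] by (auto simp: a'_def b'_def)
    show "a' i \<noteq> b' j" if "nb\<^sup>*\<^sup>* r i" "nb\<^sup>*\<^sup>* r j" for i j
      using disj that nbV by (simp add: a'_def b'_def)
  qed (use lift0 lift1 r lift0_root in \<open>auto simp: a'_def b'_def\<close>)
  have V: "u \<in> V" "w \<in> V" using uw nbV by auto
  define p q where "p = lift0 u" and "q = lift1 w"
  have q: "q = p @ d # m" using uw(3) V by (simp add: a'_def b'_def p_def q_def)
  have preq: "prefix q (lift1 v)" if "v \<in> V" for v using uw(4)[OF nb_reachable[OF that]] V that by (simp add: b'_def q_def)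
  have npre: "\<not> prefix (p @ [d]) (lift0 v)" if "v \<in> V" for v
    using uw(5)[OF nb_reachable[OF that]] V that by (simp add: a'_def p_def)
  have p: "p \<noteq> []" "hd p = \<alpha> r" "last p = \<alpha> u" using lift0[OF V(1)] by (auto simp: p_def)
  have lq: "last q = ?\<beta> w" and rq: "reduced q" using lift1[OF V(2)] by (auto simp: q_def)
  define x where "x = last p"
  define g0 where "g0 = x # d # m"
  have geo: "red (rev (lift0 v) @ p @ d # z) = gather p v @ d # z" if "v \<in> V" "reduced (p @ d # z)" for v z
    using red_geodesic[of "lift0 v" p d z] lift0[OF that(1)] p that npre[OF that(1)] by (simp add: gather_def)
  \<comment> \<open>The geodesics of all vertices to the points of the segment run through its near
    end \<open>p\<close>.\<close>
  have Geq: "gather (p @ take i (d # m)) v = gather p v @ take i (d # m)" if "v \<in> V" for i v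
  proof (cases i)
    case (Suc k)
    have "reduced (p @ d # take k m)" using rq q reduced_appendD1[of "p @ d # take k m" "drop k m"] by simp
    then show ?thesis using geo[OF that, of "take k m"] Suc that by (simp add: gather_def)
  qed simp
  have Spre: "prefix (gather q v) (red (tr \<alpha> ms v))" if v: "v \<in> V" for v
  proof -
    obtain z where z: "lift1 v = q @ z" using preq[OF v] by (auto simp: prefix_def)
    have "reduced (p @ d # m @ z)" using lift1'[of v] z q by simp
    then have "red (tr \<alpha> ms v) = gather p v @ d # m @ z"
      using geo[OF v, of "m @ z"] trace_lift[OF v] z q by simp
    moreover have "gather q v = gather p v @ d # m" using Geq[OF v, of "length (d # m)"] q by simp
    ultimately show ?thesis by simp
  qed
  have "EH (\<alpha> v) (\<alpha> v)" if "v \<in> V" for v using hom EG_refl[OF that] by (simp add: hom_def)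
  then have loop: "EH c c" if "c \<in> set (tr \<alpha> ms r)" for c
    using EH_refl_tr[OF ok _ that] r by simp
  have qS: "prefix q (red (tr \<alpha> ms r))" using preq[OF r(1)] lift1_root by simp
  then have loopq: "EH c c" if "c \<in> set q" for c
    using loop set_red[of "tr \<alpha> ms r"] set_mono_prefix[OF qS] that by auto
  have tG: "traced \<alpha> ms (gather (p @ take i (d # m)))" for i
  proof (rule traced_gather)
    have "prefix (p @ take i (d # m)) q" using q take_is_prefix[of i "d # m"] by simp
    then have "set (p @ take i (d # m)) \<subseteq> set q" by (rule set_mono_prefix)
    moreover have ne: "p @ take i (d # m) \<noteq> []" using p by simp
    ultimately show "EH (last (p @ take i (d # m))) (last (p @ take i (d # m)))"
      using loopq last_in_set[OF ne] by auto
    show "prefix (gather (p @ take i (d # m)) v) (red (tr \<alpha> ms v))" if v: "v \<in> V" for v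
    proof -
      have "gather q v = gather p v @ d # m" using Geq[OF v, of "length (d # m)"] q by simp
      then have "prefix (gather (p @ take i (d # m)) v) (gather q v)"
        using Geq[OF v, of i] take_is_prefix[of i "d # m"] by simp
      then show ?thesis using Spre[OF v] prefix_order.trans by blast
    qed
  qed (use p in auto)
  have lastG: "(\<lambda>v. last (gather z v)) = const_on \<alpha> (last z)" if "z \<noteq> []" for z
    using that by (auto simp: gather_def const_on_def)
  \<comment> \<open>Between two consecutive gathered families every vertex crosses the same arc
    exactly once.\<close>
  have arcs: "\<exists>ns. ok (const_on \<alpha> (g0 ! i)) ns \<and> (\<forall>v\<in>V. moves ns v = [g0 ! Suc i])" if i: "Suc i < length g0" for i
  proof -
    let ?z = "p @ take i (d # m)" and ?z' = "p @ take (Suc i) (d # m)"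
    have i': "i < length (d # m)" using i by (simp add: g0_def)
    have tk: "take (Suc i) (d # m) = take i (d # m) @ [(d # m) ! i]" using i' by (rule take_Suc_conv_app_nth)
    have st: "gather ?z' v = (if v \<in> V then gather ?z v @ [(d # m) ! i] else gather ?z v)" for v
      using Geq[of v i] Geq[of v "Suc i"] tk by (simp add: gather_def)
    have "prefix (gather ?z v) (gather ?z' v)" for v using st[of v] by (cases "v \<in> V") auto
    then obtain ns where ns: "ok (\<lambda>v. last (gather ?z v)) ns" "\<And>v. gather ?z' v = gather ?z v @ moves ns v"
      using traced_run[OF tG tG] by blast
    have "last ?z = g0 ! i"
      using i' by (cases i) (auto simp: g0_def x_def p last_append take_Suc_conv_app_nth simp del: take_Suc_Cons)
    then have "ok (const_on \<alpha> (g0 ! i)) ns" using ns(1) lastG[of ?z] p(1) by simp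
    moreover have "moves ns v = [g0 ! Suc i]" if "v \<in> V" for v using ns(2)[of v] st[of v] that by (simp add: g0_def)
    ultimately show ?thesis by blast
  qed
  have "p @ d # m = (butlast p @ [last p]) @ d # m" by (simp only: append_butlast_last_id[OF p(1)])
  then have "q = butlast p @ g0" by (simp only: q g0_def x_def append_assoc append_Cons append_Nil)
  then have "reduced g0" using rq reduced_appendD2 by blast
  then have g0ne: "g0 ! i \<noteq> g0 ! Suc i" if "Suc i < length g0" for i using reduced_ne that by blast
  have g0EH: "EH (g0 ! i) (g0 ! Suc i)" if i: "Suc i < length g0" for i
  proof -
    obtain ns where ns: "ok (const_on \<alpha> (g0 ! i)) ns" "moves ns r = [g0 ! Suc i]" using arcs[OF i] r by blast
    have "successively (\<lambda>a b. EH a b \<and> EH b b) (tr (const_on \<alpha> (g0 ! i)) ns r)" by (rule successively_tr[OF ns(1)])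
    then show ?thesis using ns(2) r by (simp add: tr_def const_on_def)
  qed
  define bi where "bi \<longleftrightarrow> (\<forall>i. Suc i < length g0 \<longrightarrow> EH (g0 ! Suc i) (g0 ! i))"
  have step: "\<exists>ns. ok (const_on \<alpha> a) ns \<and> (\<forall>v\<in>V. moves ns v = [b])" if ab: "EH_sym bi a b" "a \<noteq> b" for a b
  proof -
    \<comment> \<open>The model arc for \<open>const_step_transfer\<close>: with \<open>bi\<close>
      the new arc is symmetric and any arc of the segment will do; otherwise the segment contains an
      arc without reverse arc.\<close>
    obtain i where i: "Suc i < length g0" "EH b a \<or> \<not> EH (g0 ! Suc i) (g0 ! i)"
    proof (cases bi)
      case True
      then show thesis using that[of 0] ab by (auto simp: EH_sym_def g0_def)
    next
      case False
      then show thesis using that by (auto simp: bi_def)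
    qed
    obtain ns where ns: "ok (const_on \<alpha> (g0 ! i)) ns" "\<forall>v\<in>V. moves ns v = [g0 ! Suc i]" using arcs[OF i(1)] by blast
    have "EH a b" "EH b b" using ab loops by (auto simp: EH_sym_def)
    then show ?thesis
      using const_step_transfer[OF ns(1) _ g0ne[OF i(1)], of a b] ns(2) ab(2) i(2) by blast
  qed
  have reach: "(EH_sym bi)\<^sup>*\<^sup>* (\<alpha> u) (?\<beta> w)"
  proof -
    have "(EH_sym bi)\<^sup>*\<^sup>* (g0 ! 0) (g0 ! i)" if "i < length g0" for i
      using that
    proof (induction i)
      case (Suc i)
      then have "EH_sym bi (g0 ! i) (g0 ! Suc i)" using g0EH by (auto simp: EH_sym_def bi_def)
      then show ?case using Suc by (simp add: rtranclp.rtrancl_into_rtrancl)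
    qed simp
    from this[of "length g0 - 1"] have "(EH_sym bi)\<^sup>*\<^sup>* (hd g0) (last g0)"
      by (simp add: g0_def last_conv_nth del: last.simps)
    moreover have "last g0 = last q" by (simp add: g0_def q)
    ultimately show ?thesis using p lq by (simp add: g0_def x_def)
  qed
  have "\<exists>ms'. ok \<alpha> ms' \<and> final \<alpha> ms' = ?\<beta> \<and> red (tr \<alpha> ms' r) = red (map \<alpha> (W u) @ g @ rev (map ?\<beta> (W w)))"
    if g: "successively (EH_sym bi) g" "g \<noteq> []" "hd g = \<alpha> u" "last g = ?\<beta> w" for g
  proof -
    have tp: "traced \<alpha> ms (gather p)" and tq: "traced \<alpha> ms (gather q)"
      using tG[of 0] tG[of "length (d # m)"] q by simp_all
    have q0: "q \<noteq> []" using q by simp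
    let ?S = "\<lambda>v. red (tr \<alpha> ms v)"
    have tS: "traced \<alpha> ms ?S" using traced_full[OF hom ok] .
    have "prefix [\<alpha> v] (gather p v)" for v
      using traced_ne[OF tp, of v] traced_hd[OF tp, of v] by (cases "gather p v") auto
    then obtain ms1 where ms1: "ok (\<lambda>v. last [\<alpha> v]) ms1" "\<And>v. gather p v = [\<alpha> v] @ moves ms1 v"
      using traced_run[OF traced_init[OF hom ok] tp] by blast
    obtain ms2 where ms2: "ok (const_on \<alpha> (hd g)) ms2" "\<And>v. v \<in> V \<Longrightarrow> red (hd g # moves ms2 v) = red g"
      using const_path[of bi \<alpha> g] step g by blast
    have "prefix (gather q v) (?S v)" for v using tq by (simp add: traced_def)
    then obtain ms3 where ms3: "ok (\<lambda>v. last (gather q v)) ms3" "\<And>v. ?S v = gather q v @ moves ms3 v"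
      using traced_run[OF tq tS] by blast
    have f1: "final \<alpha> ms1 = const_on \<alpha> (hd g)"
      using last_tr[of \<alpha> ms1] ms1(2) lastG[OF p(1)] p(3) g(3) by (auto simp: tr_def fun_eq_iff)
    have f2: "final (const_on \<alpha> (hd g)) ms2 = const_on \<alpha> (last g)"
    proof (rule final_moves_const)
      show "last (hd g # moves ms2 v) = last g" if "v \<in> V" for v
        using ms2(2)[OF that] last_red by metis
    qed (rule ms2)
    have lastq: "(\<lambda>v. last (gather q v)) = const_on \<alpha> (last g)" using lastG[OF q0] lq g(4) by simp
    have f3: "final (const_on \<alpha> (last g)) ms3 = ?\<beta>"
    proof
      fix v
      have "final (\<lambda>v. last (gather q v)) ms3 v = last (?S v)"
        using final_last[of "gather q" v ms3] traced_ne[OF tq] ms3(2)[of v] by simp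
      then show "final (const_on \<alpha> (last g)) ms3 v = ?\<beta> v" unfolding lastq by simp
    qed
    \<comment> \<open>Gather at \<open>p\<close>, follow \<open>g\<close> as a constant map, release
      from \<open>q\<close>.\<close>
    let ?ms = "ms1 @ ms2 @ ms3"
    have "ok \<alpha> ?ms" using ms1(1) ms2(1) ms3(1) f1 f2 lastq by (simp add: ok_append)
    moreover have "final \<alpha> ?ms = ?\<beta>" by (simp add: final_append f1 f2 f3)
    moreover have "red (tr \<alpha> ?ms r) = red (map \<alpha> (W u) @ g @ rev (map ?\<beta> (W w)))"
    proof -
      have gr: "gather z r = z" if "z \<noteq> []" "hd z = \<alpha> r" "reduced z" for z
        using that red_hd[of z "[]" "[]"] r lift0_root by (simp add: gather_def)
      have pr: "gather p r = p" and qr: "gather q r = q"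
        using gr[of p] gr[of q] p q0 rq q reduced_appendD1[of p "d # m"] by auto
      have t: "tr \<alpha> ?ms r = p @ moves ms2 r @ moves ms3 r" using ms1(2)[of r] pr by (simp add: tr_def)
      have "red (p @ moves ms2 r) = red (p @ hd g # moves ms2 r)"
        using red_last[OF p(1), of "[]" "moves ms2 r"] p(3) g(3) by simp
      also have "\<dots> = red (p @ g)" using red_cong[OF refl ms2(2)[OF r(1)], of p] .
      also have "\<dots> = red (map \<alpha> (W u) @ g)" by (simp add: p_def lift0_def)
      finally have 1: "red (p @ moves ms2 r) = red (map \<alpha> (W u) @ g)" .
      let ?Y = "map ?\<beta> (W w)"
      have Y: "?Y \<noteq> []" "hd ?Y = ?\<beta> r" "last ?Y = ?\<beta> w" using W[OF V(2)] by (auto simp: hd_map last_map)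
      have "red (q @ rev ?Y) = red (tr \<alpha> ms r @ ?Y @ rev ?Y)" by (simp add: q_def lift1_def)
      also have "\<dots> = red (tr \<alpha> ms r @ [?\<beta> r])" using red_append_rev[OF Y(1), of "tr \<alpha> ms r" "[]"] Y by simp
      also have "\<dots> = ?S r" using red_last[of "tr \<alpha> ms r" "[]" "[]"] by simp
      also have "\<dots> = red (q @ moves ms3 r)" using ms3(2)[of r] qr reduced_red[of "tr \<alpha> ms r"] by simp
      finally have 2: "red (last q # moves ms3 r) = red (last q # rev ?Y)"
        using red_cancel_left[OF _ q0] by metis
      have "red (tr \<alpha> ?ms r) = red ((map \<alpha> (W u) @ g) @ moves ms3 r)"
        unfolding t using red_cong[OF 1 refl, of "moves ms3 r"] by simp
      also have "\<dots> = red ((map \<alpha> (W u) @ g) @ last q # moves ms3 r)"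
        using red_last[OF g(2), of "map \<alpha> (W u)" "moves ms3 r"] g(4) lq by simp
      also have "\<dots> = red ((map \<alpha> (W u) @ g) @ last q # rev ?Y)" by (rule red_cong[OF refl 2])
      also have "\<dots> = red ((map \<alpha> (W u) @ g) @ rev ?Y)"
        using red_last[OF g(2), of "map \<alpha> (W u)" "rev ?Y"] g(4) lq by simp
      finally show ?thesis by simp
    qed
    ultimately show ?thesis by blast
  qed
  then show ?thesis using V reach by blast
qed

end

section \<open>Possible traces of the root\<close>

lemma successively_nb_flip: "successively (\<lambda>x y. nb y x) xs \<longleftrightarrow> successively nb xs"
proof -
  have "(\<lambda>x y. nb y x) = nb" using nb_sym by blast
  then show ?thesis by (rule arg_cong)
qed

text \<open>\<open>CS\<close>, \<open>XS\<close> and \<open>GS\<close> stand for the lists of the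
  algorithm. The trivial paths demanded of \<open>GS\<close> let \<open>g\<close> disappear where no
  segment has to be crossed.\<close>

lemma reroute:
  assumes hom: "hom \<alpha>" and ok: "ok \<alpha> ms" and loops: "\<And>a b. EH a b \<Longrightarrow> EH b b" and r: "r \<in> V" "W r = [r]"
    and W: "\<And>v. v \<in> V \<Longrightarrow> successively nb (W v) \<and> W v \<noteq> [] \<and> hd (W v) = r \<and> last (W v) = v \<and> length (W v) \<le> L"
    and CS: "\<And>u v. u \<in> V \<Longrightarrow> v \<in> V \<Longrightarrow> W u @ rev (W v) \<in> CS"
    and XS: "\<And>C i. C \<in> CS \<Longrightarrow> 1 \<le> i \<Longrightarrow> i \<le> length C \<Longrightarrow> take i C \<in> XS"
    and GS: "\<And>bi v b. v \<in> V \<Longrightarrow> (EH_sym bi)\<^sup>*\<^sup>* (\<alpha> v) b \<Longrightarrow>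
       \<exists>g\<in>GS. successively (EH_sym bi) g \<and> g \<noteq> [] \<and> hd g = \<alpha> v \<and> last g = b \<and> (\<alpha> v = b \<longrightarrow> g = [b])"
  shows "\<exists>ms'. ok \<alpha> ms' \<and> final \<alpha> ms' = final \<alpha> ms \<and>
    (\<exists>C\<in>CS. \<exists>k\<le>64 * L. \<exists>X\<in>XS. \<exists>g\<in>GS. \<exists>Y\<in>XS.
       red (tr \<alpha> ms' r) = red (concat (replicate k (map \<alpha> C)) @ map \<alpha> X @ g @ rev (map (final \<alpha> ms) Y)))"
proof -
  define \<beta> where "\<beta> = final \<alpha> ms"
  obtain ms0 where ms0: "ok \<alpha> ms0" "final \<alpha> ms0 = \<beta>" "shortest \<alpha> ms0"
  proof -
    define Pn where "Pn n \<longleftrightarrow> (\<exists>ms'. ok \<alpha> ms' \<and> final \<alpha> ms' = \<beta> \<and> length ms' = n)" for n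
    have "Pn (length ms)" using ok by (auto simp: Pn_def \<beta>_def)
    then have "Pn (LEAST n. Pn n)" by (rule LeastI)
    then obtain ms' where ms': "ok \<alpha> ms'" "final \<alpha> ms' = \<beta>" "length ms' = (LEAST n. Pn n)" by (auto simp: Pn_def)
    have "length ms' \<le> length ms''" if "ok \<alpha> ms''" "final \<alpha> ms'' = \<beta>" for ms''
      unfolding ms'(3) by (rule Least_le) (use that in \<open>auto simp: Pn_def\<close>)
    then show thesis using that[of ms'] ms' by (simp add: shortest_def)
  qed
  let ?S = "red (tr \<alpha> ms0 r)"
  have WXS: "W v \<in> XS" if "v \<in> V" for v
    using XS[OF CS[OF that that], of "length (W v)"] W[OF that] by (simp add: Suc_le_eq)
  show ?thesis
  proof (cases "\<forall>u v. nb u v \<longrightarrow> red (map \<alpha> (W u @ rev (W v))) = [\<alpha> r]")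
    case True
    note ctx = hom ms0(1) r(1,2)
    have W': "\<And>v. v \<in> V \<Longrightarrow> successively nb (W v) \<and> W v \<noteq> [] \<and> hd (W v) = r \<and> last (W v) = v" using W by blast
    have tri: "\<And>u v. nb u v \<Longrightarrow> red (map \<alpha> (W u @ rev (W v))) = [\<alpha> r]" using True by blast
    obtain ms' u w g where g: "ok \<alpha> ms'" "final \<alpha> ms' = \<beta>" "u \<in> V" "w \<in> V" "g \<in> GS"
      "red (tr \<alpha> ms' r) = red (map \<alpha> (W u) @ g @ rev (map \<beta> (W w)))"
    proof (cases "\<exists>u\<in>V. \<exists>w\<in>V. lift0 \<alpha> W u = lift1 \<alpha> ms0 r W w")
      case True
      then obtain u w where uw: "u \<in> V" "w \<in> V" "lift0 \<alpha> W u = lift1 \<alpha> ms0 r W w" by blast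
      note meet = trace_meet[OF ctx W' tri uw]
      obtain g where g: "g \<in> GS" "g = [\<alpha> u]" using GS[OF uw(1), of False "\<alpha> u"] by auto
      have "red (map \<alpha> (W u) @ \<alpha> u # rev (map \<beta> (W w))) = red (map \<alpha> (W u) @ rev (map \<beta> (W w)))"
        using red_last[of "map \<alpha> (W u)" "[]" "rev (map \<beta> (W w))"] W[OF uw(1)] by (simp add: last_map)
      then show thesis using that[OF ms0(1,2) uw(1,2) g(1)] g(2) meet(1) ms0(2) by simp
    next
      case False
      then have ne: "\<And>u w. u \<in> V \<Longrightarrow> w \<in> V \<Longrightarrow> lift0 \<alpha> W u \<noteq> lift1 \<alpha> ms0 r W w" by blast
      have "\<exists>u\<in>V. \<exists>w\<in>V. \<exists>bi. (EH_sym bi)\<^sup>*\<^sup>* (\<alpha> u) (\<beta> w) \<and>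
        (\<forall>g. successively (EH_sym bi) g \<longrightarrow> g \<noteq> [] \<longrightarrow> hd g = \<alpha> u \<longrightarrow> last g = \<beta> w \<longrightarrow>
          (\<exists>ms'. ok \<alpha> ms' \<and> final \<alpha> ms' = \<beta> \<and> red (tr \<alpha> ms' r) = red (map \<alpha> (W u) @ g @ rev (map \<beta> (W w)))))"
        unfolding ms0(2)[symmetric]
        by (rule trace_disjoint[where W = W and r = r and ms = ms0 and \<alpha> = \<alpha>, OF ctx]) (fact W' tri loops ne)+
      then obtain u w bi where uw: "u \<in> V" "w \<in> V" "(EH_sym bi)\<^sup>*\<^sup>* (\<alpha> u) (\<beta> w)"
        "\<And>g. successively (EH_sym bi) g \<Longrightarrow> g \<noteq> [] \<Longrightarrow> hd g = \<alpha> u \<Longrightarrow> last g = \<beta> w \<Longrightarrow>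
          \<exists>ms'. ok \<alpha> ms' \<and> final \<alpha> ms' = \<beta> \<and> red (tr \<alpha> ms' r) = red (map \<alpha> (W u) @ g @ rev (map \<beta> (W w)))"
        by blast
      obtain g where g: "g \<in> GS" "successively (EH_sym bi) g" "g \<noteq> []" "hd g = \<alpha> u" "last g = \<beta> w"
        using GS[OF uw(1,3)] by blast
      then show thesis using that uw(1,2) uw(4)[OF g(2-5)] by blast
    qed
    \<comment> \<open>With exponent 0 any closed walk can stand in front.\<close>
    have "red (tr \<alpha> ms' r) = red (concat (replicate 0 (map \<alpha> (W r @ rev (W r)))) @ map \<alpha> (W u) @ g @ rev (map (final \<alpha> ms) (W w)))"
      using g(6) by (simp add: \<beta>_def)
    then show ?thesis using g(1-5) WXS CS[OF r(1) r(1)] by (metis \<beta>_def le0)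
  next
    case False
    then obtain u v where uv: "nb u v" "red (map \<alpha> (W u @ rev (W v))) \<noteq> [\<alpha> r]" by blast
    have V: "u \<in> V" "v \<in> V" using nb_V[OF uv(1)] by auto
    define C where "C = W u @ rev (W v)"
    have C: "successively nb C" "C \<noteq> []" "hd C = r" "last C = r" "length C \<le> 2 * L"
      using W[OF V(1)] W[OF V(2)] uv(1) by (auto simp: C_def successively_append_iff successively_nb_flip hd_rev last_rev)
    have w1: "\<exists>Wa. successively nb Wa \<and> Wa \<noteq> [] \<and> hd Wa = v \<and> last Wa = hd C \<and> length Wa \<le> 2 * L" if "v \<in> V" for v
      using W[OF that] C by (intro exI[of _ "rev (W v)"]) (auto simp: successively_nb_flip hd_rev last_rev)
    have w2: "\<exists>Wa. successively nb Wa \<and> Wa \<noteq> [] \<and> hd Wa = hd C \<and> last Wa = v \<and> length Wa \<le> 2 * L" if "v \<in> V" for v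
      using W[OF that] C by (intro exI[of _ "W v"]) auto
    have "length ?S < 30 * (2 * L)"
      using shortest_bound[OF ms0(3) hom C(1,2) _ _ _ C(5) w1 w2] C uv(2) r by (simp add: C_def)
    \<comment> \<open>\<open>length ?S < 60 * L\<close> and \<open>length C \<le> 2 * L\<close>,
      whence the constant 64.\<close>
    then have len: "length ?S + 2 * length C \<le> 64 * L" using C(5) by linarith
    let ?A = "map \<alpha> C" and ?B = "map \<beta> C"
    have AB: "red (?A @ ?S) = red (?S @ ?B)"
      using trace_walk[OF ms0(1) C(1,2)] C(3,4) ms0(2) by simp
    have h: "?A \<noteq> []" "hd ?A = last ?A" "hd ?S = hd ?A" "hd ?B = last ?B" "last ?S = hd ?B" "reduced ?S" "?S \<noteq> []"
      "red ?A \<noteq> [hd ?A]"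
      using C uv(2) ms0(2) by (auto simp: hd_map last_map C_def[symmetric])
    obtain D k i j where D: "D = ?A \<or> D = rev ?A" "k \<le> length ?S + 2 * length C" "1 \<le> i" "i \<le> length C" "1 \<le> j" "j \<le> length C"
      "?S = red (concat (replicate k D) @ take i ?A @ rev (take j ?B))" "?A ! (i - 1) = ?B ! (j - 1)"
      by (rule conjugacy[OF AB _ _ h, of "length C"]) simp_all
    define X Y where "X = take i C" and "Y = take j C"
    have CC: "C \<in> CS" using CS[OF V] by (simp add: C_def)
    have XY: "X \<in> XS" "Y \<in> XS" using XS[OF CC] D(3-6) by (auto simp: X_def Y_def)
    \<comment> \<open>The reverse of the image of \<open>C\<close> is the image of
      \<open>rev C\<close>, which belongs to \<open>CS\<close> with \<open>u\<close> and
      \<open>v\<close> exchanged.\<close>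
    have D': "\<exists>C'\<in>CS. D = map \<alpha> C'"
    proof -
      have "rev C = W v @ rev (W u)" by (simp add: C_def)
      then have "rev C \<in> CS" using CS[OF V(2,1)] by simp
      then show ?thesis using D(1) CC by (auto simp: rev_map)
    qed
    have Xne: "X \<noteq> []" using D(3,4) C(2) by (simp add: X_def)
    have "last (map \<alpha> X) = \<alpha> (last X)" using Xne by (simp add: last_map)
    moreover obtain x where x: "x = last X" "x \<in> V"
    proof -
      have "set C \<subseteq> V"
      proof
        fix z assume z: "z \<in> set C"
        have "\<exists>w. nb z w"
        proof -
          obtain xs ys where s: "C = xs @ z # ys" using z by (meson split_list)
          show ?thesis
          proof (cases ys)
            case Nil
            then have "z = r" using C(4) s by simp
            then show ?thesis using EG_refl[OF r(1)] by (auto simp: nb_def)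
          next
            case (Cons y zs)
            then show ?thesis using C(1) s by (auto simp: successively_append_iff)
          qed
        qed
        then show "z \<in> V" using nb_V by blast
      qed
      moreover have "last X \<in> set C" using last_in_set[OF Xne] set_take_subset[of i C] unfolding X_def by blast
      ultimately show thesis using that[of "last X"] by blast
    qed
    obtain g where g: "g \<in> GS" "g = [\<alpha> x]" using GS[OF x(2), of False "\<alpha> x"] by auto
    have "?S = red (concat (replicate k D) @ map \<alpha> X @ g @ rev (map \<beta> Y))"
      using D(7) red_last[of "map \<alpha> X" "concat (replicate k D)" "rev (map \<beta> Y)"] Xne x(1) g(2)
      by (simp add: X_def Y_def take_map last_map)
    moreover obtain C' where C': "C' \<in> CS" "D = map \<alpha> C'" using D' by blast
    moreover have "k \<le> 64 * L" using len D(2) by linarith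
    ultimately show ?thesis using ms0(1,2) XY g(1) unfolding \<beta>_def by blast
  qed
qed

end


section \<open>The algorithm\<close>

definition nthd :: "'a \<Rightarrow> 'a list \<Rightarrow> nat \<Rightarrow> 'a" where
  "nthd d xs i = (case drop i xs of [] \<Rightarrow> d | x # _ \<Rightarrow> x)"

lemma nthd [simp]: "i < length xs \<Longrightarrow> nthd d xs i = xs ! i" "length xs \<le> i \<Longrightarrow> nthd d xs i = d"
  by (auto simp: nthd_def Cons_nth_drop_Suc[symmetric])

text \<open>The defaults make all pairs outside the matrix count as non-arcs.\<close>

definition look :: "bool list list \<Rightarrow> nat \<Rightarrow> nat \<Rightarrow> bool" where
  "look M u v = nthd False (nthd [] M u) v"

definition square :: "nat \<Rightarrow> bool list list \<Rightarrow> bool" where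
  "square n M \<longleftrightarrow> length M = n \<and> (\<forall>row\<in>set M. length row = n)"

lemma look_square: assumes "square n M" "look M u v" shows "u < n" "v < n"
proof -
  show "u < n" using assms by (cases "u < length M") (auto simp: look_def square_def)
  then have "length (nthd [] M u) = n" using assms(1) by (simp add: square_def)
  then show "v < n" using assms(2) by (cases "v < n") (auto simp: look_def)
qed

lemma length_concat_square: "square n M \<Longrightarrow> length (concat M) = n * n"
proof -
  have "(\<forall>row\<in>set M. length row = n) \<Longrightarrow> length (concat M) = length M * n" by (induction M) auto
  then show "square n M \<Longrightarrow> length (concat M) = n * n" by (simp add: square_def)
qed

definition matrix :: "nat \<Rightarrow> (nat \<Rightarrow> nat \<Rightarrow> bool) \<Rightarrow> bool list list" where
  "matrix n P = map (\<lambda>u. map (P u) [0..<n]) [0..<n]"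

lemma square_matrix: "square n (matrix n P)"
  by (auto simp: square_def matrix_def)

lemma look_matrix: "look (matrix n P) u v \<longleftrightarrow> u < n \<and> v < n \<and> P u v"
  by (cases "u < n"; cases "v < n") (auto simp: look_def matrix_def)

text \<open>One round of breadth-first search: a path once found is kept, a missing one is obtained
  by one arc from a vertex found before.\<close>

definition expand :: "bool list list \<Rightarrow> nat list list \<Rightarrow> nat list list" where
  "expand M T = map (\<lambda>v. case nthd [] T v of
       [] \<Rightarrow> (case filter (\<lambda>u. nthd [] T u \<noteq> [] \<and> look M u v) [0..<length M] of [] \<Rightarrow> [] | u # _ \<Rightarrow> nthd [] T u @ [v])
     | x # xs \<Rightarrow> x # xs) [0..<length M]"

text \<open>Row \<open>v\<close> of the table is a path from \<open>r\<close> to \<open>v\<close>, or empty if there is none.\<close>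

definition paths :: "bool list list \<Rightarrow> nat \<Rightarrow> nat list list" where
  "paths M r = foldl (\<lambda>T _. expand M T) (map (\<lambda>v. if v = r then [v] else []) [0..<length M]) (concat M)"

text \<open>The loop invariant after \<open>k\<close> rounds: every vertex within distance
  \<open>k\<close> of \<open>r\<close> has been found.\<close>

definition path_table :: "bool list list \<Rightarrow> nat \<Rightarrow> nat \<Rightarrow> nat list list \<Rightarrow> bool" where
  "path_table M r k T \<longleftrightarrow> length T = length M \<and> (r < length M \<longrightarrow> T ! r = [r]) \<and>
     (\<forall>v<length M. T ! v \<noteq> [] \<longrightarrow> hd (T ! v) = r \<and> last (T ! v) = v \<and> successively (look M) (T ! v) \<and>
        length (T ! v) \<le> Suc k \<and> set (T ! v) \<subseteq> {..<length M}) \<and>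
     (\<forall>v<length M. \<forall>j\<le>k. (r, v) \<in> {(a, b). look M a b} ^^ j \<longrightarrow> T ! v \<noteq> [])"

lemma path_table_expand:
  assumes T: "path_table M r k T" and sq: "square (length M) M"
  shows "path_table M r (Suc k) (expand M T)"
proof -
  let ?n = "length M" and ?E = "{(a, b). look M a b}"
  have len: "length T = ?n" using T by (simp add: path_table_def)
  have keep: "expand M T ! v = T ! v" if "v < ?n" "T ! v \<noteq> []" for v
    using that len by (auto simp: expand_def split: list.splits)
  have new: "expand M T ! v = [] \<and> (\<forall>u<?n. T ! u \<noteq> [] \<longrightarrow> \<not> look M u v) \<or>
      (\<exists>u<?n. T ! u \<noteq> [] \<and> look M u v \<and> expand M T ! v = T ! u @ [v])" if v: "v < ?n" "T ! v = []" for v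
  proof (cases "filter (\<lambda>u. nthd [] T u \<noteq> [] \<and> look M u v) [0..<?n]")
    case Nil
    then have "expand M T ! v = []" using v len by (simp add: expand_def)
    moreover have "\<forall>u<?n. T ! u \<noteq> [] \<longrightarrow> \<not> look M u v"
      using Nil len by (auto simp: filter_empty_conv)
    ultimately show ?thesis by blast
  next
    case (Cons u us)
    then have "u \<in> set (filter (\<lambda>u. nthd [] T u \<noteq> [] \<and> look M u v) [0..<?n])" by simp
    then have "u < ?n" "T ! u \<noteq> []" "look M u v" using len by auto
    moreover have "expand M T ! v = T ! u @ [v]" using Cons v len \<open>u < ?n\<close> by (simp add: expand_def)
    ultimately show ?thesis by blast
  qed
  have "expand M T ! v \<noteq> [] \<longrightarrow> hd (expand M T ! v) = r \<and> last (expand M T ! v) = v \<and>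
      successively (look M) (expand M T ! v) \<and> length (expand M T ! v) \<le> Suc (Suc k) \<and> set (expand M T ! v) \<subseteq> {..<?n}"
    if v: "v < ?n" for v
  proof (cases "T ! v = []")
    case False
    then show ?thesis using keep[OF v False] T v by (auto simp: path_table_def)
  next
    case True
    show ?thesis
    proof
      assume "expand M T ! v \<noteq> []"
      then obtain u where u: "u < ?n" "T ! u \<noteq> []" "look M u v" "expand M T ! v = T ! u @ [v]"
        using new[OF v True] by auto
      have "hd (T ! u) = r \<and> last (T ! u) = u \<and> successively (look M) (T ! u) \<and> length (T ! u) \<le> Suc k \<and> set (T ! u) \<subseteq> {..<?n}"
        using T u(1,2) by (simp add: path_table_def)
      then show "hd (expand M T ! v) = r \<and> last (expand M T ! v) = v \<and>
          successively (look M) (expand M T ! v) \<and> length (expand M T ! v) \<le> Suc (Suc k) \<and> set (expand M T ! v) \<subseteq> {..<?n}"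
        using u v by (auto simp: successively_append_iff)
    qed
  qed
  moreover have "expand M T ! v \<noteq> []" if v: "v < ?n" and j: "j \<le> Suc k" "(r, v) \<in> ?E ^^ j" for v j
  proof (cases "T ! v = []")
    case False
    then show ?thesis using keep[OF v False] by simp
  next
    case True
    then have "\<not> j \<le> k" using T v j(2) by (auto simp: path_table_def)
    then have "j = Suc k" using j(1) by simp
    then obtain u where u: "(r, u) \<in> ?E ^^ k" "look M u v" using j(2) by auto
    have "u < ?n" using look_square[OF sq u(2)] by simp
    then have "T ! u \<noteq> []" using T u(1) by (auto simp: path_table_def)
    then show ?thesis using new[OF v True] u(2) \<open>u < ?n\<close> by auto
  qed
  moreover have "length (expand M T) = ?n" by (simp add: expand_def)
  moreover have "r < ?n \<longrightarrow> expand M T ! r = [r]" using keep[of r] T by (auto simp: path_table_def)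
  ultimately show ?thesis by (simp add: path_table_def)
qed

lemma path_table_init: "path_table M r 0 (map (\<lambda>v. if v = r then [v] else []) [0..<length M])"
  by (auto simp: path_table_def)

lemma path_table_foldl:
  assumes "square (length M) M"
  shows "path_table M r (length xs) (foldl (\<lambda>T _. expand M T) (map (\<lambda>v. if v = r then [v] else []) [0..<length M]) xs)"
  by (induction xs rule: rev_induct) (auto simp: path_table_init path_table_expand assms)

text \<open>The matrix entries serve as loop counter. There are \<open>n * n\<close> of them, at
  least as many as arcs, so every reachable vertex is found in time.\<close>

lemma paths:
  assumes "square n M" "r < n"
  shows "length (paths M r) = n" "paths M r ! r = [r]"
    "\<And>v. v < n \<Longrightarrow> (look M)\<^sup>*\<^sup>* r v \<Longrightarrow> paths M r ! v \<noteq> []"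
    "\<And>v. v < n \<Longrightarrow> paths M r ! v \<noteq> [] \<Longrightarrow> hd (paths M r ! v) = r \<and> last (paths M r ! v) = v \<and>
       successively (look M) (paths M r ! v) \<and> length (paths M r ! v) \<le> Suc (n * n)"
proof -
  have n: "length M = n" using assms by (simp add: square_def)
  have P: "path_table M r (n * n) (paths M r)"
    using path_table_foldl[of M r "concat M"] assms n length_concat_square[OF assms(1)] by (simp add: paths_def)
  show "length (paths M r) = n" "paths M r ! r = [r]" using P n assms by (auto simp: path_table_def)
  show "hd (paths M r ! v) = r \<and> last (paths M r ! v) = v \<and>
       successively (look M) (paths M r ! v) \<and> length (paths M r ! v) \<le> Suc (n * n)"
    if "v < n" "paths M r ! v \<noteq> []" for v
    using P n that by (simp add: path_table_def)
  show "paths M r ! v \<noteq> []" if "v < n" "(look M)\<^sup>*\<^sup>* r v" for v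
  proof -
    let ?E = "{(a, b). look M a b}"
    have sub: "?E \<subseteq> {..<n} \<times> {..<n}" using look_square[OF assms(1)] by auto
    then have fin: "finite ?E" by (rule finite_subset) simp
    have "card ?E \<le> n * n" using card_mono[OF _ sub] by simp
    moreover have "(r, v) \<in> ?E\<^sup>*" using that(2) by (simp add: Enum.rtranclp_rtrancl_eq)
    then obtain j where "j \<le> card ?E" "(r, v) \<in> ?E ^^ j"
      unfolding rtrancl_finite_eq_relpow[OF fin] by blast
    ultimately have "j \<le> n * n" "(r, v) \<in> ?E ^^ j" by auto
    then show ?thesis using P n that(1) unfolding path_table_def by blast
  qed
qed

definition sym_or :: "bool list list \<Rightarrow> bool list list" where
  "sym_or M = matrix (length M) (\<lambda>u v. look M u v \<or> look M v u)"

definition sym_and :: "bool list list \<Rightarrow> bool list list" where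
  "sym_and M = matrix (length M) (\<lambda>u v. look M u v \<and> look M v u)"

section \<open>Candidates and greedy recolouring\<close>

definition walks :: "bool list list \<Rightarrow> nat list list" where
  "walks MG = paths (sym_or MG) 0"

definition closed_walks :: "bool list list \<Rightarrow> nat list list" where
  "closed_walks MG = concat (map (\<lambda>u. map (\<lambda>v. u @ rev v) (walks MG)) (walks MG))"

text \<open>Expressed through \<open>nthd\<close> and an interval, so that the running time follows
  from the rules for \<open>map\<close>; the lemma \<open>prefix_list\<close> recovers
  \<open>take\<close>.\<close>

definition prefix_list :: "nat list \<Rightarrow> nat list list" where
  "prefix_list C = map (\<lambda>j. map (nthd 0 C) [0..<Suc j]) [0..<length C]"

definition prefix_walks :: "bool list list \<Rightarrow> nat list list" where
  "prefix_walks MG = concat (map prefix_list (closed_walks MG))"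

definition all_paths :: "bool list list \<Rightarrow> nat list list" where
  "all_paths M = concat (map (paths M) [0..<length M])"

definition color_paths :: "bool list list \<Rightarrow> nat list list" where
  "color_paths MH = all_paths MH @ all_paths (sym_and MH)"

text \<open>Walks in \<open>walks MG\<close> have length at most \<open>L = n\<^sup>2 + 1\<close>, and exponents up to \<open>64 * L\<close> may be needed,
  see \<open>reroute\<close>.\<close>

definition exponents :: "bool list list \<Rightarrow> nat list" where
  "exponents MG = [0..<length (concat (map (\<lambda>_. True # concat MG) [0..<65]))]"

definition amap :: "nat list \<Rightarrow> nat list \<Rightarrow> nat list" where
  "amap A X = map (nthd 0 A) X"

definition candidates :: "bool list list \<Rightarrow> bool list list \<Rightarrow> nat list \<Rightarrow> nat list \<Rightarrow> nat list list" where
  "candidates MG MH A B =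
     concat (map (\<lambda>C. concat (map (\<lambda>k. concat (map (\<lambda>X. concat (map (\<lambda>g. map (\<lambda>Y.
       concat (map (\<lambda>_. amap A C) [0..<k]) @ amap A X @ g @ rev (amap B Y))
     (prefix_walks MG)) (color_paths MH))) (prefix_walks MG))) (exponents MG))) (closed_walks MG))"

text \<open>The trace of the root carried to every vertex along its walk in the table, as in
  \<open>red_walk\<close>.\<close>

definition starts :: "bool list list \<Rightarrow> nat list \<Rightarrow> nat list \<Rightarrow> nat list \<Rightarrow> nat list list" where
  "starts MG A B S = map (\<lambda>w. red (rev (amap A w) @ S @ amap B w)) (walks MG)"

definition hd0 :: "nat list \<Rightarrow> nat" where
  "hd0 xs = (case xs of [] \<Rightarrow> 0 | x # _ \<Rightarrow> x)"

lemma hd0 [simp]: "xs \<noteq> [] \<Longrightarrow> hd0 xs = hd xs"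
  by (cases xs) (auto simp: hd0_def)

definition movable :: "bool list list \<Rightarrow> bool list list \<Rightarrow> nat list list \<Rightarrow> nat \<Rightarrow> bool" where
  "movable MG MH R v = (case nthd [] R v of [] \<Rightarrow> False | a # as \<Rightarrow> (case as of [] \<Rightarrow> False | b # bs \<Rightarrow>
     a \<noteq> b \<and> look MH a b \<and> look MH b b \<and>
     list_all (\<lambda>w. w = v \<or>
       (look MG v w \<longrightarrow> hd0 (nthd [] R w) = b \<or> hd0 (nthd [] R w) = a \<and> look MH b a) \<and>
       (look MG w v \<longrightarrow> hd0 (nthd [] R w) = a \<or> hd0 (nthd [] R w) = b)) [0..<length MG]))"

text \<open>A state consists of the remaining walks, each beginning with the current colour, and of
  the colourings so far, the latest first.\<close>

definition greedy_step :: "bool list list \<Rightarrow> bool list list \<Rightarrow> nat list list \<times> nat list list \<Rightarrow> nat list list \<times> nat list list" where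
  "greedy_step MG MH st = (case filter (movable MG MH (fst st)) [0..<length MG] of
     [] \<Rightarrow> st
   | v # _ \<Rightarrow> (map (\<lambda>w. if w = v then tl (nthd [] (fst st) w) else nthd [] (fst st) w) [0..<length MG],
       map (\<lambda>w. hd0 (if w = v then tl (nthd [] (fst st) w) else nthd [] (fst st) w)) [0..<length MG] # snd st))"

text \<open>The entries of \<open>R\<close> count the rounds: there are at least as many as moves to
  be made.\<close>

definition greedy_run :: "bool list list \<Rightarrow> bool list list \<Rightarrow> nat list list \<Rightarrow> nat list list \<times> nat list list" where
  "greedy_run MG MH R = foldl (\<lambda>st _. greedy_step MG MH st) (R, [map hd0 R]) (concat R)"

definition greedy :: "bool list list \<Rightarrow> bool list list \<Rightarrow> nat list list \<Rightarrow> nat list list option" where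
  "greedy MG MH R = (if list_all (\<lambda>l. tl l = []) (fst (greedy_run MG MH R)) then Some (rev (snd (greedy_run MG MH R))) else None)"

definition solve :: "bool list list \<Rightarrow> bool list list \<Rightarrow> nat list \<Rightarrow> nat list \<Rightarrow> nat list list option" where
  "solve MG MH A B = (case concat (map (\<lambda>S. case greedy MG MH (starts MG A B S) of None \<Rightarrow> [] | Some t \<Rightarrow> [t])
       (candidates MG MH A B)) of [] \<Rightarrow> None | t # _ \<Rightarrow> Some t)"


subsection \<open>Correctness\<close>

context recoloring
begin

fun states :: "('a \<Rightarrow> 'b) \<Rightarrow> ('a \<times> 'b) list \<Rightarrow> ('a \<Rightarrow> 'b) list" where
  "states \<phi> [] = [\<phi>]"
| "states \<phi> (m # ms) = \<phi> # states (\<phi>(fst m := snd m)) ms"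

lemma states_snoc: "states \<phi> (ms @ [m]) = states \<phi> ms @ [final \<phi> (ms @ [m])]"
  by (induction ms arbitrary: \<phi>) auto

lemma valid_cong: "(\<And>v. v \<in> V \<Longrightarrow> \<phi> v = \<psi> v) \<Longrightarrow> valid \<phi> u b \<longleftrightarrow> valid \<psi> u b"
proof -
  assume eq: "\<And>v. v \<in> V \<Longrightarrow> \<phi> v = \<psi> v"
  have "EG u w \<Longrightarrow> \<phi> w = \<psi> w \<and> \<phi> u = \<psi> u" "EG w u \<Longrightarrow> \<phi> w = \<psi> w \<and> \<phi> u = \<psi> u" for w
    using EG_V eq by blast+
  then show ?thesis unfolding valid_def using eq by (cases "u \<in> V") auto
qed

lemma red_walk:
  assumes "ok \<alpha> ms" "successively nb W" "W \<noteq> []"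
  shows "red (tr \<alpha> ms (last W)) = red (rev (map \<alpha> W) @ tr \<alpha> ms (hd W) @ map (final \<alpha> ms) W)"
proof -
  have "red (rev (map \<alpha> W) @ tr \<alpha> ms (hd W) @ map (final \<alpha> ms) W) = red (rev (map \<alpha> W) @ map \<alpha> W @ tr \<alpha> ms (last W))"
    by (rule red_cong[OF refl trace_walk[OF assms, symmetric]])
  also have "\<dots> = red (\<alpha> (last W) # tr \<alpha> ms (last W))"
    using red_rev_append[of "map \<alpha> W" "[]" "tr \<alpha> ms (last W)"] assms(3) by (simp add: last_map)
  also have "\<dots> = red (tr \<alpha> ms (last W))" using red_hd[of "tr \<alpha> ms (last W)" "[]" "[]"] by simp
  finally show ?thesis by simp
qed

end

section \<open>Soundness and completeness of greedy recolouring\<close>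

locale instance_matrices =
  fixes MG MH :: "bool list list" and n m :: nat and \<alpha> \<beta> :: "nat \<Rightarrow> nat"
  assumes MG: "square n MG" and MH: "square m MH" and n0: "0 < n"
    and MG_refl: "\<And>v. v < n \<Longrightarrow> look MG v v" and MH_refl: "\<And>a. a < m \<Longrightarrow> look MH a a"
    and MG_connected: "\<And>v. v < n \<Longrightarrow> (\<lambda>u v. look MG u v \<or> look MG v u)\<^sup>*\<^sup>* 0 v"
    and \<alpha>_hom: "\<And>u v. look MG u v \<Longrightarrow> look MH (\<alpha> u) (\<alpha> v)"
begin

sublocale recoloring "{..<n}" "look MG" "look MH"
  by standard (use look_square[OF MG] MG_refl in auto)

lemma lengthMG: "length MG = n" and lengthMH: "length MH = m"
  using MG MH by (auto simp: square_def)

definition colors :: "nat list list \<Rightarrow> nat \<Rightarrow> nat" where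
  "colors R v = hd (R ! v)"

lemma movable_iff:
  assumes "length R = n" "\<And>v. v < n \<Longrightarrow> R ! v \<noteq> []" "v < n"
  shows "movable MG MH R v \<longleftrightarrow> (\<exists>a b bs. R ! v = a # b # bs \<and> valid (colors R) v b)"
proof (cases "R ! v")
  case (Cons a as)
  have h: "hd0 (nthd [] R w) = colors R w" if "w < n" for w using assms that by (simp add: colors_def)
  have c: "colors R v = a" using Cons by (simp add: colors_def)
  show ?thesis
  proof (cases as)
    case (Cons b bs)
    have "movable MG MH R v \<longleftrightarrow> a \<noteq> b \<and> look MH a b \<and> look MH b b \<and>
     (\<forall>w<n. w = v \<or>
       (look MG v w \<longrightarrow> colors R w = b \<or> colors R w = a \<and> look MH b a) \<and>
       (look MG w v \<longrightarrow> colors R w = a \<or> colors R w = b))"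
      using \<open>R ! v = a # as\<close> Cons assms h by (auto simp: movable_def list_all_iff lengthMG)
    also have "\<dots> \<longleftrightarrow> valid (colors R) v b"
      unfolding valid_def c using assms(3) EG_V by auto
    finally show ?thesis using \<open>R ! v = a # as\<close> Cons by auto
  qed (use \<open>R ! v = a # as\<close> assms in \<open>simp add: movable_def\<close>)
qed (use assms in auto)

lemma greedy_step_cases:
  assumes "length (fst st) = n" "\<And>v. v < n \<Longrightarrow> fst st ! v \<noteq> []"
  obtains (stuck) "greedy_step MG MH st = st" "\<And>v. v < n \<Longrightarrow> \<not> movable MG MH (fst st) v"
  | (move) v a b bs where "v < n" "fst st ! v = a # b # bs" "valid (colors (fst st)) v b"
     "greedy_step MG MH st = ((fst st)[v := b # bs], map ((colors (fst st))(v := b)) [0..<n] # snd st)"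
proof (cases "filter (movable MG MH (fst st)) [0..<n]")
  case Nil
  then show thesis using stuck by (auto simp: greedy_step_def filter_empty_conv lengthMG)
next
  case (Cons v vs)
  then have "v \<in> set (filter (movable MG MH (fst st)) [0..<n])" by simp
  then have v: "v < n" "movable MG MH (fst st) v" by auto
  then obtain a b bs where ab: "fst st ! v = a # b # bs" "valid (colors (fst st)) v b"
    using movable_iff[OF assms v(1)] by blast
  have 1: "map (\<lambda>w. if w = v then tl (nthd [] (fst st) w) else nthd [] (fst st) w) [0..<n] = (fst st)[v := b # bs]"
    using assms(1) v(1) ab(1) by (auto intro!: nth_equalityI simp: nth_list_update)
  have 2: "map (\<lambda>w. hd0 (if w = v then tl (nthd [] (fst st) w) else nthd [] (fst st) w)) [0..<n] = map ((colors (fst st))(v := b)) [0..<n]"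
    using assms v(1) ab(1) by (auto simp: colors_def)
  show thesis
    by (rule move[OF v(1) ab]) (use Cons 1 2 in \<open>simp add: greedy_step_def lengthMG\<close>)
qed

text \<open>This invariant holds for right and wrong candidates alike: the recorded colourings
  belong to a valid run, and the remaining walks still lead to \<beta>.\<close>

definition sound :: "nat list list \<times> nat list list \<Rightarrow> bool" where
  "sound st \<longleftrightarrow> length (fst st) = n \<and> (\<forall>v<n. fst st ! v \<noteq> [] \<and> last (fst st ! v) = \<beta> v) \<and>
     (\<exists>ms. ok \<alpha> ms \<and> (\<forall>v<n. final \<alpha> ms v = colors (fst st) v) \<and> rev (snd st) = map (\<lambda>\<phi>. map \<phi> [0..<n]) (states \<alpha> ms))"

lemma sound_step: assumes "sound st" shows "sound (greedy_step MG MH st)"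
proof -
  have len: "length (fst st) = n" and ne: "\<And>v. v < n \<Longrightarrow> fst st ! v \<noteq> []" using assms by (auto simp: sound_def)
  show ?thesis
  proof (cases rule: greedy_step_cases[OF len ne])
    case 2
    then show ?thesis using assms by simp
  next
    case (3 v a b bs)
    obtain ms where ms: "ok \<alpha> ms" "\<And>v. v < n \<Longrightarrow> final \<alpha> ms v = colors (fst st) v"
      "rev (snd st) = map (\<lambda>\<phi>. map \<phi> [0..<n]) (states \<alpha> ms)"
      using assms by (auto simp: sound_def)
    have "valid (final \<alpha> ms) v b" using valid_cong[of "final \<alpha> ms" "colors (fst st)" v b] ms(2) 3(3) by simp
    then have ok: "ok \<alpha> (ms @ [(v, b)])" using ms(1) by (simp add: ok_append)
    have f: "map (final \<alpha> (ms @ [(v, b)])) [0..<n] = map ((colors (fst st))(v := b)) [0..<n]"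
      using ms(2) by (simp add: final_append)
    have "rev (map ((colors (fst st))(v := b)) [0..<n] # snd st) = map (\<lambda>\<phi>. map \<phi> [0..<n]) (states \<alpha> (ms @ [(v, b)]))"
      using ms(3) f by (simp add: states_snoc)
    moreover have "final \<alpha> (ms @ [(v, b)]) w = colors ((fst st)[v := b # bs]) w" if "w < n" for w
      using ms(2)[OF that] len that by (auto simp: final_append colors_def nth_list_update)
    moreover have "(fst st)[v := b # bs] ! w \<noteq> [] \<and> last ((fst st)[v := b # bs] ! w) = \<beta> w" if "w < n" for w
      using assms that 3(1,2) len by (auto simp: sound_def nth_list_update split: if_splits)
    ultimately show ?thesis unfolding 3(4) sound_def using ok len by auto
  qed
qed

lemma sound_greedy:
  assumes R: "length R = n" "\<And>v. v < n \<Longrightarrow> R ! v \<noteq> [] \<and> hd (R ! v) = \<alpha> v \<and> last (R ! v) = \<beta> v"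
    and t: "greedy MG MH R = Some t"
  obtains ms where "ok \<alpha> ms" "\<And>v. v < n \<Longrightarrow> final \<alpha> ms v = \<beta> v" "t = map (\<lambda>\<phi>. map \<phi> [0..<n]) (states \<alpha> ms)"
proof -
  have "map hd0 R = map \<alpha> [0..<n]" using R by (auto intro!: nth_equalityI)
  then have "sound (R, [map hd0 R])"
    unfolding sound_def using R by (intro conjI exI[of _ "[]"]) (simp_all add: colors_def)
  then have "sound (foldl (\<lambda>st _. greedy_step MG MH st) (R, [map hd0 R]) xs)" for xs :: "nat list"
    by (induction xs rule: rev_induct) (auto intro: sound_step)
  then have s: "sound (greedy_run MG MH R)" by (simp add: greedy_run_def)
  obtain Rf tf where run: "greedy_run MG MH R = (Rf, tf)" by fastforce
  have fin: "\<forall>l\<in>set Rf. tl l = []" "t = rev tf"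
    using t run by (auto simp: greedy_def list_all_iff split: if_splits)
  obtain ms where ms: "ok \<alpha> ms" "\<And>v. v < n \<Longrightarrow> final \<alpha> ms v = colors Rf v" "rev tf = map (\<lambda>\<phi>. map \<phi> [0..<n]) (states \<alpha> ms)"
    using s run by (auto simp: sound_def)
  have "colors Rf v = \<beta> v" if "v < n" for v
  proof -
    have "Rf ! v \<noteq> []" "last (Rf ! v) = \<beta> v" "length Rf = n" using s run that by (auto simp: sound_def)
    moreover have "tl (Rf ! v) = []" using fin(1) \<open>length Rf = n\<close> that by auto
    ultimately show ?thesis by (cases "Rf ! v") (auto simp: colors_def)
  qed
  then show thesis using that[of ms] ms fin(2) by simp
qed

text \<open>The invariant for a right candidate. The remaining walk overlaps \<open>P v\<close> in
  the current colour, hence the subtraction of 1.\<close>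

definition remaining :: "(nat \<times> nat) list \<Rightarrow> (nat \<Rightarrow> nat list) \<Rightarrow> nat list list \<Rightarrow> bool" where
  "remaining ms S R \<longleftrightarrow> length R = n \<and> (\<exists>P. traced \<alpha> ms P \<and> (\<forall>v. prefix (P v) (S v)) \<and>
     (\<forall>v<n. R ! v = drop (length (P v) - 1) (S v)))"

definition work :: "nat list list \<Rightarrow> nat" where
  "work R = (\<Sum>v<n. length (R ! v) - 1)"

lemma remaining_ne: assumes "remaining ms S R" "v < n" shows "R ! v \<noteq> []"
proof -
  obtain P where "traced \<alpha> ms P" "prefix (P v) (S v)" "R ! v = drop (length (P v) - 1) (S v)"
    using assms by (auto simp: remaining_def)
  then show ?thesis using traced_ne[of \<alpha> ms P v] prefix_length_le[of "P v" "S v"] by (cases "P v") auto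
qed

text \<open>If the run got stuck before the end, \<open>traced_step\<close> would still provide a
  valid move, which \<open>movable\<close> would have found.\<close>

lemma remaining_step:
  assumes S: "traced \<alpha> ms S" and R: "remaining ms S (fst st)"
  shows "remaining ms S (fst (greedy_step MG MH st)) \<and>
    (work (fst st) = 0 \<or> work (fst (greedy_step MG MH st)) < work (fst st)) \<and>
    work (fst (greedy_step MG MH st)) \<le> work (fst st)"
proof -
  have len: "length (fst st) = n" using R by (simp add: remaining_def)
  note ne = remaining_ne[OF R]
  obtain P where P: "traced \<alpha> ms P" "\<And>v. prefix (P v) (S v)" "\<And>v. v < n \<Longrightarrow> fst st ! v = drop (length (P v) - 1) (S v)"
    using R by (auto simp: remaining_def)
  have dec: "fst st ! v = last (P v) # drop (length (P v)) (S v)" if "v < n" for v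
  proof -
    obtain z where z: "S v = P v @ z" using P(2)[of v] by (auto simp: prefix_def)
    have "P v = butlast (P v) @ [last (P v)]" using traced_ne[OF P(1), of v] by simp
    moreover have "length (P v) - 1 = length (butlast (P v))" by simp
    ultimately have "drop (length (P v) - 1) (P v) = [last (P v)]" by (metis append_eq_conv_conj)
    then show ?thesis using P(3)[OF that] z by simp
  qed
  have col: "colors (fst st) v = last (P v)" if "v < n" for v using dec[OF that] by (simp add: colors_def)
  have val: "valid (colors (fst st)) v b \<longleftrightarrow> valid (\<lambda>v. last (P v)) v b" for v b
    by (rule valid_cong) (simp add: col)
  show ?thesis
  proof (cases rule: greedy_step_cases[OF len ne])
    case 2
    then have stuck: "greedy_step MG MH st = st" "\<And>v. v < n \<Longrightarrow> \<not> movable MG MH (fst st) v" .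
    have "P = S"
    proof (rule ccontr)
      assume "P \<noteq> S"
      then obtain u b where ub: "\<And>v. prefix ((P(u := P u @ [b])) v) (S v)" "valid (\<lambda>v. last (P v)) u b" "u \<in> {..<n}"
        using traced_step[OF P(1) S P(2) \<open>P \<noteq> S\<close>] by blast
      have "prefix (P u @ [b]) (S u)" using ub(1)[of u] by simp
      then obtain z where "S u = P u @ b # z" by (auto simp: prefix_def)
      then have "fst st ! u = last (P u) # b # z" using dec[of u] ub(3) by simp
      then show False using stuck(2)[of u] movable_iff[OF len ne, of u] ub(2,3) val by auto
    qed
    then have "work (fst st) = 0" unfolding work_def using dec by simp
    then show ?thesis using stuck(1) R by simp
  next
    case (3 v a b bs)
    have Sv: "drop (length (P v)) (S v) = b # bs" "a = last (P v)" using dec[OF 3(1)] 3(2) by auto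
    then have S': "S v = P v @ b # bs" using P(2)[of v] by (auto simp: prefix_def)
    let ?P = "P(v := P v @ [b])"
    have feas: "feasible \<alpha> ?P" using feasible_step[of \<alpha> P v b] P(1) 3(3) val by (auto simp: traced_def)
    have pre: "prefix (?P w) (S w)" for w using P(2)[of w] S' by simp
    then have "prefix (?P w) (red (tr \<alpha> ms w))" for w
      using S prefix_order.trans unfolding traced_def by blast
    then have "traced \<alpha> ms ?P" using feas P(1) by (auto simp: traced_def)
    moreover have "(fst st)[v := b # bs] ! w = drop (length (?P w) - 1) (S w)" if "w < n" for w
      using that P(3)[OF that] len Sv(1) by (auto simp: nth_list_update)
    ultimately have rem: "remaining ms S ((fst st)[v := b # bs])"
      using pre len unfolding remaining_def by auto
    have "work ((fst st)[v := b # bs]) < work (fst st)"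
      unfolding work_def
    proof (rule sum_strict_mono_ex1)
      show "\<forall>x\<in>{..<n}. length ((fst st)[v := b # bs] ! x) - 1 \<le> length (fst st ! x) - 1"
        using len 3(1,2) by (auto simp: nth_list_update)
      show "\<exists>x\<in>{..<n}. length ((fst st)[v := b # bs] ! x) - 1 < length (fst st ! x) - 1"
        using len 3(1,2) by (intro bexI[of _ v]) auto
    qed simp
    then show ?thesis unfolding 3(4) using rem by simp
  qed
qed

lemma greedy_complete:
  assumes ok: "ok \<alpha> ms" and R: "R = map (\<lambda>v. red (tr \<alpha> ms v)) [0..<n]"
  shows "greedy MG MH R \<noteq> None"
proof -
  have hom: "hom \<alpha>" using \<alpha>_hom by (simp add: hom_def)
  let ?S = "\<lambda>v. red (tr \<alpha> ms v)"
  have S: "traced \<alpha> ms ?S" using traced_full[OF hom ok] .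
  have pre: "prefix [\<alpha> v] (?S v)" for v
    using traced_ne[OF S, of v] traced_hd[OF S, of v] by (cases "?S v") auto
  have init: "remaining ms ?S R"
    unfolding remaining_def using traced_init[OF hom ok] pre by (intro conjI exI[of _ "\<lambda>v. [\<alpha> v]"]) (auto simp: R)
  let ?st = "\<lambda>xs. foldl (\<lambda>st _. greedy_step MG MH st) (R, [map hd0 R]) xs"
  have *: "remaining ms ?S (fst (?st xs)) \<and> work (fst (?st xs)) \<le> work R - length xs" for xs :: "nat list"
  proof (induction xs rule: rev_induct)
    case (snoc x xs)
    then show ?case using remaining_step[OF S, of "?st xs"] by auto
  qed (use init in simp)
  have "work R \<le> length (concat R)"
  proof -
    have "work R \<le> (\<Sum>v<n. length (R ! v))" unfolding work_def by (rule sum_mono) simp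
    also have "\<dots> = sum_list (map length R)"
      using R by (simp add: sum_list_sum_nth atLeast0LessThan)
    finally show ?thesis by (simp add: length_concat)
  qed
  then have fin: "remaining ms ?S (fst (greedy_run MG MH R))" "work (fst (greedy_run MG MH R)) = 0"
    using *[of "concat R"] by (auto simp: greedy_run_def)
  have "tl l = []" if l: "l \<in> set (fst (greedy_run MG MH R))" for l
  proof -
    have "length (fst (greedy_run MG MH R)) = n" using fin(1) by (simp add: remaining_def)
    then obtain v where "v < n" "l = fst (greedy_run MG MH R) ! v" using l by (auto simp: in_set_conv_nth)
    then have "length l - 1 = 0" using fin(2) by (auto simp: work_def)
    then show ?thesis by (cases l) auto
  qed
  then show ?thesis by (simp add: greedy_def list_all_iff)
qed

section \<open>The tables of walks, and the correctness of \<open>solve\<close>\<close>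

definition "W v = walks MG ! v"

lemma look_sym_or: "look (sym_or MG) u v \<longleftrightarrow> nb u v"
  using look_square[OF MG] by (auto simp: sym_or_def look_matrix lengthMG nb_def)

lemma look_sym_or_fun: "look (sym_or MG) = nb"
  by (intro ext) (rule look_sym_or)

lemma walks: "length (walks MG) = n" "W 0 = [0]"
  and W: "v < n \<Longrightarrow> successively nb (W v) \<and> W v \<noteq> [] \<and> hd (W v) = 0 \<and> last (W v) = v \<and> length (W v) \<le> Suc (n * n)"
proof -
  have sq: "square n (sym_or MG)" using square_matrix[of n] by (simp add: sym_or_def lengthMG)
  note p = paths[OF sq n0]
  show "length (walks MG) = n" "W 0 = [0]" using p(1,2) by (auto simp: walks_def W_def)
  assume v: "v < n"
  have "(\<lambda>u v. look MG u v \<or> look MG v u) = nb" by (intro ext) (simp add: nb_def)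
  then have "nb\<^sup>*\<^sup>* 0 v" using MG_connected[OF v] by metis
  then have "W v \<noteq> []" using p(3)[OF v] by (simp add: look_sym_or_fun W_def walks_def)
  then show "successively nb (W v) \<and> W v \<noteq> [] \<and> hd (W v) = 0 \<and> last (W v) = v \<and> length (W v) \<le> Suc (n * n)"
    using p(4)[OF v] by (simp add: look_sym_or_fun W_def walks_def)
qed

lemma set_walks: "set (walks MG) = W ` {..<n}"
  using walks(1) by (auto simp: set_conv_nth W_def)

lemma set_W: assumes "v < n" shows "set (W v) \<subseteq> {..<n}"
proof
  fix z assume z: "z \<in> set (W v)"
  obtain xs ys where s: "W v = xs @ z # ys" using z by (meson split_list)
  show "z \<in> {..<n}"
  proof (cases ys)
    case Nil
    then show ?thesis using W[OF assms] s assms by auto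
  next
    case (Cons y zs)
    then have "nb z y" using W[OF assms] s by (auto simp: successively_append_iff)
    then show ?thesis using nb_V by blast
  qed
qed

lemma set_closed_walks: "set (closed_walks MG) = {W u @ rev (W v) | u v. u < n \<and> v < n}"
  by (auto simp: closed_walks_def set_walks)

lemma prefix_list: "prefix_list C = map (\<lambda>j. take (Suc j) C) [0..<length C]"
proof -
  have "map (nthd 0 C) [0..<Suc j] = take (Suc j) C" if "j < length C" for j
    using that by (intro nth_equalityI) (auto simp del: upt_Suc)
  then show ?thesis unfolding prefix_list_def by (intro map_cong) auto
qed

lemma prefix_walks_subset: "X \<in> set (prefix_walks MG) \<Longrightarrow> set X \<subseteq> {..<n}"
proof -
  assume "X \<in> set (prefix_walks MG)"
  then obtain C j where "C \<in> set (closed_walks MG)" "X = take (Suc j) C" by (auto simp: prefix_walks_def prefix_list)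
  then obtain u v where "u < n" "v < n" "C = W u @ rev (W v)" by (auto simp: set_closed_walks)
  then have "set C \<subseteq> {..<n}" using set_W[of u] set_W[of v] by auto
  moreover have "set X \<subseteq> set C" using \<open>X = _\<close> set_take_subset by fast
  ultimately show ?thesis by blast
qed

lemma amap: "set X \<subseteq> {..<n} \<Longrightarrow> amap (map \<phi> [0..<n]) X = map \<phi> X"
  by (auto simp: amap_def)

lemma color_paths:
  assumes a: "a < m" and reach: "(EH_sym bi)\<^sup>*\<^sup>* a b"
  shows "\<exists>g\<in>set (color_paths MH). successively (EH_sym bi) g \<and> g \<noteq> [] \<and> hd g = a \<and> last g = b \<and> (a = b \<longrightarrow> g = [b])"
proof -
  define M where "M = (if bi then sym_and MH else MH)"
  have M: "square m M" using MH square_matrix[of m] by (simp add: M_def sym_and_def lengthMH)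
  have eq: "look M = EH_sym bi"
    using look_square[OF MH] by (intro ext) (auto simp: M_def sym_and_def look_matrix lengthMH EH_sym_def)
  have b: "b < m" using reach a
    by (induction rule: rtranclp_induct) (auto simp: EH_sym_def look_square[OF MH])
  have lM: "length M = m" using M by (simp add: square_def)
  note p = paths[OF M a]
  have ne: "paths M a ! b \<noteq> []" using p(3)[OF b] reach eq by simp
  have "paths M a ! b \<in> set (paths M a)" using p(1) b by simp
  then have "paths M a ! b \<in> set (all_paths M)" using a lM by (auto simp: all_paths_def)
  then have "paths M a ! b \<in> set (color_paths MH)" by (auto simp: color_paths_def M_def split: if_splits)
  then show ?thesis using p(4)[OF b ne] p(2) ne eq by (intro bexI[of _ "paths M a ! b"]) auto
qed

text \<open>65 copies, because the bound \<open>64 * Suc (n * n)\<close> must itself occur among the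
  exponents.\<close>

lemma set_exponents: "set (exponents MG) = {..<65 * Suc (n * n)}"
proof -
  have "length (concat (map (\<lambda>_. True # concat MG) [0..<k])) = k * Suc (n * n)" for k
    by (induction k) (auto simp: length_concat_square[OF MG])
  then show ?thesis unfolding exponents_def by (simp add: atLeast0LessThan del: upt_conv_Cons)
qed

lemma solve_correct:
  defines "A \<equiv> map \<alpha> [0..<n]" and "B \<equiv> map \<beta> [0..<n]"
  shows "case solve MG MH A B of
      Some t \<Rightarrow> \<exists>ms. ok \<alpha> ms \<and> (\<forall>v<n. final \<alpha> ms v = \<beta> v) \<and> t = map (\<lambda>\<phi>. map \<phi> [0..<n]) (states \<alpha> ms)
    | None \<Rightarrow> \<nexists>ms. ok \<alpha> ms \<and> final \<alpha> ms = \<beta>"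
proof -
  let ?res = "concat (map (\<lambda>S. case greedy MG MH (starts MG A B S) of None \<Rightarrow> [] | Some t \<Rightarrow> [t]) (candidates MG MH A B))"
  have amapW: "amap A (W v) = map \<alpha> (W v)" "amap B (W v) = map \<beta> (W v)" if "v < n" for v
    using amap[OF set_W[OF that]] by (simp_all add: A_def B_def)
  have starts: "starts MG A B S = map (\<lambda>v. red (rev (map \<alpha> (W v)) @ S @ map \<beta> (W v))) [0..<n]" for S
    unfolding starts_def using walks(1) amapW by (intro nth_equalityI) (auto simp: W_def)
  show ?thesis
  proof (cases ?res)
    case (Cons t ts)
    then have "t \<in> set ?res" by simp
    then obtain S where t: "greedy MG MH (starts MG A B S) = Some t" by (auto split: option.splits)
    have "starts MG A B S ! v \<noteq> [] \<and> hd (starts MG A B S ! v) = \<alpha> v \<and> last (starts MG A B S ! v) = \<beta> v" if "v < n" for v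
      using W[OF that] that by (auto simp: starts hd_append hd_rev last_map)
    moreover have "length (starts MG A B S) = n" by (simp add: starts)
    ultimately obtain ms where "ok \<alpha> ms" "\<And>v. v < n \<Longrightarrow> final \<alpha> ms v = \<beta> v" "t = map (\<lambda>\<phi>. map \<phi> [0..<n]) (states \<alpha> ms)"
      using sound_greedy[OF _ _ t] by blast
    then show ?thesis using Cons by (auto simp: solve_def)
  next
    case Nil
    \<comment> \<open>A recolouring can be rerouted so that a candidate has the same reduction as
      the trace of its root; the greedy run on this candidate would succeed.\<close>
    have "False" if ms: "ok \<alpha> ms" "final \<alpha> ms = \<beta>" for ms
    proof -
      have hom: "hom \<alpha>" using \<alpha>_hom by (simp add: hom_def)
      have loops: "look MH b b" if "look MH a b" for a b using look_square[OF MH that] MH_refl by blast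
      have "\<exists>ms'. ok \<alpha> ms' \<and> final \<alpha> ms' = final \<alpha> ms \<and>
        (\<exists>C\<in>set (closed_walks MG). \<exists>k\<le>64 * Suc (n * n). \<exists>X\<in>set (prefix_walks MG). \<exists>g\<in>set (color_paths MH). \<exists>Y\<in>set (prefix_walks MG).
         red (tr \<alpha> ms' 0) = red (concat (replicate k (map \<alpha> C)) @ map \<alpha> X @ g @ rev (map (final \<alpha> ms) Y)))"
      proof (rule reroute[where W = W and r = 0 and L = "Suc (n * n)", OF hom ms(1) loops])
        show "W u @ rev (W v) \<in> set (closed_walks MG)" if "u \<in> {..<n}" "v \<in> {..<n}" for u v
          using that by (auto simp: set_closed_walks)
        show "take i C \<in> set (prefix_walks MG)" if "C \<in> set (closed_walks MG)" "1 \<le> i" "i \<le> length C" for C i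
        proof -
          have "take i C \<in> set (prefix_list C)" using that(2,3) by (auto simp: prefix_list intro!: image_eqI[of _ _ "i - 1"])
          then show ?thesis using that(1) by (auto simp: prefix_walks_def)
        qed
        show "\<exists>g\<in>set (color_paths MH). successively (EH_sym bi) g \<and> g \<noteq> [] \<and> hd g = \<alpha> v \<and> last g = b \<and> (\<alpha> v = b \<longrightarrow> g = [b])"
          if "v \<in> {..<n}" "(EH_sym bi)\<^sup>*\<^sup>* (\<alpha> v) b" for bi v b
        proof (rule color_paths[OF _ that(2)])
          show "\<alpha> v < m" using look_square[OF MH \<alpha>_hom[OF MG_refl]] that(1) by auto
        qed
      qed (use W walks n0 in auto)
      then obtain ms' C k X g Y where c: "ok \<alpha> ms'" "final \<alpha> ms' = \<beta>" "C \<in> set (closed_walks MG)" "k \<le> 64 * Suc (n * n)"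
        "X \<in> set (prefix_walks MG)" "g \<in> set (color_paths MH)" "Y \<in> set (prefix_walks MG)"
        "red (tr \<alpha> ms' 0) = red (concat (replicate k (map \<alpha> C)) @ map \<alpha> X @ g @ rev (map \<beta> Y))"
        using ms(2) by blast
      define S where "S = concat (map (\<lambda>_. amap A C) [0..<k]) @ amap A X @ g @ rev (amap B Y)"
      have kin: "k \<in> set (exponents MG)" using c(4) by (simp add: set_exponents)
      have Sin: "S \<in> set (candidates MG MH A B)"
        unfolding candidates_def S_def using c(3,5-7) kin by (auto intro!: bexI)
      obtain u v where "u < n" "v < n" "C = W u @ rev (W v)" using c(3) by (auto simp: set_closed_walks)
      then have "set C \<subseteq> {..<n}" using set_W[of u] set_W[of v] by auto
      moreover have "map (\<lambda>_. amap A C) [0..<k] = replicate k (amap A C)" by (simp add: map_replicate_const)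
      ultimately have "S = concat (replicate k (map \<alpha> C)) @ map \<alpha> X @ g @ rev (map \<beta> Y)"
        using amap prefix_walks_subset[OF c(5)] prefix_walks_subset[OF c(7)] by (simp add: S_def A_def B_def)
      then have S: "red S = red (tr \<alpha> ms' 0)" using c(8) by simp
      have "red (rev (map \<alpha> (W v)) @ S @ map \<beta> (W v)) = red (tr \<alpha> ms' v)" if "v < n" for v
      proof -
        have "red (rev (map \<alpha> (W v)) @ S @ map \<beta> (W v)) = red (rev (map \<alpha> (W v)) @ tr \<alpha> ms' 0 @ map \<beta> (W v))"
          by (intro red_cong refl S)
        also have "\<dots> = red (tr \<alpha> ms' v)" using red_walk[OF c(1), of "W v"] W[OF that] c(2) by simp
        finally show ?thesis .
      qed
      then have "starts MG A B S = map (\<lambda>v. red (tr \<alpha> ms' v)) [0..<n]" by (simp add: starts)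
      then have "greedy MG MH (starts MG A B S) \<noteq> None" using greedy_complete[OF c(1)] by blast
      then show False using Nil Sin by auto
    qed
    moreover have "solve MG MH A B = None" unfolding solve_def Nil by simp
    ultimately show ?thesis by auto
  qed
qed

end


subsection \<open>Running time\<close>

lemma pt_not [pt_intros]: "pt P \<Longrightarrow> pt (\<lambda>x. \<not> P x)"
proof -
  assume "pt P"
  then have "pt (\<lambda>x. if P x then False else True)" by (intro pt_intros)
  moreover have "(\<lambda>x. if P x then False else True) = (\<lambda>x. \<not> P x)" by auto
  ultimately show ?thesis by simp
qed

lemma pt_conj [pt_intros]: "pt P \<Longrightarrow> pt Q \<Longrightarrow> pt (\<lambda>x. P x \<and> Q x)"
proof -
  assume "pt P" "pt Q"
  then have "pt (\<lambda>x. if P x then Q x else False)" by (intro pt_intros)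
  moreover have "(\<lambda>x. if P x then Q x else False) = (\<lambda>x. P x \<and> Q x)" by auto
  ultimately show ?thesis by simp
qed

lemma pt_disj [pt_intros]: "pt P \<Longrightarrow> pt Q \<Longrightarrow> pt (\<lambda>x. P x \<or> Q x)"
proof -
  assume "pt P" "pt Q"
  then have "pt (\<lambda>x. if P x then True else Q x)" by (intro pt_intros)
  moreover have "(\<lambda>x. if P x then True else Q x) = (\<lambda>x. P x \<or> Q x)" by auto
  ultimately show ?thesis by simp
qed

lemma pt_imp [pt_intros]: "pt P \<Longrightarrow> pt Q \<Longrightarrow> pt (\<lambda>x. P x \<longrightarrow> Q x)"
  unfolding imp_conv_disj by (intro pt_intros)

lemma pt_eq_Nil [pt_intros]: "pt l \<Longrightarrow> pt (\<lambda>x. l x = [])"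
proof -
  assume "pt l"
  then have "pt (\<lambda>x. case l x of [] \<Rightarrow> True | a # as \<Rightarrow> False)" by (intro pt_intros)
  moreover have "(\<lambda>x. case l x of [] \<Rightarrow> True | a # as \<Rightarrow> False) = (\<lambda>x. l x = [])" by (auto simp: fun_eq_iff split: list.splits)
  ultimately show ?thesis by simp
qed

text \<open>In a branch of a case expression the input is paired with the components read.
  \<open>THEN pt_comp\<close> lets the hypothesis apply to the first component of such a
  pair.\<close>

lemma pt_tl [pt_intros]:
  assumes "pt l" shows "pt (\<lambda>x. tl (l x))"
  unfolding tl_def by (intro pt_intros assms[THEN pt_comp])

text \<open>A unary number has the same code as a list of units, so numbers can drive
  \<open>foldl\<close>.\<close>

lemma pt_units: "pt f \<Longrightarrow> pt (\<lambda>x. replicate (f x) ())"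
proof (rule pt_cast[of f])
  have "enc (replicate n ()) = enc n" for n by (induction n) auto
  then show "\<And>x. enc (replicate (f x) ()) = enc (f x)" .
qed

lemma pt_drop [pt_intros]: assumes "pt n" "pt l" shows "pt (\<lambda>x. drop (n x) (l x))"
proof -
  have eq: "drop k xs = foldl (\<lambda>l _. tl l) xs (replicate k ())" for k and xs :: "'b list"
    by (induction k arbitrary: xs) (auto simp: drop_Suc)
  have "size (enc (tl xs)) \<le> size (enc xs) + 0" for xs :: "'b list" by (cases xs) auto
  then show ?thesis unfolding eq
    by (intro pt_foldl_additive[where q = "\<lambda>_. 0"] pt_units assms pt_tl pt_fst pt_snd pt_id pbd_const)
qed

lemma pt_minus [pt_intros]: assumes "pt f" "pt g" shows "pt (\<lambda>x. f x - (g x :: nat))"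
proof -
  have eq: "n - k = foldl (\<lambda>a _. case a of 0 \<Rightarrow> 0 | Suc b \<Rightarrow> b) n (replicate k ())" for n k :: nat
  proof (induction k arbitrary: n)
    case (Suc k)
    then show ?case by (cases n) (simp_all flip: Suc.IH)
  qed simp
  have "size (enc (case a of 0 \<Rightarrow> 0 | Suc b \<Rightarrow> b)) \<le> size (enc a) + 0" for a :: nat by (cases a) auto
  then show ?thesis unfolding eq
    by (intro pt_foldl_additive[where q = "\<lambda>_. 0"] pt_units assms pt_case_nat pt_const pt_fst pt_snd pt_id pbd_const)
qed

lemma pt_eq_nat [pt_intros]: assumes "pt f" "pt g" shows "pt (\<lambda>x. f x = (g x :: nat))"
proof -
  have "pt (\<lambda>x. case f x - g x of 0 \<Rightarrow> (case g x - f x of 0 \<Rightarrow> True | Suc n \<Rightarrow> False) | Suc n \<Rightarrow> False)"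
    by (intro pt_intros assms)
  moreover have "(\<lambda>x. case f x - g x of 0 \<Rightarrow> (case g x - f x of 0 \<Rightarrow> True | Suc n \<Rightarrow> False) | Suc n \<Rightarrow> False)
      = (\<lambda>x. f x = g x)"
    by (auto simp: fun_eq_iff split: nat.splits)
  ultimately show ?thesis by simp
qed

lemma pt_length [pt_intros]: assumes "pt l" shows "pt (\<lambda>x. length (l x))"
proof -
  have eq: "length xs = foldl (\<lambda>n _. Suc n) 0 xs" for xs :: "'b list"
    by (induction xs rule: rev_induct) auto
  show ?thesis unfolding eq
    by (rule pt_foldl_additive[where q = "\<lambda>_. 1"]) (intro pt_intros assms pbd_const | simp)+
qed

text \<open>The new entry is as large as the counter inside the accumulator, so the growth is not
  additive and a quadratic bound is given directly.\<close>

lemma pt_upt [pt_intros]: assumes "pt f" shows "pt (\<lambda>x. [0..<f x])"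
proof -
  let ?F = "\<lambda>acc (_ :: unit). (Suc (fst acc), snd acc @ [fst acc])"
  have fold: "foldl ?F (0, []) (replicate k ()) = (k, [0..<k])" for k
  proof (induction k)
    case (Suc k)
    have "replicate (Suc k) () = replicate k () @ [()]" by (simp add: replicate_append_same)
    then show ?case using Suc by simp
  qed simp
  have "size (enc [0..<k]) \<le> k * Suc k" for k
    by (rule size_enc_list_le) auto
  then have B: "size (enc (k, [0..<k])) \<le> Suc (k + k * Suc k)" for k by simp
  have "pt (\<lambda>x. snd (foldl ?F (0, []) (replicate (f x) ())))"
  proof (intro pt_snd pt_foldl[where B = "\<lambda>x. Suc (f x + f x * Suc (f x))"] pt_units assms)
    have f: "pbd f" using pt_pbd_size[OF assms] by simp
    show "pbd (\<lambda>x. Suc (f x + f x * Suc (f x)))" by (intro pbd_intros f)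
    show "size (enc (foldl ?F (0, []) (take j (replicate (f x) ())))) \<le> Suc (f x + f x * Suc (f x))"
      if "j \<le> length (replicate (f x) ())" for x j
    proof -
      have "j \<le> f x" using that by simp
      have "foldl ?F (0, []) (take j (replicate (f x) ())) = (j, [0..<j])" using fold[of j] \<open>j \<le> f x\<close> by (simp add: min_def)
      moreover have "Suc (j + j * Suc j) \<le> Suc (f x + f x * Suc (f x))"
        using \<open>j \<le> f x\<close> by (simp add: add_mono mult_mono)
      ultimately show ?thesis using B[of j] le_trans by metis
    qed
  qed (intro pt_intros)+
  then show ?thesis by (simp add: fold)
qed

lemma pt_filter [pt_intros]: assumes "pt l" "pt (\<lambda>z. P (fst z) (snd z))" shows "pt (\<lambda>x. filter (P x) (l x))"
proof -
  have eq: "filter Q xs = concat (map (\<lambda>a. if Q a then [a] else []) xs)" for Q and xs :: "'b list"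
    by (induction xs) auto
  have "pt (\<lambda>x. concat (map (\<lambda>a. if P x a then [a] else []) (l x)))" by (intro pt_intros assms)
  then show ?thesis by (subst eq)
qed

lemma pt_list_all [pt_intros]: assumes "pt l" "pt (\<lambda>z. P (fst z) (snd z))" shows "pt (\<lambda>x. list_all (P x) (l x))"
proof -
  have "pt (\<lambda>x. filter (\<lambda>a. \<not> P x a) (l x) = [])" by (intro pt_intros assms)
  moreover have "(\<lambda>x. filter (\<lambda>a. \<not> P x a) (l x) = []) = (\<lambda>x. list_all (P x) (l x))"
    by (auto simp: filter_empty_conv list_all_iff)
  ultimately show ?thesis by simp
qed

lemma pt_concat [pt_intros]: assumes "pt l" shows "pt (\<lambda>x. concat (l x))"
proof -
  have "pt (\<lambda>x. concat (map (\<lambda>a. a) (l x)))" by (intro pt_concat_map pt_snd pt_id assms)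
  then show ?thesis by simp
qed

lemma pt_nthd [pt_intros]:
  assumes "pt d" "pt l" "pt i" shows "pt (\<lambda>x. nthd (d x) (l x) (i x))"
  unfolding nthd_def by (intro pt_intros assms[THEN pt_comp])

lemma pt_look [pt_intros]:
  assumes "pt M" "pt u" "pt v" shows "pt (\<lambda>x. look (M x) (u x) (v x))"
  unfolding look_def by (intro pt_intros assms[THEN pt_comp])

text \<open>Nested patterns are split into single case distinctions, to which
  \<open>pt_case_list\<close> applies.\<close>

lemma push_alt: "push st x = (case st of [] \<Rightarrow> [x] | y # t \<Rightarrow> if x = y then st else
    (case t of [] \<Rightarrow> x # st | z # r \<Rightarrow> if x = z then t else x # st))"
  by (cases "(st, x)" rule: push.cases) auto

lemma pt_red [pt_intros]: assumes "pt l" shows "pt (\<lambda>x. red (l x :: nat list))"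
  unfolding red_def
proof (intro pt_rev pt_foldl_additive[where q = "\<lambda>z. Suc (size (enc (snd z)))"] assms pt_const)
  show "pt (\<lambda>z. push (fst (snd z)) (snd (snd z) :: nat))" unfolding push_alt by (intro pt_intros)
  show "pbd (\<lambda>z. Suc (size (enc (snd z))))" by (intro pbd_intros pbd_le_size) (simp add: enc_prod_def)
  show "size (enc (push acc y)) \<le> size (enc acc) + Suc (size (enc (snd (x, y))))" for x acc and y :: nat
    by (cases "(acc, y)" rule: push.cases) auto
qed

lemma pt_expand [pt_intros]:
  assumes "pt M" "pt T" shows "pt (\<lambda>x. expand (M x) (T x))"
  unfolding expand_def by (intro pt_intros assms[THEN pt_comp])

lemma length_concat_le_size: "length (concat M) \<le> size (enc M)"
proof (induction M)
  case (Cons r M)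
  then show ?case using length_le_size_enc[of r] by simp
qed simp

text \<open>\<open>expand\<close> copies rows, so its growth depends on the accumulator. The bound
  comes from the shape of the rows: they hold vertices and have at most one entry more than there
  were rounds.\<close>

lemma paths_size:
  "size (enc (foldl (\<lambda>T _. expand M T) (map (\<lambda>v. if v = r then [v] else []) [0..<length M]) xs))
     \<le> length M * Suc (Suc (length xs) * Suc (length M))" (is "size (enc (?T xs)) \<le> _")
proof -
  have *: "length (?T xs) = length M \<and> (\<forall>p\<in>set (?T xs). length p \<le> Suc (length xs) \<and> (\<forall>v\<in>set p. v \<le> length M))" for xs :: "'a list"
  proof (induction xs rule: rev_induct)
    case (snoc x xs)
    have T: "nthd [] (?T xs) u = [] \<or> nthd [] (?T xs) u \<in> set (?T xs)" for u
      by (cases "u < length (?T xs)") auto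
    have "length p \<le> Suc (Suc (length xs)) \<and> (\<forall>v\<in>set p. v \<le> length M)" if p: "p \<in> set (expand M (?T xs))" for p
    proof -
      define t where "t = nthd [] (?T xs)"
      obtain v where v: "v < length M" "p = (case t v of
       [] \<Rightarrow> (case filter (\<lambda>u. t u \<noteq> [] \<and> look M u v) [0..<length M] of [] \<Rightarrow> [] | u # _ \<Rightarrow> t u @ [v])
     | y # ys \<Rightarrow> y # ys)" using p unfolding expand_def t_def by auto
      have b: "length (t u) \<le> Suc (length xs)" "\<forall>w\<in>set (t u). w \<le> length M" for u
        using T[of u] snoc by (auto simp: t_def)
      have "p = t v \<or> p = [] \<or> (\<exists>u. p = t u @ [v])"
        unfolding v(2) by (auto split: list.split)
      then show ?thesis
      proof (elim disjE exE)
        assume "p = t v"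
        then show ?thesis using b[of v] by auto
      next
        fix u assume "p = t u @ [v]"
        then show ?thesis using b[of u] v(1) by auto
      qed simp
    qed
    then show ?case by (simp add: expand_def[of M "?T xs"])
  qed (auto split: if_splits)
  have "size (enc p) \<le> Suc (length xs) * Suc (length M)" if "p \<in> set (?T xs)" for p
    using *[of xs] that by (intro size_enc_list_le) auto
  then show ?thesis using * by (intro size_enc_list_le) auto
qed

lemma pt_paths [pt_intros]: assumes "pt M" "pt r" shows "pt (\<lambda>x. paths (M x) (r x))"
  unfolding paths_def
proof (rule pt_foldl[where B = "\<lambda>x. size (enc (M x)) * Suc (Suc (size (enc (M x))) * Suc (size (enc (M x))))"])
  show "pbd (\<lambda>x. size (enc (M x)) * Suc (Suc (size (enc (M x))) * Suc (size (enc (M x)))))"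
    by (intro pbd_intros pt_pbd_size assms)
  show "size (enc (foldl (\<lambda>T _. expand (M x) T) (map (\<lambda>v. if v = r x then [v] else []) [0..<length (M x)]) (take j (concat (M x)))))
     \<le> size (enc (M x)) * Suc (Suc (size (enc (M x))) * Suc (size (enc (M x))))" for x j
  proof -
    have "length (M x) \<le> size (enc (M x))" "length (take j (concat (M x))) \<le> size (enc (M x))"
      using length_le_size_enc[of "M x"] length_concat_le_size[of "M x"] by auto
    then have "length (M x) * Suc (Suc (length (take j (concat (M x)))) * Suc (length (M x)))
       \<le> size (enc (M x)) * Suc (Suc (size (enc (M x))) * Suc (size (enc (M x))))"
      by (intro mult_le_mono Suc_le_mono[THEN iffD2])
    then show ?thesis using paths_size le_trans by blast
  qed
qed (intro pt_intros assms[THEN pt_comp])+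

lemma pt_sym_or [pt_intros]:
  assumes "pt M" shows "pt (\<lambda>x. sym_or (M x))"
  unfolding sym_or_def matrix_def by (intro pt_intros assms[THEN pt_comp])

lemma pt_sym_and [pt_intros]:
  assumes "pt M" shows "pt (\<lambda>x. sym_and (M x))"
  unfolding sym_and_def matrix_def by (intro pt_intros assms[THEN pt_comp])

lemma pt_walks [pt_intros]:
  assumes "pt M" shows "pt (\<lambda>x. walks (M x))"
  unfolding walks_def by (intro pt_intros assms[THEN pt_comp])

lemma pt_closed_walks [pt_intros]:
  assumes "pt M" shows "pt (\<lambda>x. closed_walks (M x))"
  unfolding closed_walks_def by (intro pt_intros assms[THEN pt_comp])

lemma pt_prefix_list [pt_intros]:
  assumes "pt C" shows "pt (\<lambda>x. prefix_list (C x))"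
  unfolding prefix_list_def by (intro pt_intros assms[THEN pt_comp])

lemma pt_prefix_walks [pt_intros]:
  assumes "pt M" shows "pt (\<lambda>x. prefix_walks (M x))"
  unfolding prefix_walks_def by (intro pt_intros assms[THEN pt_comp])

lemma pt_all_paths [pt_intros]:
  assumes "pt M" shows "pt (\<lambda>x. all_paths (M x))"
  unfolding all_paths_def by (intro pt_intros assms[THEN pt_comp])

lemma pt_color_paths [pt_intros]:
  assumes "pt M" shows "pt (\<lambda>x. color_paths (M x))"
  unfolding color_paths_def by (intro pt_intros assms[THEN pt_comp])

lemma pt_exponents [pt_intros]:
  assumes "pt M" shows "pt (\<lambda>x. exponents (M x))"
  unfolding exponents_def by (intro pt_intros assms[THEN pt_comp])

lemma pt_amap [pt_intros]:
  assumes "pt A" "pt X" shows "pt (\<lambda>x. amap (A x) (X x))"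
  unfolding amap_def by (intro pt_intros assms[THEN pt_comp])

lemma pt_candidates [pt_intros]:
  assumes "pt MG" "pt MH" "pt A" "pt B" shows "pt (\<lambda>x. candidates (MG x) (MH x) (A x) (B x))"
  unfolding candidates_def by (intro pt_intros assms[THEN pt_comp])

lemma pt_starts [pt_intros]:
  assumes "pt MG" "pt A" "pt B" "pt S" shows "pt (\<lambda>x. starts (MG x) (A x) (B x) (S x))"
  unfolding starts_def by (intro pt_intros assms[THEN pt_comp])

lemma pt_hd0 [pt_intros]:
  assumes "pt l" shows "pt (\<lambda>x. hd0 (l x))"
  unfolding hd0_def by (intro pt_intros assms[THEN pt_comp])

lemma pt_movable [pt_intros]:
  assumes "pt MG" "pt MH" "pt R" "pt v" shows "pt (\<lambda>x. movable (MG x) (MH x) (R x) (v x))"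
  unfolding movable_def by (intro pt_intros assms[THEN pt_comp])

lemma pt_greedy_step [pt_intros]:
  assumes "pt MG" "pt MH" "pt st" shows "pt (\<lambda>x. greedy_step (MG x) (MH x) (st x))"
  unfolding greedy_step_def by (intro pt_intros assms[THEN pt_comp])

lemma hd0_le_size: "hd0 l \<le> size (enc l)"
  by (cases l) (auto simp: hd0_def)

text \<open>The remaining walks only shrink, and each round records at most one colouring, whose
  entries are bounded by their sizes.\<close>

lemma greedy_run_size:
  fixes xs :: "'c list"
  assumes n: "n = length MG + size (enc R)"
  shows "size (enc (foldl (\<lambda>st _. greedy_step MG MH st) (R, [map hd0 R]) xs))
     \<le> Suc (n * Suc n + Suc (length xs) * Suc (n * Suc n))" (is "size (enc (?st xs)) \<le> _")
proof -
  have *: "length (fst (?st xs)) \<le> n \<and> (\<forall>l\<in>set (fst (?st xs)). size (enc l) \<le> n) \<and>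
     length (snd (?st xs)) \<le> Suc (length xs) \<and> (\<forall>c\<in>set (snd (?st xs)). length c \<le> n \<and> (\<forall>a\<in>set c. a \<le> n))" for xs :: "'c list"
  proof (induction xs rule: rev_induct)
    case Nil
    have "hd0 l \<le> n" if "l \<in> set R" for l
      using hd0_le_size[of l] size_enc_member[OF that] n by linarith
    moreover have "size (enc l) \<le> n" if "l \<in> set R" for l
      using size_enc_member[OF that] n by linarith
    ultimately show ?case using length_le_size_enc[of R] n by auto
  next
    case (snoc x xs)
    let ?s = "?st xs"
    have b: "size (enc (nthd [] (fst ?s) w)) \<le> n" for w
      using snoc by (cases "w < length (fst ?s)") auto
    have b': "size (enc (tl l)) \<le> size (enc l)" for l :: "nat list" by (cases l) auto
    have b2: "size (enc (if P then tl (nthd [] (fst ?s) w) else nthd [] (fst ?s) w)) \<le> n" for w P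
      using b[of w] b'[of "nthd [] (fst ?s) w"] by (cases P) auto
    have b3: "hd0 (if P then tl (nthd [] (fst ?s) w) else nthd [] (fst ?s) w) \<le> n" for w P
      using b2[of P w] hd0_le_size le_trans by blast
    show ?case
    proof (cases "filter (movable MG MH (fst ?s)) [0..<length MG]")
      case Nil
      then have "greedy_step MG MH ?s = ?s" by (simp add: greedy_step_def)
      then show ?thesis using snoc by auto
    next
      case (Cons v vs)
      define g where "g w = (if w = v then tl (nthd [] (fst ?s) w) else nthd [] (fst ?s) w)" for w
      have step: "greedy_step MG MH ?s = (map g [0..<length MG], map (\<lambda>w. hd0 (g w)) [0..<length MG] # snd ?s)"
        using Cons by (simp add: greedy_step_def g_def)
      have g: "size (enc (g w)) \<le> n" "hd0 (g w) \<le> n" for w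
        unfolding g_def using b2[of "w = v" w] b3[of "w = v" w] by auto
      have "length MG \<le> n" using n by simp
      then show ?thesis using snoc g by (simp add: step)
    qed
  qed
  have l: "size (enc (fst (?st xs))) \<le> n * Suc n" using *[of xs] by (intro size_enc_list_le) auto
  have "size (enc c) \<le> n * Suc n" if "c \<in> set (snd (?st xs))" for c
    using *[of xs] that by (intro size_enc_list_le) auto
  then have "size (enc (snd (?st xs))) \<le> Suc (length xs) * Suc (n * Suc n)"
    using *[of xs] by (intro size_enc_list_le) auto
  then show ?thesis using l by (simp add: enc_prod_def)
qed

lemma pt_greedy_run [pt_intros]:
  assumes "pt MG" "pt MH" "pt R" shows "pt (\<lambda>x. greedy_run (MG x) (MH x) (R x))"
  unfolding greedy_run_def
proof (rule pt_foldl[where B = "\<lambda>x. let n = size (enc (MG x)) + size (enc (R x)) in Suc (n * Suc n + Suc n * Suc (n * Suc n))"])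
  show "pbd (\<lambda>x. let n = size (enc (MG x)) + size (enc (R x)) in Suc (n * Suc n + Suc n * Suc (n * Suc n)))"
    unfolding Let_def by (intro pbd_intros pt_pbd_size assms)
  show "size (enc (foldl (\<lambda>st _. greedy_step (MG x) (MH x) st) (R x, [map hd0 (R x)]) (take j (concat (R x)))))
     \<le> (let n = size (enc (MG x)) + size (enc (R x)) in Suc (n * Suc n + Suc n * Suc (n * Suc n)))" for x j
  proof -
    define n where "n = length (MG x) + size (enc (R x))"
    define k where "k = size (enc (MG x)) + size (enc (R x))"
    have "n \<le> k" "length (take j (concat (R x))) \<le> k"
      using length_le_size_enc[of "MG x"] length_concat_le_size[of "R x"] by (auto simp: n_def k_def)
    then have "Suc (n * Suc n + Suc (length (take j (concat (R x)))) * Suc (n * Suc n))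
       \<le> Suc (k * Suc k + Suc k * Suc (k * Suc k))"
      by (intro mult_le_mono add_le_mono Suc_le_mono[THEN iffD2])
    then show ?thesis using greedy_run_size[OF n_def] le_trans unfolding Let_def k_def by blast
  qed
qed (intro pt_intros assms[THEN pt_comp])+

lemma pt_greedy [pt_intros]:
  assumes "pt MG" "pt MH" "pt R" shows "pt (\<lambda>x. greedy (MG x) (MH x) (R x))"
  unfolding greedy_def by (intro pt_intros assms[THEN pt_comp])

lemma pt_solve [pt_intros]:
  assumes "pt MG" "pt MH" "pt A" "pt B" shows "pt (\<lambda>x. solve (MG x) (MH x) (A x) (B x))"
  unfolding solve_def by (intro pt_intros assms[THEN pt_comp])


subsection \<open>Recolouring sequences and runs\<close>

context recoloring
begin

lemma states_ne [simp]: "states \<phi> ms \<noteq> []" and hd_states [simp]: "hd (states \<phi> ms) = \<phi>"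
  by (cases ms; simp)+

lemma last_states: "last (states \<phi> ms) = final \<phi> ms"
  by (induction ms arbitrary: \<phi>) auto

lemma states_step:
  "ok \<phi> ms \<Longrightarrow> Suc i < length (states \<phi> ms) \<Longrightarrow>
    \<exists>u b. valid (states \<phi> ms ! i) u b \<and> states \<phi> ms ! Suc i = (states \<phi> ms ! i)(u := b)"
proof (induction ms arbitrary: \<phi> i)
  case (Cons m ms)
  show ?case
  proof (cases i)
    case 0
    have "states (\<phi>(fst m := snd m)) ms ! 0 = \<phi>(fst m := snd m)"
      using hd_states[of "\<phi>(fst m := snd m)" ms] by (simp only: hd_conv_nth[OF states_ne])
    then show ?thesis using 0 Cons.prems(1) by auto
  next
    case (Suc k)
    have "Suc k < length (states (\<phi>(fst m := snd m)) ms)" using Cons.prems(2) Suc by (simp only: states.simps length_Cons Suc_less_eq)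
    from Cons.IH[OF _ this] show ?thesis
      using Cons.prems(1) by (simp only: Suc ok.simps states.simps nth_Cons_Suc)
  qed
qed simp

lemma run_of_steps:
  assumes "\<sigma> \<noteq> []" "\<And>i. Suc i < length \<sigma> \<Longrightarrow> \<exists>u b. valid (\<sigma> ! i) u b \<and> \<sigma> ! Suc i = (\<sigma> ! i)(u := b)"
  shows "\<exists>ms. ok (hd \<sigma>) ms \<and> final (hd \<sigma>) ms = last \<sigma>"
  using assms
proof (induction \<sigma> rule: induct_list012)
  case (2 \<phi>)
  then show ?case by (intro exI[of _ "[]"]) simp
next
  case (3 \<phi> \<psi> \<sigma>)
  have "\<exists>u b. valid \<phi> u b \<and> \<psi> = \<phi>(u := b)"
  proof -
    have "Suc 0 < length (\<phi> # \<psi> # \<sigma>)" by simp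
    from 3(4)[OF this] show ?thesis by (simp only: nth_Cons_0 nth_Cons_Suc)
  qed
  then obtain u b where ub: "valid \<phi> u b" "\<psi> = \<phi>(u := b)" by blast
  have "\<exists>u b. valid ((\<psi> # \<sigma>) ! i) u b \<and> (\<psi> # \<sigma>) ! Suc i = ((\<psi> # \<sigma>) ! i)(u := b)"
    if "Suc i < length (\<psi> # \<sigma>)" for i
    using 3(4)[of "Suc i"] that by (simp only: nth_Cons_Suc length_Cons Suc_less_eq)
  then obtain ms where "ok \<psi> ms" "final \<psi> ms = last (\<psi> # \<sigma>)"
    using 3(2) unfolding list.sel by blast
  then have "ok \<phi> ((u, b) # ms)" "final \<phi> ((u, b) # ms) = last (\<phi> # \<psi> # \<sigma>)" using ub by simp_all
  then show ?case unfolding list.sel by blast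
qed simp

end

text \<open>Brings weak connectivity into the form assumed by
  \<open>instance_matrices\<close>.\<close>

lemma reachable_mk_symmetric_rtranclp:
  assumes "u \<rightarrow>\<^sup>*\<^bsub>with_proj (mk_symmetric (with_proj G))\<^esub> v"
  shows "(\<lambda>u v. (u, v) \<in> parcs G \<or> (v, u) \<in> parcs G)\<^sup>*\<^sup>* u v"
  using assms unfolding reachable_def
proof (induction rule: rtrancl_on_induct)
  case (step x y)
  then have "(x, y) \<in> parcs G \<or> (y, x) \<in> parcs G"
    by (auto simp: parcs_mk_symmetric with_proj_def arcs_ends_def arc_to_ends_def)
  then show ?case by (rule rtranclp.rtrancl_into_rtrancl[OF step.IH])
qed simp

lemma enc_list_map: "enc_list f (map g xs) = enc_list (\<lambda>x. f (g x)) xs"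
  by (induction xs) auto

definition adjacency :: "nat pair_pre_digraph \<Rightarrow> bool list list" where
  "adjacency G = matrix (card (pverts G)) (\<lambda>u v. (u, v) \<in> parcs G)"

lemma enc_adjacency: "enc_digraph G = enc (adjacency G)"
  by (simp add: enc_digraph_def adjacency_def matrix_def Let_def enc_list_def enc_bool_def enc_list_map)

lemma enc_table: "enc_map G \<phi> = enc (map \<phi> [0..<card (pverts G)])"
  by (simp add: enc_map_def enc_list_def enc_nat_def enc_list_map)

lemma enc_instance_eq:
  "enc_instance G H \<alpha> \<beta> = enc (adjacency G, adjacency H, map \<alpha> [0..<card (pverts G)], map \<beta> [0..<card (pverts G)])"
  by (simp add: enc_instance_def enc_adjacency enc_table)

lemma enc_answer:
  "enc (Some (map (\<lambda>\<phi>. map \<phi> [0..<card (pverts G)]) \<sigma>)) = enc_option (enc_list (enc_map G)) (Some \<sigma>)"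
proof -
  have "enc (map (\<lambda>\<phi>. map \<phi> [0..<card (pverts G)]) \<sigma>) = enc_list (enc_map G) \<sigma>"
    by (induction \<sigma>) (auto simp: enc_table)
  then show ?thesis by simp
qed

section \<open>Instances of the problem read as matrices\<close>

locale recoloring_problem =
  fixes G H :: "nat pair_pre_digraph" and \<alpha> \<beta> :: "nat \<Rightarrow> nat" and n m :: nat
  assumes instance_ok: "recoloring_instance G H \<alpha> \<beta>" and n: "n = card (pverts G)" and m: "m = card (pverts H)"
begin

lemma verts: "pverts G = {..<n}" "pverts H = {..<m}"
  using instance_ok unfolding recoloring_instance_def std_verts_def n m by blast+

lemma fin_digraphs: "pair_fin_digraph G" "pair_fin_digraph H"
  using instance_ok by (auto simp: recoloring_instance_def admissible_digraph_def)

lemma arcs_in_verts: "(u, v) \<in> parcs G \<Longrightarrow> u < n \<and> v < n" "(a, b) \<in> parcs H \<Longrightarrow> a < m \<and> b < m"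
proof -
  interpret G: pair_fin_digraph G by (rule fin_digraphs)
  interpret H: pair_fin_digraph H by (rule fin_digraphs)
  show "(u, v) \<in> parcs G \<Longrightarrow> u < n \<and> v < n" using G.arc_fst_in_verts G.arc_snd_in_verts verts by fastforce
  show "(a, b) \<in> parcs H \<Longrightarrow> a < m \<and> b < m" using H.arc_fst_in_verts H.arc_snd_in_verts verts by fastforce
qed

lemma look_adjacency: "look (adjacency G) u v \<longleftrightarrow> (u, v) \<in> parcs G" "look (adjacency H) u v \<longleftrightarrow> (u, v) \<in> parcs H"
  using arcs_in_verts unfolding adjacency_def look_matrix n[symmetric] m[symmetric] by blast+

lemma loops: "v < n \<Longrightarrow> (v, v) \<in> parcs G" "a < m \<Longrightarrow> (a, a) \<in> parcs H"
  using instance_ok verts by (auto simp: recoloring_instance_def reflexive_digraph_def)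

lemma homs: "\<alpha> \<in> digraph_hom G H" "\<beta> \<in> digraph_hom G H"
  using instance_ok by (auto simp: recoloring_instance_def)

lemma n_pos: "0 < n"
  using instance_ok by (simp add: recoloring_instance_def admissible_digraph_def n)

sublocale instance_matrices "adjacency G" "adjacency H" n m \<alpha> \<beta>
proof
  show "square n (adjacency G)" "square m (adjacency H)" by (simp_all add: adjacency_def square_matrix n m)
  show "look (adjacency H) (\<alpha> u) (\<alpha> v)" if "look (adjacency G) u v" for u v
    using homs(1) that by (auto simp: look_adjacency digraph_hom_def)
  show "(\<lambda>u v. look (adjacency G) u v \<or> look (adjacency G) v u)\<^sup>*\<^sup>* 0 v" if "v < n" for v
  proof -
    have "strongly_connected (with_proj (mk_symmetric (with_proj G)))"
      using instance_ok by (simp add: recoloring_instance_def admissible_digraph_def Digraph_Component.connected_def)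
    moreover have "0 \<in> verts (with_proj (mk_symmetric (with_proj G)))" "v \<in> verts (with_proj (mk_symmetric (with_proj G)))"
      using that n_pos verts by auto
    ultimately have "0 \<rightarrow>\<^sup>*\<^bsub>with_proj (mk_symmetric (with_proj G))\<^esub> v" by blast
    then show ?thesis unfolding look_adjacency by (rule reachable_mk_symmetric_rtranclp)
  qed
qed (use n_pos loops look_adjacency in auto)

lemma hom_step:
  assumes "\<phi> \<in> digraph_hom G H" "valid \<phi> u b"
  shows "\<phi>(u := b) \<in> digraph_hom G H"
proof -
  have "hom \<phi>" using assms(1) by (auto simp: hom_def digraph_hom_def look_adjacency)
  then have hom: "hom (\<phi>(u := b))" using assms(2) by (rule hom_valid)
  have "u \<in> pverts G" "b \<in> pverts H"
    using assms(2) verts arcs_in_verts(2)[of b b] by (auto simp: valid_def look_adjacency)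
  then have "\<phi>(u := b) \<in> pverts G \<rightarrow>\<^sub>E pverts H"
    using assms(1) by (auto simp: digraph_hom_def PiE_iff extensional_def)
  moreover have "\<forall>(x, y) \<in> parcs G. ((\<phi>(u := b)) x, (\<phi>(u := b)) y) \<in> parcs H"
    using hom unfolding hom_def look_adjacency by blast
  ultimately show ?thesis unfolding digraph_hom_def by blast
qed

lemma valid_hom1_adj:
  assumes "\<phi> \<in> digraph_hom G H" "valid \<phi> u b"
  shows "hom1_adj G H \<phi> (\<phi>(u := b))"
proof -
  have "\<exists>!w. w \<in> pverts G \<and> \<phi> w \<noteq> (\<phi>(u := b)) w"
    using assms(2) verts by (intro ex1I[of _ u]) (auto simp: valid_def split: if_splits)
  moreover have "(\<phi> x, (\<phi>(u := b)) y) \<in> parcs H" if "(x, y) \<in> parcs G" for x y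
    using assms that by (auto simp: digraph_hom_def valid_def look_adjacency)
  ultimately show ?thesis unfolding hom1_adj_def using assms(1) hom_step[OF assms] by blast
qed

text \<open>The loop at \<open>u\<close> turns the one-sided condition on arcs into the arc from the
  old to the new colour. An out-neighbour that shares the old colour gives the reverse arc, as
  \<psi> is a homomorphism.\<close>

lemma hom1_adj_valid:
  assumes "hom1_adj G H \<phi> \<psi>"
    and pp: "\<And>u v. u \<in> pverts G \<Longrightarrow> \<phi> u \<noteq> \<psi> u \<Longrightarrow> v \<in> neighbors G u \<Longrightarrow> \<phi> v \<in> {\<phi> u, \<psi> u}"
  shows "\<exists>u b. valid \<phi> u b \<and> \<psi> = \<phi>(u := b)"
proof -
  have "\<exists>!u. u \<in> pverts G \<and> \<phi> u \<noteq> \<psi> u"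
    using assms(1) unfolding hom1_adj_def by (elim conjE)
  then obtain u where u: "u \<in> pverts G" "\<phi> u \<noteq> \<psi> u" "\<And>w. w \<in> pverts G \<Longrightarrow> \<phi> w \<noteq> \<psi> w \<Longrightarrow> w = u"
    by (rule ex1E) blast
  have \<phi>: "\<phi> \<in> digraph_hom G H" and \<psi>: "\<psi> \<in> digraph_hom G H"
    and arcs: "\<And>x y. (x, y) \<in> parcs G \<Longrightarrow> (\<phi> x, \<psi> y) \<in> parcs H"
    using assms(1) unfolding hom1_adj_def by blast+
  have eq: "\<psi> w = \<phi> w" if "w \<noteq> u" for w
  proof (cases "w \<in> pverts G")
    case True
    then show ?thesis using u(3)[OF True] that by fastforce
  next
    case False
    then show ?thesis using \<phi> \<psi> by (auto simp: digraph_hom_def PiE_iff extensional_def)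
  qed
  have uu: "(u, u) \<in> parcs G" using loops(1) u(1) verts by auto
  have \<psi>h: "(\<psi> x, \<psi> y) \<in> parcs H" if "(x, y) \<in> parcs G" for x y using \<psi> that by (auto simp: digraph_hom_def)
  have "valid \<phi> u (\<psi> u)"
    unfolding valid_def look_adjacency
  proof (intro conjI allI impI)
    fix w assume "w \<noteq> u"
    { assume "(u, w) \<in> parcs G"
      then have "\<phi> w = \<phi> u \<or> \<phi> w = \<psi> u" "(\<psi> u, \<phi> w) \<in> parcs H"
        using pp[OF u(1,2), of w] \<psi>h[of u w] eq[OF \<open>w \<noteq> u\<close>] by (auto simp: neighbors_def)
      then show "\<phi> w = \<psi> u \<or> \<phi> w = \<phi> u \<and> (\<psi> u, \<phi> u) \<in> parcs H" by auto }
    { assume "(w, u) \<in> parcs G"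
      then show "\<phi> w = \<phi> u \<or> \<phi> w = \<psi> u" using pp[OF u(1,2), of w] by (auto simp: neighbors_def) }
  qed (use u(1,2) verts(1) arcs[OF uu] \<psi>h[OF uu] in simp_all)
  moreover have "\<psi> = \<phi>(u := \<psi> u)" using eq by auto
  ultimately show ?thesis by blast
qed

lemma recoloring_seq_states:
  assumes ok: "ok \<alpha> ms" and fin: "final \<alpha> ms = \<beta>"
  shows "recoloring_seq G H \<alpha> \<beta> (states \<alpha> ms) \<and> push_or_pull G (states \<alpha> ms)"
proof -
  let ?\<sigma> = "states \<alpha> ms"
  have inG: "?\<sigma> ! i \<in> digraph_hom G H" if "i < length ?\<sigma>" for i
    using that
  proof (induction i)
    case 0
    then show ?case using homs(1) hd_conv_nth[OF states_ne, of \<alpha> ms] by simp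
  next
    case (Suc i)
    then obtain u b where ub: "valid (?\<sigma> ! i) u b" "?\<sigma> ! Suc i = (?\<sigma> ! i)(u := b)"
      using states_step[OF ok Suc.prems] by blast
    show ?case unfolding ub(2) by (rule hom_step[OF Suc.IH ub(1)]) (use Suc.prems in simp)
  qed
  have "set ?\<sigma> \<subseteq> digraph_hom G H" using inG by (auto simp: in_set_conv_nth)
  moreover have "hom1_adj G H (?\<sigma> ! i) (?\<sigma> ! Suc i)" if i: "Suc i < length ?\<sigma>" for i
    using states_step[OF ok i] inG[of i] i valid_hom1_adj by fastforce
  moreover have "push_or_pull G ?\<sigma>"
    unfolding push_or_pull_def
  proof (intro allI impI ballI)
    fix i u v assume i: "Suc i < length ?\<sigma>" and d: "(?\<sigma> ! i) u \<noteq> (?\<sigma> ! Suc i) u" and v: "v \<in> neighbors G u"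
    obtain u' b where ub: "valid (?\<sigma> ! i) u' b" "?\<sigma> ! Suc i = (?\<sigma> ! i)(u' := b)" using states_step[OF ok i] by blast
    have "u' = u" using d ub(2) by (auto split: if_splits)
    then show "(?\<sigma> ! i) v \<in> {(?\<sigma> ! i) u, (?\<sigma> ! Suc i) u}"
      using ub v by (cases "v = u") (auto simp: valid_def neighbors_def look_adjacency)
  qed
  ultimately show ?thesis using last_states[of \<alpha> ms] fin by (simp add: recoloring_seq_def)
qed

lemma run_of_recoloring_seq:
  assumes "recoloring_seq G H \<alpha> \<beta> \<sigma>" "push_or_pull G \<sigma>"
  shows "\<exists>ms. ok \<alpha> ms \<and> final \<alpha> ms = \<beta>"
proof -
  have "\<exists>u b. valid (\<sigma> ! i) u b \<and> \<sigma> ! Suc i = (\<sigma> ! i)(u := b)" if "Suc i < length \<sigma>" for i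
    by (rule hom1_adj_valid) (use assms that in \<open>auto simp: recoloring_seq_def push_or_pull_def\<close>)
  then show ?thesis using run_of_steps[of \<sigma>] assms(1) by (auto simp: recoloring_seq_def)
qed

lemma solve_answer:
  obtains ans where "correct_answer G H \<alpha> \<beta> ans"
    "enc (solve (adjacency G) (adjacency H) (map \<alpha> [0..<n]) (map \<beta> [0..<n])) = enc_option (enc_list (enc_map G)) ans"
proof (cases "solve (adjacency G) (adjacency H) (map \<alpha> [0..<n]) (map \<beta> [0..<n])")
  case None
  then have "\<nexists>ms. ok \<alpha> ms \<and> final \<alpha> ms = \<beta>" using solve_correct by simp
  then have "correct_answer G H \<alpha> \<beta> None" using run_of_recoloring_seq by (auto simp: correct_answer_def)
  then show thesis by (rule that) (simp add: None)
next
  case (Some t)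
  then obtain ms where ms: "ok \<alpha> ms" "\<And>v. v < n \<Longrightarrow> final \<alpha> ms v = \<beta> v" "t = map (\<lambda>\<phi>. map \<phi> [0..<n]) (states \<alpha> ms)"
    using solve_correct by auto
  \<comment> \<open>\<open>solve\<close> sees \<beta> on the vertices only; elsewhere both
    colourings are \<open>undefined\<close>, being extensional.\<close>
  have "final \<alpha> ms v = \<beta> v" for v
  proof (cases "v < n")
    case False
    then have "final \<alpha> ms v = \<alpha> v" using tr_outside[OF ms(1), of v] last_tr[of \<alpha> ms v] by simp
    moreover have "v \<notin> pverts G" using False verts(1) by auto
    ultimately show ?thesis using homs by (auto simp: digraph_hom_def PiE_iff extensional_def)
  qed (use ms in auto)
  then have "correct_answer G H \<alpha> \<beta> (Some (states \<alpha> ms))"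
    using recoloring_seq_states[OF ms(1)] by (auto simp: correct_answer_def)
  then show thesis by (rule that) (unfold Some ms(3), unfold n, rule enc_answer)
qed

end

theorem theorem38:
  shows "\<exists>(prog :: com) (p :: nat poly).
    \<forall>(G :: nat pair_pre_digraph) (H :: nat pair_pre_digraph) (\<alpha> :: nat \<Rightarrow> nat) (\<beta> :: nat \<Rightarrow> nat).
      recoloring_instance G H \<alpha> \<beta> \<longrightarrow>
      (\<exists>(t :: nat) (ans :: (nat \<Rightarrow> nat) list option).
         runs prog (enc_instance G H \<alpha> \<beta>) t (enc_option (enc_list (enc_map G)) ans) \<and>
         t \<le> poly p (size (enc_instance G H \<alpha> \<beta>)) \<and>
         correct_answer G H \<alpha> \<beta> ans)"
proof -
  let ?f = "\<lambda>x :: bool list list \<times> bool list list \<times> nat list \<times> nat list.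
    solve (fst x) (fst (snd x)) (fst (snd (snd x))) (snd (snd (snd x)))"
  have "pt ?f" by (intro pt_intros)
  then obtain prog K T where T: "pbd T" and prog: "computes prog K T ?f" unfolding pt_def by blast
  obtain k where k: "\<And>x. T x \<le> (size (enc x) + 2) ^ k" using T unfolding pbd_def by blast
  \<comment> \<open>The time bound is a power of the size plus 2, which is the value of this
    polynomial at the size.\<close>
  have poly: "poly ([:2, 1:] ^ k) s = (s + 2) ^ k" for s :: nat by (simp add: poly_power add.commute)
  have "\<exists>t ans. runs prog (enc_instance G H \<alpha> \<beta>) t (enc_option (enc_list (enc_map G)) ans) \<and>
      t \<le> poly ([:2, 1:] ^ k) (size (enc_instance G H \<alpha> \<beta>)) \<and> correct_answer G H \<alpha> \<beta> ans"
    if inst: "recoloring_instance G H \<alpha> \<beta>" for G H \<alpha> \<beta>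
  proof -
    interpret recoloring_problem G H \<alpha> \<beta> "card (pverts G)" "card (pverts H)"
      by unfold_locales (rule inst refl)+
    define x where "x = (adjacency G, adjacency H, map \<alpha> [0..<card (pverts G)], map \<beta> [0..<card (pverts G)])"
    have x: "enc_instance G H \<alpha> \<beta> = enc x" by (simp only: enc_instance_eq x_def)
    obtain ans where ans: "correct_answer G H \<alpha> \<beta> ans" "enc (?f x) = enc_option (enc_list (enc_map G)) ans"
      using solve_answer unfolding x_def by auto
    have "exe prog ((\<lambda>_. Leaf)(0 := enc x)) (T x) (\<lambda>s'. s' 0 = enc (?f x) \<and> (\<forall>i\<ge>K. s' i = ((\<lambda>_. Leaf)(0 := enc x)) i))"
      by (rule computesD[OF prog]) simp
    then obtain t s' where "exec prog ((\<lambda>_. Leaf)(0 := enc x)) t s'" "t \<le> T x" "s' 0 = enc (?f x)"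
      unfolding exe_def by blast
    then have "runs prog (enc x) t (enc_option (enc_list (enc_map G)) ans)" "t \<le> (size (enc x) + 2) ^ k"
      using ans(2) k[of x] by (auto simp: runs_def)
    then show ?thesis using ans(1) poly x by metis
  qed
  then show ?thesis by blast
qed

end
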